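(* Let $G$ be a (topologically) finitely generated profinite group. If $\tilde\Gamma_{\mathrm{virt}}(G)$ contains a non-trivial isolated vertex $g$ (that is, an isolated vertex $g\neq 1$), then either $g$ is a topological generator of $G$ (that is, $G=\langle g\rangle$) or one of the following occurs: (1) $G\cong C_{p^n}$ is a cyclic group of $p$-power order for some prime $p$, and all the vertices of $\tilde\Gamma_{\mathrm{virt}}(G)$ are isolated; (2) $G\cong\mathbb Z_p$, the group of the $p$-adic integers for some prime $p$, and all the vertices of $\tilde\Gamma_{\mathrm{virt}}(G)$ are isolated; (3) $G\cong Q_{2^n}=\langle x,y\mid x^{2^{n-1}}=1,\ y^2=x^{2^{n-2}},\ y^{-1}xy=x^{-1}\rangle$ is a generalized quaternion group ($n\ge 3$), and $g=y^2$ is the unique non-trivial isolated vertex of $\tilde\Gamma_{\mathrm{virt}}(G)$.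
   Context: Generation is always topological. A generating set $X$ of a profinite group $H$ is minimal if no proper subset of $X$ topologically generates $H$. Two elements $x,y$ of a profinite group $G$ are virtually independent if there exists a minimal generating set of some open subgroup of $G$ containing both $x$ and $y$. The virtually independence graph $\tilde\Gamma_{\mathrm{virt}}(G)$ is the graph whose vertices are the elements of $G$ and in which two (distinct) vertices are joined by an edge if and only if they are virtually independent. The "either/or" is inclusive. *)

theory Defs
  imports
    "HOL-Analysis.Analysis"
    "HOL-Computational_Algebra.Primes"
    "HOL-Algebra.Generated_Groups"
    "HOL-Algebra.Elementary_Groups"
    "HOL-Algebra.Product_Groups"
begin

section \<open>Profinite groups\<close>

locale topological_group = group G for G (structure) and T :: "'a topology" +
  assumes topspace_eq: "topspace T = carrier G"
    and continuous_mult: "continuous_map (prod_topology T T) T (\<lambda>(x, y). x \<otimes> y)"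
    and continuous_inv: "continuous_map T T (\<lambda>x. inv x)"

definition totally_disconnected_space :: "'a topology \<Rightarrow> bool" where
  "totally_disconnected_space T \<longleftrightarrow> (\<forall>S. connectedin T S \<longrightarrow> (\<exists>a. S \<subseteq> {a}))"

locale profinite_group = topological_group +
  assumes compact: "compact_space T"
    and Hausdorff: "Hausdorff_space T"
    and totally_disconnected: "totally_disconnected_space T"

definition top_iso ::
    "('a, 'c) monoid_scheme \<Rightarrow> 'a topology \<Rightarrow> ('b, 'd) monoid_scheme \<Rightarrow> 'b topology \<Rightarrow> ('a \<Rightarrow> 'b) set" where
  "top_iso G T H U = {h. h \<in> iso G H \<and> homeomorphic_map T U h}"


section \<open>Topological generation and the virtually independence graph\<close>

definition top_generates :: "('a, 'c) monoid_scheme \<Rightarrow> 'a topology \<Rightarrow> 'a set \<Rightarrow> bool" where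
  "top_generates G T X \<longleftrightarrow> X \<subseteq> carrier G \<and> T closure_of (generate G X) = carrier G"

definition top_finitely_generated :: "('a, 'c) monoid_scheme \<Rightarrow> 'a topology \<Rightarrow> bool" where
  "top_finitely_generated G T \<longleftrightarrow> (\<exists>X. finite X \<and> top_generates G T X)"

definition minimal_generating_set :: "('a, 'c) monoid_scheme \<Rightarrow> 'a topology \<Rightarrow> 'a set \<Rightarrow> bool" where
  "minimal_generating_set G T X \<longleftrightarrow>
     top_generates G T X \<and> (\<forall>Y. Y \<subset> X \<longrightarrow> \<not> top_generates G T Y)"

definition virtually_independent ::
    "('a, 'c) monoid_scheme \<Rightarrow> 'a topology \<Rightarrow> 'a \<Rightarrow> 'a \<Rightarrow> bool" where
  "virtually_independent G T x y \<longleftrightarrow>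
     (\<exists>H X. subgroup H G \<and> openin T H \<and>
            minimal_generating_set (G\<lparr>carrier := H\<rparr>) (subtopology T H) X \<and> x \<in> X \<and> y \<in> X)"

text \<open>A simple graph is a pair of a vertex set and a set of two-element edges.\<close>

type_synonym 'v graph = "'v set \<times> 'v set set"

definition isolated_vertex :: "'v graph \<Rightarrow> 'v \<Rightarrow> bool" where
  "isolated_vertex \<Gamma> v \<longleftrightarrow> v \<in> fst \<Gamma> \<and> (\<forall>e \<in> snd \<Gamma>. v \<notin> e)"

definition virt_graph :: "('a, 'c) monoid_scheme \<Rightarrow> 'a topology \<Rightarrow> 'a graph" where
  "virt_graph G T =
     (carrier G,
      {{x, y} | x y. x \<in> carrier G \<and> y \<in> carrier G \<and> x \<noteq> y \<and> virtually_independent G T x y})"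


section \<open>The additive group of the p-adic integers\<close>

text \<open>
  The inverse limit of the groups of integers modulo \<open>p ^ k\<close>, inside their product; the k-th
  coordinate is the residue in \<open>{0..<p ^ k}\<close>.
\<close>

definition padic_int_group :: "nat \<Rightarrow> (nat \<Rightarrow> int) monoid" where
  "padic_int_group p =
     (let P = product_group UNIV (\<lambda>k. integer_mod_group (p ^ k))
      in P\<lparr>carrier := {f \<in> carrier P. \<forall>k. f (Suc k) mod int (p ^ k) = f k}\<rparr>)"

definition padic_int_topology :: "nat \<Rightarrow> (nat \<Rightarrow> int) topology" where
  "padic_int_topology p =
     subtopology
       (product_topology (\<lambda>k. discrete_topology (carrier (integer_mod_group (p ^ k)))) UNIV)
       (carrier (padic_int_group p))"

lemma group_padic_int_group:
  assumes "p > 0"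
  shows "group (padic_int_group p)"
proof -
  let ?P = "product_group UNIV (\<lambda>k. integer_mod_group (p ^ k))"
  let ?H = "{f \<in> carrier ?P. \<forall>k. f (Suc k) mod int (p ^ k) = f k}"
  have gP: "group ?P"
    by simp
  have C: "carrier (integer_mod_group (p ^ k)) = {0..<int (p ^ k)}" for k
    using assms by (simp add: carrier_integer_mod_group)
  have modmod: "a mod int (p ^ Suc k) mod int (p ^ k) = a mod int (p ^ k)" for a :: int and k
    by (rule mod_mod_cancel) simp
  have in_H: "(\<lambda>k. F k mod int (p ^ k)) \<in> ?H"
    if "\<And>k. F (Suc k) mod int (p ^ k) = F k mod int (p ^ k)" for F :: "nat \<Rightarrow> int"
    using assms that modmod by (simp add: C PiE_iff del: of_nat_power power_Suc)
  have "subgroup ?H ?P"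
  proof (rule group.subgroupI[OF gP])
    show "?H \<noteq> {}"
      using in_H[of "\<lambda>_. 0"] by blast
    show "inv\<^bsub>?P\<^esub> f \<in> ?H" if f: "f \<in> ?H" for f
    proof -
      have "inv\<^bsub>?P\<^esub> f = (\<lambda>k. (- f k) mod int (p ^ k))"
        using f by (subst inv_product_group) (auto simp: fun_eq_iff PiE_iff)
      moreover have "(- f (Suc k)) mod int (p ^ k) = (- f k) mod int (p ^ k)" for k
      proof -
        have "f k = f (Suc k) mod int (p ^ k)"
          using f by simp
        then show ?thesis
          by (simp only: mod_minus_eq)
      qed
      ultimately show ?thesis
        using in_H[of "\<lambda>k. - f k"] by simp
    qed
    show "f \<otimes>\<^bsub>?P\<^esub> g \<in> ?H" if fg: "f \<in> ?H" "g \<in> ?H" for f g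
    proof -
      have "f \<otimes>\<^bsub>?P\<^esub> g = (\<lambda>k. (f k + g k) mod int (p ^ k))"
        by (auto simp: fun_eq_iff)
      moreover have "(f (Suc k) + g (Suc k)) mod int (p ^ k) = (f k + g k) mod int (p ^ k)" for k
      proof -
        have "f k = f (Suc k) mod int (p ^ k)" "g k = g (Suc k) mod int (p ^ k)"
          using fg by simp_all
        then show ?thesis
          by (simp only: mod_add_eq)
      qed
      ultimately show ?thesis
        using in_H[of "\<lambda>k. f k + g k"] by simp
    qed
  qed simp
  from group.subgroup_imp_group[OF gP this] show ?thesis
    by (simp add: padic_int_group_def Let_def)
qed


section \<open>Group presentations and generalized quaternion groups\<close>

text \<open>
  In a word, \<open>(a, True)\<close> stands for the generator \<open>a\<close> and \<open>(a, False)\<close> for its formal inverse.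
  A relation \<open>r = s\<close> is given as the pair \<open>(r, s)\<close>.
\<close>

type_synonym 'g word = "('g \<times> bool) list"

inductive pres_eq :: "('g word \<times> 'g word) set \<Rightarrow> 'g word \<Rightarrow> 'g word \<Rightarrow> bool"
  for R :: "('g word \<times> 'g word) set" where
  refl: "pres_eq R u u"
| sym: "pres_eq R u v \<Longrightarrow> pres_eq R v u"
| trans: "pres_eq R u v \<Longrightarrow> pres_eq R v w \<Longrightarrow> pres_eq R u w"
| cancel: "pres_eq R (u @ [(a, b), (a, \<not> b)] @ v) (u @ v)"
| rel: "(r, s) \<in> R \<Longrightarrow> pres_eq R (u @ r @ v) (u @ s @ v)"

definition pres_class :: "('g word \<times> 'g word) set \<Rightarrow> 'g word \<Rightarrow> 'g word set" where
  "pres_class R u = {v. pres_eq R u v}"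

text \<open>The set of generators is the whole type \<open>'g\<close>.\<close>

definition presented_group :: "('g word \<times> 'g word) set \<Rightarrow> 'g word set monoid" where
  "presented_group R =
     \<lparr>carrier = range (pres_class R),
      monoid.mult = (\<lambda>A B. \<Union>u\<in>A. \<Union>v\<in>B. pres_class R (u @ v)),
      one = pres_class R []\<rparr>"

lemma pres_class_eq_iff: "pres_class R u = pres_class R v \<longleftrightarrow> pres_eq R u v"
proof
  assume "pres_class R u = pres_class R v"
  then show "pres_eq R u v"
    unfolding pres_class_def using pres_eq.refl[of R v] by blast
next
  assume uv: "pres_eq R u v"
  have "pres_eq R u w \<longleftrightarrow> pres_eq R v w" for w
    using pres_eq.trans[OF uv] pres_eq.trans[OF pres_eq.sym[OF uv]] by blast
  then show "pres_class R u = pres_class R v"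
    by (simp add: pres_class_def)
qed

lemma pres_eq_context: "pres_eq R u v \<Longrightarrow> pres_eq R (a @ u @ b) (a @ v @ b)"
proof (induction rule: pres_eq.induct)
  case (refl u)
  show ?case
    by (rule pres_eq.refl)
next
  case (sym u v)
  from sym.IH show ?case
    by (rule pres_eq.sym)
next
  case (trans u v w)
  from trans.IH show ?case
    by (rule pres_eq.trans)
next
  case (cancel u x y v)
  show ?case
    using pres_eq.cancel[of R "a @ u" x y "v @ b"] by simp
next
  case (rel r s u v)
  then show ?case
    using pres_eq.rel[of r s R "a @ u" "v @ b"] by simp
qed

lemma pres_eq_append:
  assumes "pres_eq R u u'" "pres_eq R v v'"
  shows "pres_eq R (u @ v) (u' @ v')"
proof (rule pres_eq.trans)
  show "pres_eq R (u @ v) (u' @ v)"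
    using pres_eq_context[OF assms(1), of "[]" v] by simp
  show "pres_eq R (u' @ v) (u' @ v')"
    using pres_eq_context[OF assms(2), of u' "[]"] by simp
qed

lemma carrier_presented_group: "carrier (presented_group R) = range (pres_class R)"
  by (simp add: presented_group_def)

lemma one_presented_group: "\<one>\<^bsub>presented_group R\<^esub> = pres_class R []"
  by (simp add: presented_group_def)

lemma presented_group_mult:
  "pres_class R u \<otimes>\<^bsub>presented_group R\<^esub> pres_class R v = pres_class R (u @ v)"
proof -
  have eq: "pres_class R (u' @ v') = pres_class R (u @ v)"
    if "u' \<in> pres_class R u" "v' \<in> pres_class R v" for u' v'
  proof -
    have "pres_eq R (u @ v) (u' @ v')"
      using that by (intro pres_eq_append) (simp_all add: pres_class_def)
    then show ?thesis
      using pres_class_eq_iff by blast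
  qed
  have ne: "u \<in> pres_class R u" "v \<in> pres_class R v"
    by (simp_all add: pres_class_def pres_eq.refl)
  have "(\<Union>u'\<in>pres_class R u. \<Union>v'\<in>pres_class R v. pres_class R (u' @ v'))
      = (\<Union>u'\<in>pres_class R u. \<Union>v'\<in>pres_class R v. pres_class R (u @ v))"
    by (simp add: eq cong: SUP_cong)
  also have "\<dots> = pres_class R (u @ v)"
    using ne by blast
  finally show ?thesis
    by (simp add: presented_group_def)
qed

lemma pres_eq_inverse: "pres_eq R (map (\<lambda>(a, b). (a, \<not> b)) (rev u) @ u) []"
proof (induction u)
  case Nil
  show ?case
    by (simp add: pres_eq.refl)
next
  case (Cons x u)
  obtain a b where x: "x = (a, b)"
    by (cases x)
  have "pres_eq R (map (\<lambda>(a, b). (a, \<not> b)) (rev u) @ [(a, \<not> b), (a, \<not> \<not> b)] @ u)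
          (map (\<lambda>(a, b). (a, \<not> b)) (rev u) @ u)"
    by (rule pres_eq.cancel)
  from pres_eq.trans[OF this Cons.IH] show ?case
    by (simp add: x)
qed

lemma group_presented_group: "group (presented_group R)"
proof (rule groupI)
  fix A assume "A \<in> carrier (presented_group R)"
  then obtain u where A: "A = pres_class R u"
    by (auto simp: carrier_presented_group)
  let ?B = "pres_class R (map (\<lambda>(a, b). (a, \<not> b)) (rev u))"
  have "?B \<otimes>\<^bsub>presented_group R\<^esub> A = \<one>\<^bsub>presented_group R\<^esub>"
    using pres_eq_inverse[of R u]
    by (simp only: A presented_group_mult one_presented_group pres_class_eq_iff)
  then show "\<exists>B\<in>carrier (presented_group R). B \<otimes>\<^bsub>presented_group R\<^esub> A = \<one>\<^bsub>presented_group R\<^esub>"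
    unfolding carrier_presented_group by blast
qed (auto simp: carrier_presented_group one_presented_group presented_group_mult)

datatype quat_gen = QX | QY

definition quaternion_rels :: "nat \<Rightarrow> (quat_gen word \<times> quat_gen word) set" where
  "quaternion_rels n =
     {(replicate (2 ^ (n - 1)) (QX, True), []),
      ([(QY, True), (QY, True)], replicate (2 ^ (n - 2)) (QX, True)),
      ([(QY, False), (QX, True), (QY, True)], [(QX, False)])}"

definition quaternion_group :: "nat \<Rightarrow> quat_gen word set monoid" where
  "quaternion_group n = presented_group (quaternion_rels n)"

definition quaternion_y :: "nat \<Rightarrow> quat_gen word set" where
  "quaternion_y n = pres_class (quaternion_rels n) [(QY, True)]"

end

(* If g is isolated and M is an open subgroup that does not contain g, then g belongs to a minimal
   generating set of <M, g>; this set is {g}, so M is contained in C = <g>.  Hence C is open and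
   every x outside C satisfies g : <x>; in particular C is central, and G/C is a finite p-group for a
   single prime p.  A central element of order p of G/C lifts to k with k^p = g.  If x outside C
   also satisfies x^p = g, then [k, x] is central of order dividing p, and u = k x^-1 satisfies u^p = 1
   if p is odd and u^4 = 1 if p = 2.  Since g lies in <u> unless u is in C, this forces u in C, hence k
   in <x>, except when p = 2 and g^2 = 1.  So outside the exceptional case k inherits the property of g, and climbing up
   the finitely many subgroups above C shows that G is procyclic and pro-p.  In the exceptional case
   the same applies to the centralizer <a> of k; an element y outside <a> satisfies y^2 = g = (y a)^2,
   hence inverts a, and G is generalized quaternion. *)

theory Submission
  imports Defs
    "HOL-Algebra.Sylow"
    "HOL-Algebra.Group_Action"
    "HOL-Algebra.Multiplicative_Group"
    "HOL-Algebra.SndIsomorphismGrp"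
    "HOL-Number_Theory.Cong"
begin

section \<open>Finite groups\<close>

text \<open>If x lies outside C and x^p lies in C, then <x^p> = C, and therefore <g^q> = C for every
  prime q other than p. Two such primes p would make C divisible by all primes, which a nontrivial
  procyclic profinite group never is; so there is only one, <g^p> is smaller than C, and every p-th
  root of g lies outside C. For u = k x^-1 one finds u^p = v^(p(p-1)/2), where v is a commutator
  with v^p = 1. The exponent is a multiple of p exactly when p is odd: this parity is the source of
  the quaternion exception, and the climb therefore carries the condition k^2 different from 1
  along. The argument is run in G and again inside a centralizer, so it is phrased for an abstract
  map \<open>cyc\<close> with a few closure properties that restrict to subgroups. Finite generation
  serves to find a minimal generating set inside a finite generating set. In the two cyclic cases
  all vertices are isolated because the closed procyclic subgroups form a chain.\<close>

lemma (in group) pow_mem_coprime: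
  assumes H: "subgroup H G" and x: "x \<in> carrier G"
    and a: "x [^] (a::nat) \<in> H" and b: "x [^] (b::nat) \<in> H" and ab: "coprime a b"
  shows "x \<in> H"
proof -
  obtain s t :: int where st: "s * int a + t * int b = 1"
    using ab bezout_int[of "int a" "int b"] by auto
  have "(x [^] a) [^] s \<otimes> (x [^] b) [^] t \<in> H"
    using a b H by (simp add: subgroup_int_pow_closed subgroup.m_closed)
  moreover have "(x [^] a) [^] s \<otimes> (x [^] b) [^] t = x [^] (int a * s + int b * t)"
    using x by (simp add: int_pow_pow int_pow_mult flip: int_pow_int)
  ultimately show ?thesis
    using st x by (simp add: mult.commute int_pow_1)
qed

lemma (in group) nat_pow_mem_subgroup:
  assumes "subgroup H G" "x \<in> H" shows "x [^] (n::nat) \<in> H"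
  using subgroup_int_pow_closed[OF assms, of "int n"] by (simp add: int_pow_int)

text \<open>Sylow's theorem with exponent 1 yields a subgroup of order \<open>q\<close>, in which
  every nontrivial element will do.\<close>

lemma (in group) Cauchy:
  assumes "prime q" "q dvd order G" "finite (carrier G)"
  obtains x where "x \<in> carrier G" "x \<noteq> \<one>" "x [^] q = \<one>"
proof -
  obtain m where "order G = q ^ 1 * m" using assms(2) by auto
  then obtain H where H: "subgroup H G" "card H = q"
    using sylow_thm[OF assms(1) is_group _ assms(3), of 1 m] by auto
  then have "H \<noteq> {\<one>}" using assms(1) by force
  then obtain x where x: "x \<in> H" "x \<noteq> \<one>"
    using H subgroup.one_closed by blast
  interpret K: group "G\<lparr>carrier := H\<rparr>" using H(1) by (rule subgroup_imp_group)
  have "x [^]\<^bsub>G\<lparr>carrier := H\<rparr>\<^esub> q = \<one>"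
    using K.pow_order_eq_1[of x] x H by (simp add: order_def)
  then have "x [^] q = \<one>" by (simp add: nat_pow_consistent[symmetric])
  then show thesis using that x H subgroup.mem_carrier by metis
qed

text \<open>By \<open>Cauchy\<close> every prime divisor of the order occurs as the order of an
  element, so \<open>p\<close> is the only candidate.\<close>

lemma (in group) order_prime_power:
  assumes fin: "finite (carrier G)"
    and ord: "\<And>x q. x \<in> carrier G \<Longrightarrow> x \<noteq> \<one> \<Longrightarrow> prime q \<Longrightarrow> x [^] q = \<one> \<Longrightarrow> q = p"
    and p: "prime p"
  shows "\<exists>k. order G = p ^ k"
proof -
  have pos: "order G > 0" using fin order_gt_0_iff_finite by blast
  have "prime_factors (order G) \<subseteq> {p}"
  proof
    fix q assume "q \<in> prime_factors (order G)"
    then have q: "prime q" "q dvd order G" by auto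
    from Cauchy[OF q fin] ord q(1) show "q \<in> {p}" by auto
  qed
  moreover have "order G = (\<Prod>q\<in>prime_factors (order G). q ^ multiplicity q (order G))"
    using prod_prime_factors[of "order G"] pos by simp
  ultimately have "order G = 1 \<or> order G = p ^ multiplicity p (order G)"
    by (auto simp: subset_singleton_iff)
  then show ?thesis by (metis power_0)
qed

text \<open>Class equation: if the centre were trivial, \<open>{\<one>}\<close> would be the only
  conjugation orbit of size 1, all other sizes would be divisible by \<open>p\<close>, and
  \<open>p\<close> would divide 1.\<close>

lemma (in group) p_group_center:
  assumes fin: "finite (carrier G)" and ord: "order G = p ^ k" and p: "prime p" and nt: "order G \<noteq> 1"
  shows "\<exists>z\<in>carrier G. z \<noteq> \<one> \<and> (\<forall>x\<in>carrier G. x \<otimes> z = z \<otimes> x)"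
proof (rule ccontr)
  assume non: "\<not> ?thesis"
  define \<phi> where "\<phi> = (\<lambda>g. \<lambda>h \<in> carrier G. g \<otimes> h \<otimes> inv g)"
  interpret act: group_action G "carrier G" \<phi>
    unfolding \<phi>_def by (rule action_by_conjugation)
  let ?O = "orbits G (carrier G) \<phi>"
  have part: "\<Union>?O = carrier G" "\<And>A B. A \<in> ?O \<Longrightarrow> B \<in> ?O \<Longrightarrow> A \<noteq> B \<Longrightarrow> A \<inter> B = {}"
    using act.orbits_coverture act.disjoint_union by auto
  have finO: "finite ?O" "\<And>A. A \<in> ?O \<Longrightarrow> finite A"
    using part(1) fin by (metis finite_UnionD, metis Sup_upper finite_subset)
  have one: "orbit G \<phi> \<one> = {\<one>}"
    unfolding orbit_def \<phi>_def using one_closed by (auto intro!: exI[of _ \<one>])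
  then have oneO: "{\<one>} \<in> ?O"
    unfolding orbits_def by force
  have dvd: "p dvd card A" if A: "A \<in> ?O - {{\<one>}}" for A
  proof -
    obtain x where x: "x \<in> carrier G" "A = orbit G \<phi> x"
      using A unfolding orbits_def by auto
    have xA: "x \<in> A" using act.orbit_refl x by auto
    have "x \<noteq> \<one>" using A x one by auto
    then obtain y where y: "y \<in> carrier G" "y \<otimes> x \<noteq> x \<otimes> y"
      using non x by metis
    have "\<phi> y x \<in> A" unfolding x orbit_def using y by auto
    moreover have "\<phi> y x \<noteq> x"
      using y x(1) by (simp add: \<phi>_def) (metis inv_closed inv_solve_right m_closed)
    ultimately have "card A \<noteq> 1" using xA by (metis card_1_singletonE singletonD)
    moreover have "card A dvd p ^ k"
      using act.orbit_stabilizer_theorem[OF x(1)] x(2) ord by (metis dvd_triv_left)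
    ultimately show ?thesis
      using p by (metis divides_primepow_nat dvd_power gr0I power_0)
  qed
  have "card (carrier G) = (\<Sum>A\<in>?O. card A)"
    using card_Union_disjoint[of ?O] part finO by (auto simp: pairwise_def disjnt_def)
  also have "\<dots> = 1 + (\<Sum>A\<in>?O - {{\<one>}}. card A)"
    using sum.remove[OF finO(1) oneO, of card] by simp
  finally have eq: "p ^ k = 1 + (\<Sum>A\<in>?O - {{\<one>}}. card A)"
    using ord by (simp add: order_def)
  have "p dvd (\<Sum>A\<in>?O - {{\<one>}}. card A)"
    using dvd by (intro dvd_sum) auto
  moreover have "p dvd p ^ k" using nt ord by (metis dvd_power gr0I power_0)
  ultimately have "p dvd 1" using eq by (metis dvd_add_left_iff)
  then show False using p by (metis not_prime_unit)
qed

text \<open>Multiplication by the set \<open>K\<close> sends \<open>H #> x\<close> to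
  \<open>K #> x\<close>, so the cosets of \<open>K\<close> are an image of those of
  \<open>H\<close>.\<close>

lemma (in group) finite_rcosets_mono:
  assumes "subgroup H G" "subgroup K G" "H \<subseteq> K" "finite (rcosets H)"
  shows "finite (rcosets K)"
proof -
  have "K #> x = K <#> (H #> x)" if x: "x \<in> carrier G" for x
  proof -
    have K: "k \<in> carrier G" if "k \<in> K" for k by (rule subgroup.mem_carrier[OF assms(2) that])
    have H: "h \<in> K" if "h \<in> H" for h using assms(3) that by (rule subsetD)
    have m: "k \<otimes> h \<in> K" if "k \<in> K" "h \<in> K" for k h by (rule subgroup.m_closed[OF assms(2) that])
    have "k \<otimes> x \<in> K <#> (H #> x)" if k: "k \<in> K" for k
    proof -
      have "\<one> \<otimes> x \<in> H #> x"
        using subgroup.one_closed[OF assms(1)] unfolding r_coset_def by blast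
      then show ?thesis using k x unfolding set_mult_def by auto
    qed
    moreover have "k \<otimes> (h \<otimes> x) \<in> K #> x" if "k \<in> K" "h \<in> H" for k h
    proof -
      have "k \<otimes> (h \<otimes> x) = k \<otimes> h \<otimes> x" using K[OF that(1)] K[OF H[OF that(2)]] x by (simp add: m_assoc)
      then show ?thesis using m[OF that(1) H[OF that(2)]] unfolding r_coset_def by blast
    qed
    ultimately show ?thesis unfolding set_mult_def r_coset_def by blast
  qed
  then have "rcosets K \<subseteq> (\<lambda>X. K <#> X) ` (rcosets H)"
    unfolding RCOSETS_def by auto
  then show ?thesis using assms(4) finite_surj by blast
qed

text \<open>Each such subgroup is the union of the cosets of \<open>H\<close> that it contains. This
  is what bounds the climb in \<open>nodal_imp_procyclic\<close>.\<close>

lemma (in group) finite_subgroups_above: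
  assumes "subgroup H G" "finite (rcosets H)"
  shows "finite {K. subgroup K G \<and> H \<subseteq> K}"
proof -
  have "K = \<Union>{X \<in> rcosets H. X \<subseteq> K}" if K: "subgroup K G" "H \<subseteq> K" for K
  proof
    show "K \<subseteq> \<Union>{X \<in> rcosets H. X \<subseteq> K}"
    proof
      fix x assume x: "x \<in> K"
      then have xG: "x \<in> carrier G" using subgroup.mem_carrier[OF K(1)] by blast
      moreover have "H #> x \<subseteq> K"
        using K x subgroup.m_closed[OF K(1)] by (auto simp: r_coset_def)
      ultimately show "x \<in> \<Union>{X \<in> rcosets H. X \<subseteq> K}"
        using rcos_self[OF xG assms(1)] rcosetsI[OF subgroup.subset[OF assms(1)] xG] by blast
    qed
  qed auto
  then have "K \<in> Union ` Pow (rcosets H)" if "subgroup K G" "H \<subseteq> K" for K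
    by (rule image_eqI) (auto simp: that)
  then have "{K. subgroup K G \<and> H \<subseteq> K} \<subseteq> Union ` Pow (rcosets H)" by auto
  then show ?thesis using assms(2) by (simp add: finite_subset)
qed

section \<open>Elements whose procyclic closure is comparable to every procyclic subgroup\<close>

text \<open>The properties of the map \<open>x \<mapsto> \<langle>x\<rangle>\<close> (closed procyclic subgroup) of a profinite group
  that the algebraic part of the argument uses; they pass to subgroups.\<close>

locale procyclic_closure = group G for G (structure) +
  fixes cyc :: "'a \<Rightarrow> 'a set"
  assumes cyc_subgroup: "x \<in> carrier G \<Longrightarrow> subgroup (cyc x) G"
    and cyc_self: "x \<in> carrier G \<Longrightarrow> x \<in> cyc x"
    and cyc_least: "\<lbrakk>x \<in> carrier G; y \<in> cyc x\<rbrakk> \<Longrightarrow> cyc y \<subseteq> cyc x"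
    and cyc_commute: "\<lbrakk>x \<in> carrier G; y \<in> cyc x; z \<in> cyc x\<rbrakk> \<Longrightarrow> y \<otimes> z = z \<otimes> y"
    and cyc_decomp: "\<lbrakk>x \<in> carrier G; 0 < n; y \<in> cyc x\<rbrakk>
      \<Longrightarrow> \<exists>i<n. \<exists>c\<in>cyc (x [^] (n::nat)). y = x [^] i \<otimes> c"
    and cyc_pow: "x \<in> carrier G \<Longrightarrow> cyc (x [^] (n::nat)) = (\<lambda>y. y [^] n) ` cyc x"
    and cyc_not_divisible: "\<lbrakk>x \<in> carrier G; \<And>n::nat. 0 < n \<Longrightarrow> cyc (x [^] n) = cyc x\<rbrakk> \<Longrightarrow> x = \<one>"
begin

text \<open>All that the algebraic part keeps of isolation: \<open>cyc g\<close> is comparable with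
  each \<open>cyc x\<close>. In contrast to isolation, this can be transferred to roots of
  \<open>g\<close> and makes sense inside a subgroup with the same \<open>cyc\<close>.\<close>

definition nodal :: "'a \<Rightarrow> bool" where
  "nodal g \<longleftrightarrow> g \<in> carrier G \<and> g \<noteq> \<one> \<and> (\<forall>x\<in>carrier G - cyc g. g \<in> cyc x)"

lemma cyc_carrier: "x \<in> carrier G \<Longrightarrow> y \<in> cyc x \<Longrightarrow> y \<in> carrier G"
  by (rule subgroup.mem_carrier[OF cyc_subgroup])

lemma cyc_nat_pow: "x \<in> carrier G \<Longrightarrow> x [^] (n::nat) \<in> cyc x"
  by (simp add: cyc_self cyc_subgroup nat_pow_mem_subgroup)

lemma cyc_pow_subset: "x \<in> carrier G \<Longrightarrow> cyc (x [^] (n::nat)) \<subseteq> cyc x"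
  by (simp add: cyc_least cyc_nat_pow)

lemma cyc_one: "cyc \<one> = {\<one>}"
proof -
  \<comment> \<open>Exponent 0 in \<open>cyc_pow\<close> collapses the image to the
    identity.\<close>
  have "cyc (\<one> [^] (0::nat)) = {\<one>}"
    unfolding cyc_pow[OF one_closed] using cyc_self by auto
  then show ?thesis by simp
qed

text \<open>Here \<open>cyc (x [^] n)\<close> is trivial, so the decomposition modulo it leaves only
  powers of \<open>x\<close>.\<close>

lemma cyc_torsion:
  assumes "x \<in> carrier G" "x [^] (n::nat) = \<one>" "0 < n" "y \<in> cyc x"
  obtains i where "i < n" "y = x [^] i"
  using cyc_decomp[OF assms(1,3,4)] assms(1,2) cyc_one by auto

lemma cyc_pow_eq_of_primes:
  assumes x: "x \<in> carrier G" and n: "n > 0"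
    and q: "\<And>q. prime q \<Longrightarrow> q dvd n \<Longrightarrow> cyc (x [^] (q::nat)) = cyc x"
  shows "cyc (x [^] n) = cyc x"
  using n q
proof (induction n rule: prime_divisors_induct)
  case zero then show ?case by simp
next
  case (unit n) then show ?case using x by simp
next
  case (factor r n)
  have "cyc (x [^] n) = cyc x" using factor by simp
  moreover have "cyc (x [^] r) = cyc x" using factor by simp
  moreover have "cyc (x [^] (r * n)) = (\<lambda>y. y [^] n) ` cyc (x [^] r)"
    using x by (simp add: cyc_pow flip: nat_pow_pow)
  ultimately show ?case using x by (simp add: cyc_pow)
qed

end

text \<open>\<open>finite_index\<close> is the algebraic substitute for \<open>cyc g\<close> being
  open in a compact group.\<close>

locale nodal_element = procyclic_closure +
  fixes g
  assumes nodal: "nodal g" and finite_index: "finite (rcosets (cyc g))"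
begin

abbreviation "C \<equiv> cyc g"

lemma g_carrier [simp]: "g \<in> carrier G" and g_not_one: "g \<noteq> \<one>"
  using nodal by (auto simp: nodal_def)

lemma C_subgroup: "subgroup C G" by (simp add: cyc_subgroup)

lemma g_in_cyc: "x \<in> carrier G \<Longrightarrow> x \<notin> C \<Longrightarrow> g \<in> cyc x"
  using nodal by (auto simp: nodal_def)

lemma C_sub_cyc: "x \<in> carrier G \<Longrightarrow> x \<notin> C \<Longrightarrow> C \<subseteq> cyc x"
  by (simp add: cyc_least g_in_cyc)

text \<open>An \<open>x\<close> outside \<open>C\<close> has \<open>C\<close> inside the abelian
  group \<open>cyc x\<close>; an \<open>x\<close> inside \<open>C\<close> commutes with
  \<open>c\<close> because \<open>C\<close> is itself abelian.\<close>

lemma C_central: "x \<in> carrier G \<Longrightarrow> c \<in> C \<Longrightarrow> x \<otimes> c = c \<otimes> x"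
  by (metis C_sub_cyc cyc_commute cyc_self g_carrier subsetD)

lemma C_normal: "C \<lhd> G"
  using C_subgroup
proof (rule normalI)
  show "\<forall>x\<in>carrier G. C #> x = x <# C"
    using C_central by (force simp: r_coset_def l_coset_def)
qed

sublocale C: normal C G by (rule C_normal)

lemma C_rcoset_eq_iff:
  assumes "x \<in> carrier G" shows "C #> x = C \<longleftrightarrow> x \<in> C"
  using assms coset_join1 coset_join2 C_subgroup C.subset by metis

lemma finite_quotient: "finite (carrier (G Mod C))"
  using finite_index by (simp add: FactGroup_def)

lemma pow_mem_C:
  assumes "x \<in> carrier G" obtains n :: nat where "n > 0" "x [^] n \<in> C"
proof -
  interpret Q: group "G Mod C" by (rule C.factorgroup_is_group)
  have "C #> x \<in> carrier (G Mod C)" using assms by (simp add: carrier_FactGroup)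
  then have "(C #> x) [^]\<^bsub>G Mod C\<^esub> Coset.order (G Mod C) = \<one>\<^bsub>G Mod C\<^esub>"
    by (rule Q.pow_order_eq_1)
  then have "C #> (x [^] Coset.order (G Mod C)) = C"
    using assms by (simp add: C.FactGroup_pow)
  then have "x [^] Coset.order (G Mod C) \<in> C"
    using assms C_rcoset_eq_iff by simp
  moreover have "Coset.order (G Mod C) > 0"
    using finite_quotient Q.order_gt_0_iff_finite by blast
  ultimately show thesis using that by blast
qed

text \<open>Write \<open>g = x [^] i \<otimes> c\<close> with \<open>i < q\<close> and
  \<open>c\<close> in \<open>cyc (x [^] q)\<close>. Then \<open>x [^] i\<close> is in
  \<open>C\<close>, and a nonzero \<open>i\<close>, being coprime to \<open>q\<close>, would put
  \<open>x\<close> into \<open>C\<close>; hence \<open>g = c\<close>.\<close>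

lemma prime_pow_mem_C:
  assumes x: "x \<in> carrier G" "x \<notin> C" "x [^] (q::nat) \<in> C" and q: "prime q"
  shows "cyc (x [^] q) = C"
proof
  show "cyc (x [^] q) \<subseteq> C" using x by (simp add: cyc_least)
  obtain i c where ic: "i < q" "c \<in> cyc (x [^] q)" "g = x [^] i \<otimes> c"
    using cyc_decomp[OF x(1) _ g_in_cyc[OF x(1,2)], of q] q prime_gt_0_nat by blast
  have cC: "c \<in> C" using ic(2) x by (meson cyc_least g_carrier subsetD)
  have "x [^] i = g \<otimes> inv c"
    using ic cC x C.mem_carrier by (simp add: inv_solve_right)
  then have "x [^] i \<in> C" using cC cyc_self by simp
  have "i = 0"
  proof (rule ccontr)
    assume "i \<noteq> 0"
    then have "coprime i q"
      using ic(1) q by (metis coprime_commute nat_dvd_not_less neq0_conv prime_imp_coprime)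
    then show False
      using pow_mem_coprime[OF C_subgroup x(1) \<open>x [^] i \<in> C\<close> x(3)] x(2) by blast
  qed
  then have "g \<in> cyc (x [^] q)" using ic x cC C.mem_carrier by simp
  then show "C \<subseteq> cyc (x [^] q)" using x by (simp add: cyc_least)
qed

lemma coprime_pow_notin_C:
  assumes "x \<in> carrier G" "x \<notin> C" "x [^] (m::nat) \<in> C" "coprime m (n::nat)"
  shows "x [^] n \<notin> C"
  using pow_mem_coprime[OF C_subgroup] assms by blast

text \<open>The power \<open>x [^] n\<close> stays outside \<open>C\<close>, so its closure contains
  \<open>C\<close> and with it \<open>x [^] m\<close>; coprimality then recovers
  \<open>x\<close>.\<close>

lemma cyc_coprime_pow:
  assumes "x \<in> carrier G" "x \<notin> C" "x [^] (m::nat) \<in> C" "coprime m (n::nat)"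
  shows "cyc (x [^] n) = cyc x"
proof -
  have "x [^] n \<notin> C" using coprime_pow_notin_C assms by blast
  then have "C \<subseteq> cyc (x [^] n)" using assms C_sub_cyc by simp
  then have "x \<in> cyc (x [^] n)"
    using assms pow_mem_coprime[of "cyc (x [^] n)" x m n] cyc_self cyc_subgroup by auto
  then show ?thesis
    using assms cyc_least cyc_pow_subset by (meson nat_pow_closed subset_antisym)
qed

text \<open>Passing from \<open>x\<close> to \<open>x [^] q\<close> does not change
  \<open>cyc x\<close>; taking \<open>p\<close>-th powers carries this over to
  \<open>C = cyc (x [^] p)\<close>.\<close>

lemma C_prime_power_eq:
  assumes x: "x \<in> carrier G" "x \<notin> C" "x [^] (p::nat) \<in> C" and p: "prime p"
    and q: "prime q" "q \<noteq> p"
  shows "cyc (g [^] q) = C"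
proof -
  have "coprime p q" using p q primes_coprime by metis
  then have "cyc (x [^] q) = cyc x" using cyc_coprime_pow x by blast
  then have "cyc ((x [^] q) [^] p) = cyc (x [^] p)" using x by (simp add: cyc_pow)
  moreover have "cyc ((x [^] p) [^] q) = (\<lambda>y. y [^] q) ` cyc (x [^] p)"
    using x by (simp add: cyc_pow)
  moreover have "\<dots> = cyc (g [^] q)"
    using prime_pow_mem_C[OF x p] by (simp add: cyc_pow)
  ultimately show ?thesis
    using prime_pow_mem_C[OF x p] x by (metis mult.commute nat_pow_pow)
qed

lemma C_not_divisible: "\<exists>q. prime q \<and> cyc (g [^] (q::nat)) \<noteq> C"
  using cyc_not_divisible[OF g_carrier] cyc_pow_eq_of_primes[OF g_carrier] g_not_one by blast

text \<open>The prime supplied by \<open>C_not_divisible\<close> must be \<open>p\<close> when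
  \<open>x\<close> is used in \<open>C_prime_power_eq\<close>, and \<open>q\<close> when
  \<open>y\<close> is used.\<close>

lemma prime_index_unique:
  assumes "x \<in> carrier G" "x \<notin> C" "x [^] (p::nat) \<in> C" "prime p"
    and "y \<in> carrier G" "y \<notin> C" "y [^] (q::nat) \<in> C" "prime q"
  shows "p = q"
  using C_not_divisible C_prime_power_eq[OF assms(1-4)] C_prime_power_eq[OF assms(5-8)] by metis

text \<open>For the least positive \<open>n\<close> with \<open>x [^] n\<close> in \<open>C\<close>
  and a prime \<open>p\<close> dividing \<open>n\<close>, the exponent \<open>m\<close> is
  \<open>n\<close> divided by \<open>p\<close>.\<close>

lemma exists_prime_index_pow:
  assumes "x \<in> carrier G" "x \<notin> C"
  obtains p m :: nat where "prime p" "x [^] m \<notin> C" "(x [^] m) [^] p \<in> C"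
proof -
  define n where "n = (LEAST n::nat. n > 0 \<and> x [^] n \<in> C)"
  have n: "n > 0" "x [^] n \<in> C"
    using LeastI_ex[of "\<lambda>n::nat. n > 0 \<and> x [^] n \<in> C"] pow_mem_C[OF assms(1)]
    unfolding n_def by blast+
  have least: "x [^] m \<notin> C" if "0 < m" "m < n" for m
    using not_less_Least[of m "\<lambda>n::nat. n > 0 \<and> x [^] n \<in> C"] that unfolding n_def by blast
  have "n \<noteq> 1" using n assms by auto
  then obtain p where p: "prime p" "p dvd n" using prime_factor_nat by blast
  then obtain m where m: "n = p * m" by blast
  have "m > 0" using m n by (cases m) auto
  moreover have "m < n" using m \<open>m > 0\<close> prime_gt_1_nat[OF p(1)] by simp
  ultimately have "m > 0" "m < n" by auto
  then show thesis
    using that[of p m] least n m p assms by (simp add: nat_pow_pow mult.commute)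
qed

end

locale nodal_prime = nodal_element +
  fixes p :: nat and x\<^sub>0
  assumes p: "prime p" and x\<^sub>0: "x\<^sub>0 \<in> carrier G" "x\<^sub>0 \<notin> C" "x\<^sub>0 [^] p \<in> C"
begin

lemma index_prime:
  "x \<in> carrier G \<Longrightarrow> x \<notin> C \<Longrightarrow> x [^] (q::nat) \<in> C \<Longrightarrow> prime q \<Longrightarrow> q = p"
  using prime_index_unique x\<^sub>0 p by blast

lemma exists_pow_index_p:
  assumes "x \<in> carrier G" "x \<notin> C"
  obtains m :: nat where "x [^] m \<notin> C" "(x [^] m) [^] p \<in> C"
  using exists_prime_index_pow[OF assms] index_prime assms by (metis nat_pow_closed)

text \<open>Split an exponent that leads into \<open>C\<close> as a power of \<open>p\<close> times
  \<open>m\<close>, with \<open>m\<close> prime to \<open>p\<close>. If the power of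
  \<open>p\<close> alone did not lead into \<open>C\<close>, some element outside \<open>C\<close>
  would have both its \<open>p\<close>-th and its \<open>m\<close>-th power in
  \<open>C\<close>.\<close>

lemma exists_p_power_mem_C:
  assumes x: "x \<in> carrier G"
  shows "\<exists>k. x [^] (p ^ k) \<in> C"
proof -
  obtain n :: nat where n: "n > 0" "x [^] n \<in> C" using pow_mem_C[OF x] .
  then obtain m where m: "n = p ^ multiplicity p n * m" "\<not> p dvd m"
    using multiplicity_decompose'[of n p] p by (metis not_prime_unit not_gr0)
  let ?y = "x [^] (p ^ multiplicity p n)"
  have "?y [^] m \<in> C" using n m x by (simp add: nat_pow_pow)
  have "?y \<in> C"
  proof (rule ccontr)
    assume y: "?y \<notin> C"
    obtain r :: nat where r: "(?y [^] r) \<notin> C" "(?y [^] r) [^] p \<in> C"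
      using exists_pow_index_p[of ?y] x y by auto
    have "coprime p m" using m p prime_imp_coprime by blast
    moreover have "(?y [^] r) [^] m \<in> C"
      using \<open>?y [^] m \<in> C\<close> nat_pow_mem_subgroup[OF C_subgroup, of "?y [^] m" r] x
      by (simp add: nat_pow_pow mult.commute mult.left_commute)
    ultimately show False using r pow_mem_coprime[OF C_subgroup, of "?y [^] r" p m] x by auto
  qed
  then show ?thesis by blast
qed

lemma cyc_g_pow_p: "cyc (g [^] p) \<noteq> C"
  using C_not_divisible C_prime_power_eq[OF x\<^sub>0 p] by metis

text \<open>\<open>C = cyc (x [^] p)\<close> consists of \<open>p\<close>-th powers of elements of
  \<open>cyc x\<close>, which gives \<open>k\<close>. It avoids \<open>C\<close> because otherwise
  \<open>g\<close> would lie in \<open>cyc (g [^] p)\<close>, against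
  \<open>cyc_g_pow_p\<close>.\<close>

lemma exists_root:
  assumes x: "x \<in> carrier G" "x \<notin> C" "x [^] p \<in> C"
  obtains k where "k \<in> cyc x" "k \<notin> C" "k [^] p = g" "x \<in> cyc k"
proof -
  have xp: "cyc (x [^] p) = C" using prime_pow_mem_C x p by blast
  have "g \<in> (\<lambda>y. y [^] p) ` cyc x"
    using xp x cyc_self[of g] by (simp add: cyc_pow)
  then obtain k where k: "k \<in> cyc x" "k [^] p = g" by auto
  have kG: "k \<in> carrier G" using k x cyc_carrier by blast
  have kC: "k \<notin> C"
  proof
    assume "k \<in> C"
    then have "g \<in> cyc (g [^] p)" using k by (auto simp: cyc_pow)
    then show False using cyc_g_pow_p cyc_least cyc_pow_subset
      by (metis g_carrier nat_pow_closed subset_antisym)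
  qed
  \<comment> \<open>The exponent \<open>i\<close> is nonzero and below \<open>p\<close>, so
    \<open>cyc k\<close> contains a power of \<open>x\<close> prime to \<open>p\<close> as well as
    \<open>x [^] p\<close>, hence \<open>x\<close>.\<close>
  obtain i c where ic: "i < p" "c \<in> C" "k = x [^] i \<otimes> c"
    using cyc_decomp[OF x(1) _ k(1), of p] xp p prime_gt_0_nat by blast
  have "i \<noteq> 0"
  proof
    assume "i = 0" then show False using ic kC C.mem_carrier by simp
  qed
  then have cop: "coprime i p"
    using ic(1) p by (metis coprime_commute nat_dvd_not_less neq0_conv prime_imp_coprime)
  have Ck: "C \<subseteq> cyc k" using C_sub_cyc kG kC by blast
  have "x [^] i = k \<otimes> inv c" using ic x kG C.mem_carrier by (simp add: inv_solve_right)
  moreover have "inv c \<in> cyc k"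
    using Ck ic(2) cyc_subgroup[OF kG] by (meson subgroup.m_inv_closed subsetD)
  ultimately have "x [^] i \<in> cyc k"
    using cyc_self[OF kG] cyc_subgroup[OF kG] subgroup.m_closed by metis
  then have "x \<in> cyc k"
    using pow_mem_coprime[OF cyc_subgroup[OF kG] x(1) _ _ cop] Ck x by blast
  then show thesis using that k kC by blast
qed

text \<open>The quotient by \<open>C\<close> is a nontrivial finite \<open>p\<close>-group and has a
  nontrivial centre. Centrality modulo \<open>C\<close> is expressed by the commutator
  \<open>w\<close>, which is central in the whole group by \<open>C_central\<close>.\<close>

lemma exists_central_mod_C:
  obtains z where "z \<in> carrier G" "z \<notin> C" "z [^] p \<in> C"
    "\<And>x. x \<in> carrier G \<Longrightarrow> \<exists>w\<in>C. x \<otimes> z = w \<otimes> (z \<otimes> x)"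
proof -
  interpret Q: group "G Mod C" by (rule C.factorgroup_is_group)
  have pow: "(C #> x) [^]\<^bsub>G Mod C\<^esub> (n::nat) = \<one>\<^bsub>G Mod C\<^esub> \<longleftrightarrow> x [^] n \<in> C" if "x \<in> carrier G" for x n
    using that by (simp add: C.FactGroup_pow C_rcoset_eq_iff)
  have "\<exists>k. Coset.order (G Mod C) = p ^ k"
  proof (rule Q.order_prime_power[OF finite_quotient _ p])
    fix X and q :: nat assume X: "X \<in> carrier (G Mod C)" "X \<noteq> \<one>\<^bsub>G Mod C\<^esub>" "prime q" "X [^]\<^bsub>G Mod C\<^esub> q = \<one>\<^bsub>G Mod C\<^esub>"
    then obtain x where x: "x \<in> carrier G" "X = C #> x" by (auto simp: carrier_FactGroup)
    then have "x \<notin> C" using X C_rcoset_eq_iff by auto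
    then show "q = p" using X x pow[of x q] index_prime by auto
  qed
  moreover have "Coset.order (G Mod C) \<noteq> 1"
  proof
    assume "Coset.order (G Mod C) = 1"
    then have "carrier (G Mod C) = {\<one>\<^bsub>G Mod C\<^esub>}"
      using Q.order_one_triv_iff by blast
    then have "C #> x\<^sub>0 = C" using x\<^sub>0 by (auto simp: carrier_FactGroup)
    then show False using x\<^sub>0 C_rcoset_eq_iff by blast
  qed
  ultimately obtain Z where Z: "Z \<in> carrier (G Mod C)" "Z \<noteq> \<one>\<^bsub>G Mod C\<^esub>"
    "\<forall>X\<in>carrier (G Mod C). X \<otimes>\<^bsub>G Mod C\<^esub> Z = Z \<otimes>\<^bsub>G Mod C\<^esub> X"
    using Q.p_group_center[OF finite_quotient _ p] by blast
  then obtain z where z: "z \<in> carrier G" "Z = C #> z" by (auto simp: carrier_FactGroup)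
  have zC: "z \<notin> C" using Z z C_rcoset_eq_iff by auto
  \<comment> \<open>The central element found may have order larger than \<open>p\<close> modulo
    \<open>C\<close>; a suitable power has order exactly \<open>p\<close> and is still central
    modulo \<open>C\<close>.\<close>
  obtain m :: nat where m: "z [^] m \<notin> C" "(z [^] m) [^] p \<in> C"
    using exists_pow_index_p[OF z(1) zC] .
  have comm: "\<exists>w\<in>C. x \<otimes> z [^] m = w \<otimes> (z [^] m \<otimes> x)" if x: "x \<in> carrier G" for x
  proof -
    have X: "C #> x \<in> carrier (G Mod C)" using x by (auto simp: carrier_FactGroup)
    have "Z \<otimes>\<^bsub>G Mod C\<^esub> (C #> x) = (C #> x) \<otimes>\<^bsub>G Mod C\<^esub> Z"
      using Z(3) X by metis
    then have "(Z [^]\<^bsub>G Mod C\<^esub> m) \<otimes>\<^bsub>G Mod C\<^esub> (C #> x) = (C #> x) \<otimes>\<^bsub>G Mod C\<^esub> (Z [^]\<^bsub>G Mod C\<^esub> m)"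
      using Q.group_commutes_pow[OF _ Z(1) X] by blast
    then have "C #> (z [^] m \<otimes> x) = C #> (x \<otimes> z [^] m)"
      unfolding z(2) C.FactGroup_pow[OF z(1)] mult_FactGroup
      using z(1) x by (simp only: C.rcos_sum nat_pow_closed)
    then have "x \<otimes> z [^] m \<in> C #> (z [^] m \<otimes> x)"
      using z(1) x rcos_self[OF _ C_subgroup, of "x \<otimes> z [^] m"] by simp
    then show ?thesis unfolding r_coset_def by blast
  qed
  show thesis using that[of "z [^] m"] m comm z(1) by blast
qed

end

section \<open>Commutator calculus for pairs whose commutator \<open>v\<close> commutes with
  them\<close>

lemma (in group) class_two_commute:
  assumes c: "k \<in> carrier G" "y \<in> carrier G" "v \<in> carrier G"
    and yk: "y \<otimes> k = v \<otimes> (k \<otimes> y)" and vk: "v \<otimes> k = k \<otimes> v" 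
  shows "y \<otimes> k [^] (n::nat) = v [^] n \<otimes> (k [^] n \<otimes> y)"
proof (induction n)
  case 0 then show ?case using c by simp
next
  case (Suc n)
  have kn: "k [^] n \<otimes> v = v \<otimes> k [^] n" using group_commutes_pow[of k v n] vk c by simp
  have "y \<otimes> k [^] Suc n = (y \<otimes> k [^] n) \<otimes> k" using c by (simp add: m_assoc)
  also have "\<dots> = v [^] n \<otimes> (k [^] n \<otimes> (y \<otimes> k))" using c by (simp add: Suc m_assoc)
  also have "\<dots> = v [^] n \<otimes> ((k [^] n \<otimes> v) \<otimes> (k \<otimes> y))" using c yk by (simp add: m_assoc)
  also have "\<dots> = v [^] Suc n \<otimes> (k [^] Suc n \<otimes> y)" using c kn by (simp add: m_assoc)
  finally show ?case .
qed

text \<open>The power formula of nilpotency class two: in step \<open>n\<close> the new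
  \<open>k\<close> moves left past \<open>y [^] n\<close>, at the price of \<open>v [^] n\<close>,
  and these exponents add up to a triangular number.\<close>

lemma (in group) class_two_power:
  assumes c: "k \<in> carrier G" "y \<in> carrier G" "v \<in> carrier G"
    and yk: "y \<otimes> k = v \<otimes> (k \<otimes> y)" and vk: "v \<otimes> k = k \<otimes> v" and vy: "v \<otimes> y = y \<otimes> v"
  shows "(k \<otimes> y) [^] (n::nat) = v [^] (n * (n - 1) div 2) \<otimes> (k [^] n \<otimes> y [^] n)"
proof (induction n)
  case 0 then show ?case using c by simp
next
  case (Suc n)
  have kyv: "v \<otimes> (k \<otimes> y) = (k \<otimes> y) \<otimes> v" using c vk vy by (metis m_assoc)
  have "y [^] n \<otimes> k = v [^] n \<otimes> (k \<otimes> y [^] n)"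
  proof (induction n)
    case 0 then show ?case using c by simp
  next
    case (Suc n)
    have vn: "y \<otimes> v [^] n = v [^] n \<otimes> y" using group_commutes_pow[of v y n] vy c by simp
    have "y [^] Suc n \<otimes> k = y \<otimes> (y [^] n \<otimes> k)"
      using c by (metis m_assoc nat_pow_Suc2 nat_pow_closed)
    also have "\<dots> = (y \<otimes> v [^] n) \<otimes> (k \<otimes> y [^] n)" using c by (simp add: Suc m_assoc)
    also have "\<dots> = v [^] n \<otimes> ((y \<otimes> k) \<otimes> y [^] n)" using c vn by (simp add: m_assoc)
    also have "\<dots> = v [^] n \<otimes> (v \<otimes> (k \<otimes> (y \<otimes> y [^] n)))" using c yk by (simp add: m_assoc)
    also have "\<dots> = v [^] Suc n \<otimes> (k \<otimes> y [^] Suc n)"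
      using c by (metis m_assoc nat_pow_Suc nat_pow_Suc2 nat_pow_closed m_closed)
    finally show ?case .
  qed
  note ynk = this
  have kn: "k [^] n \<otimes> v [^] n = v [^] n \<otimes> k [^] n"
    using group_commutes_pow[of v "k [^] n" n] group_commutes_pow[of k v n] vk c by simp
  \<comment> \<open>The case split deals with \<open>n = 0\<close>, where \<open>n - 1\<close> is
    truncated.\<close>
  have e: "n * (n - 1) div 2 + n = Suc n * (Suc n - 1) div 2"
    by (cases n) (auto simp: algebra_simps)
  have "(k \<otimes> y) [^] Suc n = v [^] (n * (n - 1) div 2) \<otimes> (k [^] n \<otimes> ((y [^] n \<otimes> k) \<otimes> y))"
    using c by (simp add: Suc m_assoc)
  also have "\<dots> = v [^] (n * (n - 1) div 2) \<otimes> ((k [^] n \<otimes> v [^] n) \<otimes> (k \<otimes> (y [^] n \<otimes> y)))"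
    using c by (simp add: ynk m_assoc)
  also have "\<dots> = (v [^] (n * (n - 1) div 2) \<otimes> v [^] n) \<otimes> (k [^] Suc n \<otimes> y [^] Suc n)"
    using c by (simp add: kn m_assoc)
  also have "\<dots> = v [^] (Suc n * (Suc n - 1) div 2) \<otimes> (k [^] Suc n \<otimes> y [^] Suc n)"
    using c e by (simp add: nat_pow_mult)
  finally show ?case .
qed

section \<open>Comparison of the p-th roots of g\<close>

context nodal_prime begin

text \<open>The element \<open>u = k \<otimes> inv x\<close> measures the difference of two roots.
  If it lies in \<open>C\<close>, which is contained in \<open>cyc x\<close>, then so does
  \<open>k\<close> in \<open>cyc x\<close>; otherwise \<open>u [^] p\<close> generates
  \<open>C\<close>, and its value is computed from the commutator.\<close>

lemma root_unique:
  assumes k: "k \<in> carrier G" "k \<notin> C" "k [^] p = g"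
    and x: "x \<in> carrier G" "x \<notin> C" "x [^] p = g"
    and w: "w \<in> C" "x \<otimes> k = w \<otimes> (k \<otimes> x)"
  shows "k \<in> cyc x \<or> (p = 2 \<and> g [^] (2::nat) = \<one> \<and> x \<otimes> k \<noteq> k \<otimes> x)"
proof (cases "k \<otimes> inv x \<in> C")
  case True
  then have "k \<otimes> inv x \<in> cyc x" using C_sub_cyc x by blast
  then have "k \<otimes> inv x \<otimes> x \<in> cyc x" using x cyc_subgroup cyc_self subgroup.m_closed by metis
  then show ?thesis using k x by (simp add: m_assoc)
next
  case False
  let ?y = "inv x" and ?u = "k \<otimes> inv x" and ?v = "inv w"
  have wG: "w \<in> carrier G" using w(1) C.mem_carrier by blast
  have vC: "?v \<in> C" using w(1) by simp
  have vG: "?v \<in> carrier G" using wG by simp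
  have cent: "?v \<otimes> a = a \<otimes> ?v" if "a \<in> carrier G" for a using C_central that vC by metis
  \<comment> \<open>Replacing \<open>x\<close> by its inverse inverts the central commutator
    \<open>w\<close>.\<close>
  have yk: "?y \<otimes> k = ?v \<otimes> (k \<otimes> ?y)"
  proof -
    have "k = w \<otimes> (?y \<otimes> (k \<otimes> x))"
    proof -
      have "k = ?y \<otimes> (x \<otimes> k)" using k x by (simp add: m_assoc[symmetric])
      also have "\<dots> = (?y \<otimes> w) \<otimes> (k \<otimes> x)" using w k x wG by (simp add: m_assoc)
      also have "?y \<otimes> w = w \<otimes> ?y" using C_central w x by simp
      finally show ?thesis using k x wG by (simp add: m_assoc)
    qed
    then have "k \<otimes> ?y = w \<otimes> (?y \<otimes> (k \<otimes> x)) \<otimes> ?y" by simp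
    also have "\<dots> = w \<otimes> (?y \<otimes> k)" using k x wG by (simp add: m_assoc)
    finally show ?thesis using k x wG by (simp add: m_assoc[symmetric])
  qed
  \<comment> \<open>Moving \<open>inv x\<close> past \<open>k [^] p\<close> costs
    \<open>v [^] p\<close>, yet \<open>k [^] p = g\<close> is central.\<close>
  have vp: "?v [^] p = \<one>"
  proof -
    have "?y \<otimes> g = ?v [^] p \<otimes> (g \<otimes> ?y)"
      using class_two_commute[OF k(1) _ vG yk cent[OF k(1)], of p] k x by simp
    moreover have "g \<otimes> ?y = ?y \<otimes> g" using C_central[of ?y g] x cyc_self by simp
    ultimately show ?thesis using x vG by (metis g_carrier inv_closed r_cancel_one m_closed nat_pow_closed)
  qed
  have up: "?u [^] p = ?v [^] (p * (p - 1) div 2)"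
    using class_two_power[OF k(1) _ vG yk cent[OF k(1)] cent, of p] k x vG
    by (simp add: nat_pow_inv)
  have uG: "?u \<in> carrier G" using k x by simp
  \<comment> \<open>In the power formula \<open>k [^] p\<close> and \<open>inv x [^] p\<close>
    cancel, so \<open>u [^] p\<close> is a power of \<open>v\<close> and lies in
    \<open>C\<close>.\<close>
  have Cu: "C = cyc (?u [^] p)"
    using prime_pow_mem_C[OF uG False _ p] up nat_pow_mem_subgroup[OF C_subgroup vC] by simp
  show ?thesis
  proof (cases "p = 2")
    case False
    then have "odd p" using p primes_dvd_imp_eq two_is_prime_nat by blast
    \<comment> \<open>For odd \<open>p\<close> the exponent is a multiple of \<open>p\<close>; then
      \<open>u [^] p\<close> is trivial and could only generate a trivial \<open>C\<close>.\<close>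
    then have "p * (p - 1) div 2 = p * ((p - 1) div 2)" by (simp add: div_mult_swap)
    then have "?u [^] p = \<one>" using up vp vG by (simp add: nat_pow_pow[symmetric] del: nat_pow_pow)
    then have "C = {\<one>}" using Cu cyc_one by simp
    then show ?thesis using g_not_one cyc_self[OF g_carrier] by auto
  next
    case p2: True
    have "?u [^] p = ?v" using up p2 vG by simp
    \<comment> \<open>For \<open>p = 2\<close> the exponent is 1, so \<open>C\<close> is generated
      by \<open>v\<close> with \<open>v [^] 2 = \<one>\<close>. This bounds the order of
      \<open>g\<close>, and since \<open>g\<close> is nontrivial the commutator is too.\<close>
    then have gv: "g \<in> cyc ?v" using Cu cyc_self[OF g_carrier] by simp
    have "cyc (?v [^] (2::nat)) = {\<one>}" using vp p2 cyc_one by simp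
    then have "g [^] (2::nat) = \<one>" using gv cyc_pow[OF vG, of 2] by auto
    moreover have "x \<otimes> k \<noteq> k \<otimes> x"
    proof
      assume "x \<otimes> k = k \<otimes> x"
      then have "w \<otimes> (k \<otimes> x) = k \<otimes> x" using w by simp
      then have "w = \<one>" using wG k x by (metis r_cancel_one m_closed)
      then show False using gv cyc_one g_not_one by simp
    qed
    ultimately show ?thesis using p2 by simp
  qed
qed

text \<open>The third property transfers nodality from \<open>g\<close> to \<open>k\<close> outside
  the exceptional case. The fourth holds in every case and transfers it inside the centralizer of
  \<open>k\<close>.\<close>

lemma central_root:
  obtains k where "k \<in> carrier G" "k \<notin> C" "k [^] p = g"
    "\<And>x. x \<in> carrier G \<Longrightarrow> \<exists>w\<in>C. x \<otimes> k = w \<otimes> (k \<otimes> x)"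
    "\<And>x. \<lbrakk>x \<in> carrier G; x \<notin> C; k \<notin> cyc x\<rbrakk> \<Longrightarrow> p = 2 \<and> g [^] (2::nat) = \<one>"
    "\<And>x. \<lbrakk>x \<in> carrier G; x \<notin> C; x \<otimes> k = k \<otimes> x\<rbrakk> \<Longrightarrow> k \<in> cyc x"
proof -
  obtain z where z: "z \<in> carrier G" "z \<notin> C" "z [^] p \<in> C"
    "\<And>x. x \<in> carrier G \<Longrightarrow> \<exists>w\<in>C. x \<otimes> z = w \<otimes> (z \<otimes> x)"
    using exists_central_mod_C by metis
  obtain k where k: "k \<in> cyc z" "k \<notin> C" "k [^] p = g" "z \<in> cyc k"
    using exists_root[OF z(1-3)] .
  have kG: "k \<in> carrier G" using k z cyc_carrier by blast
  \<comment> \<open>As \<open>k\<close> is a power of \<open>z\<close> up to the central group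
    \<open>C\<close>, it inherits centrality modulo \<open>C\<close> from \<open>z\<close>.\<close>
  obtain i c where ic: "c \<in> C" "k = z [^] (i::nat) \<otimes> c"
    using cyc_decomp[OF z(1) _ k(1), of p] prime_pow_mem_C[OF z(1-3) p] p prime_gt_0_nat by blast
  have cG: "c \<in> carrier G" using ic C.mem_carrier by blast
  have comm: "\<exists>w\<in>C. x \<otimes> k = w \<otimes> (k \<otimes> x)" if x: "x \<in> carrier G" for x
  proof -
    obtain w where w: "w \<in> C" "x \<otimes> z = w \<otimes> (z \<otimes> x)" using z(4)[OF x] by blast
    have wG: "w \<in> carrier G" using w C.mem_carrier by blast
    have "x \<otimes> z [^] i = w [^] i \<otimes> (z [^] i \<otimes> x)"
      using class_two_commute[OF z(1) x wG w(2)] C_central[OF z(1) w(1)] by simp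
    moreover have "x \<otimes> k = x \<otimes> z [^] i \<otimes> c" using ic x z cG by (simp add: m_assoc)
    moreover have "c \<otimes> x = x \<otimes> c" using C_central[OF x ic(1)] by simp
    ultimately have "x \<otimes> k = w [^] i \<otimes> (k \<otimes> x)"
      using ic x z cG wG by (simp add: m_assoc)
    moreover have "w [^] i \<in> C" using w nat_pow_mem_subgroup[OF C_subgroup] by blast
    ultimately show ?thesis by blast
  qed
  have main: "k \<in> cyc x \<or> (p = 2 \<and> g [^] (2::nat) = \<one> \<and> x \<otimes> k \<noteq> k \<otimes> x)"
    if x: "x \<in> carrier G" "x \<notin> C" for x
  proof -
    obtain m :: nat where m: "x [^] m \<notin> C" "(x [^] m) [^] p \<in> C"
      using exists_pow_index_p[OF x] .
    have xmG: "x [^] m \<in> carrier G" using x by simp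
    \<comment> \<open>\<open>root_unique\<close> compares two roots of \<open>g\<close>, so an
      arbitrary \<open>x\<close> is replaced by a root inside \<open>cyc x\<close>.\<close>
    obtain k2 where k2: "k2 \<in> cyc (x [^] m)" "k2 \<notin> C" "k2 [^] p = g" "x [^] m \<in> cyc k2"
      using exists_root[OF xmG m] .
    have k2G: "k2 \<in> carrier G" using k2 xmG cyc_carrier by blast
    have k2x: "k2 \<in> cyc x" using k2 cyc_pow_subset x by blast
    obtain w where w: "w \<in> C" "k2 \<otimes> k = w \<otimes> (k \<otimes> k2)" using comm[OF k2G] by blast
    from root_unique[OF kG k(2,3) k2G k2(2,3) w]
    show ?thesis
    proof
      assume "k \<in> cyc k2" then show ?thesis using k2x cyc_least x by blast
    next
      assume nc: "p = 2 \<and> g [^] (2::nat) = \<one> \<and> k2 \<otimes> k \<noteq> k \<otimes> k2"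
      show ?thesis
      proof (rule ccontr)
        assume "\<not> ?thesis"
        then have xk: "x \<otimes> k = k \<otimes> x" using nc by blast
        \<comment> \<open>Being a power of \<open>x\<close> up to a central factor,
          \<open>k2\<close> commutes with everything that commutes with \<open>x\<close>.\<close>
        obtain j c where j: "c \<in> C" "k2 = (x [^] m) [^] (j::nat) \<otimes> c"
          using cyc_decomp[OF xmG _ k2(1), of p] prime_pow_mem_C[OF xmG m p] p prime_gt_0_nat by blast
        have cG: "c \<in> carrier G" using j C.mem_carrier by blast
        have "x [^] (m * j) \<otimes> k = k \<otimes> x [^] (m * j)" using group_commutes_pow xk x kG by blast
        moreover have "c \<otimes> k = k \<otimes> c" using C_central[OF kG j(1)] by simp
        moreover have "k2 = x [^] (m * j) \<otimes> c" using j x by (simp add: nat_pow_pow)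
        ultimately have "k2 \<otimes> k = k \<otimes> k2"
          using cG x kG by (metis m_assoc nat_pow_closed)
        then show False using nc by blast
      qed
    qed
  qed
  show thesis using that[OF kG k(2,3) comm] main by blast
qed

end

section \<open>Generalized quaternion groups\<close>

text \<open>A recognition criterion for the generalized quaternion group of order
  \<open>2 ^ n\<close>. The normal forms are part of it, so that they can be matched with those of
  the presentation.\<close>

definition quaternion_generators :: "('a, 'b) monoid_scheme \<Rightarrow> nat \<Rightarrow> 'a \<Rightarrow> 'a \<Rightarrow> bool" where
  "quaternion_generators G n a y \<longleftrightarrow>
     n \<ge> 3 \<and> a \<in> carrier G \<and> y \<in> carrier G \<and> group.ord G a = 2 ^ (n - 1) \<and>
     y \<otimes>\<^bsub>G\<^esub> y = a [^]\<^bsub>G\<^esub> (2 ^ (n - 2) :: nat) \<and> a \<otimes>\<^bsub>G\<^esub> y = y \<otimes>\<^bsub>G\<^esub> inv\<^bsub>G\<^esub> a \<and>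
     y \<notin> range (\<lambda>i::nat. a [^]\<^bsub>G\<^esub> i) \<and>
     carrier G = range (\<lambda>i::nat. a [^]\<^bsub>G\<^esub> i) \<union> range (\<lambda>i::nat. a [^]\<^bsub>G\<^esub> i \<otimes>\<^bsub>G\<^esub> y)"

primrec word_eval :: "('a, 'b) monoid_scheme \<Rightarrow> ('g \<Rightarrow> 'a) \<Rightarrow> 'g word \<Rightarrow> 'a" where
  "word_eval G f [] = \<one>\<^bsub>G\<^esub>"
| "word_eval G f (l # w) =
     (if snd l then f (fst l) else inv\<^bsub>G\<^esub> f (fst l)) \<otimes>\<^bsub>G\<^esub> word_eval G f w"

context group begin

lemma word_eval_closed: "(\<And>s. f s \<in> carrier G) \<Longrightarrow> word_eval G f w \<in> carrier G"
  by (induction w) auto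

lemma word_eval_append:
  "(\<And>s. f s \<in> carrier G) \<Longrightarrow> word_eval G f (u @ v) = word_eval G f u \<otimes> word_eval G f v"
  by (induction u) (auto simp: m_assoc word_eval_closed)

lemma word_eval_replicate:
  "(\<And>s. f s \<in> carrier G) \<Longrightarrow> word_eval G f (replicate n (s, True)) = f s [^] n"
proof (induction n)
  case (Suc n)
  then show ?case using nat_pow_Suc2[of "f s" n] by simp
qed simp

lemma word_eval_pres_eq:
  assumes f: "\<And>s. f s \<in> carrier G"
    and R: "\<And>r s. (r, s) \<in> R \<Longrightarrow> word_eval G f r = word_eval G f s"
    and uv: "pres_eq R u v"
  shows "word_eval G f u = word_eval G f v"
  using uv
proof induction
  case (cancel u a b v)
  have "(if b then f a else inv f a) \<otimes> ((if \<not> b then f a else inv f a) \<otimes> word_eval G f v)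
      = word_eval G f v"
    using f by (cases b) (simp_all add: word_eval_closed m_assoc[symmetric])
  then show ?case by (cases b) (simp_all add: word_eval_append f)
qed (simp_all add: word_eval_append f R)

text \<open>Von Dyck's theorem. The value on a class is read off a chosen word, and
  \<open>word_eval_pres_eq\<close> makes the choice irrelevant.\<close>

lemma presented_group_hom:
  assumes f: "\<And>s. f s \<in> carrier G"
    and R: "\<And>r s. (r, s) \<in> R \<Longrightarrow> word_eval G f r = word_eval G f s"
  obtains h where "h \<in> hom (presented_group R) G"
    and "\<And>w. h (pres_class R w) = word_eval G f w"
proof -
  define h where "h = (\<lambda>S. word_eval G f (SOME u. S = pres_class R u))"
  have h: "h (pres_class R w) = word_eval G f w" for w
  proof -
    have "pres_class R w = pres_class R (SOME u. pres_class R w = pres_class R u)"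
      by (rule someI[of _ w]) simp
    then show ?thesis
      using word_eval_pres_eq[OF f R] unfolding h_def by (metis pres_class_eq_iff)
  qed
  have "h \<in> hom (presented_group R) G"
    by (rule homI)
      (auto simp: carrier_presented_group h presented_group_mult word_eval_append word_eval_closed f)
  then show thesis using that h by blast
qed

lemma conjugate_inverts_pow:
  assumes c: "x \<in> carrier G" "y \<in> carrier G" and xy: "x \<otimes> y = y \<otimes> inv x"
  shows "y \<otimes> x [^] (i::nat) = inv x [^] i \<otimes> y"
proof -
  have "y = x \<otimes> y \<otimes> x" using xy c by (simp add: m_assoc)
  then have yx: "y \<otimes> x = inv x \<otimes> y"
    using c by (metis inv_solve_left m_assoc m_closed)
  show ?thesis
  proof (induction i)
    case (Suc i)
    have "y \<otimes> x [^] Suc i = inv x [^] i \<otimes> (y \<otimes> x)" using c Suc by (simp add: m_assoc[symmetric])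
    also have "\<dots> = inv x [^] Suc i \<otimes> y" using c yx by (simp add: m_assoc)
    finally show ?case .
  qed (use c in simp)
qed

end

lemma pres_class_inverse:
  "pres_class R [(s, False)] = inv\<^bsub>presented_group R\<^esub> pres_class R [(s, True)]"
proof -
  interpret Q: group "presented_group R" by (rule group_presented_group)
  have "pres_eq R ([] @ [(s, False), (s, \<not> False)] @ []) ([] @ [])" by (rule pres_eq.cancel)
  then have "pres_class R [(s, False)] \<otimes>\<^bsub>presented_group R\<^esub> pres_class R [(s, True)]
      = \<one>\<^bsub>presented_group R\<^esub>"
    by (simp add: presented_group_mult one_presented_group pres_class_eq_iff)
  then show ?thesis
    by (intro Q.inv_equality[symmetric]) (auto simp: carrier_presented_group)
qed

lemma pres_class_replicate:
  "pres_class R (replicate n l) = pres_class R [l] [^]\<^bsub>presented_group R\<^esub> n"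
proof (induction n)
  case (Suc n)
  have "pres_class R (replicate (Suc n) l) = pres_class R (replicate n l @ [l])"
    by (simp add: replicate_append_same)
  then show ?case by (simp add: Suc presented_group_mult[symmetric])
qed (simp add: one_presented_group)

context
  fixes n :: nat and Q X Y
  defines "Q \<equiv> quaternion_group n"
    and "X \<equiv> pres_class (quaternion_rels n) [(QX, True)]"
    and "Y \<equiv> pres_class (quaternion_rels n) [(QY, True)]"
begin

lemma quaternion_group_group: "group Q"
  by (simp add: Q_def quaternion_group_def group_presented_group)

lemma quaternion_relations:
  shows "X \<in> carrier Q" "Y \<in> carrier Q" "X [^]\<^bsub>Q\<^esub> (2 ^ (n - 1) :: nat) = \<one>\<^bsub>Q\<^esub>"
    and "Y \<otimes>\<^bsub>Q\<^esub> Y = X [^]\<^bsub>Q\<^esub> (2 ^ (n - 2) :: nat)"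
    and "X \<otimes>\<^bsub>Q\<^esub> Y = Y \<otimes>\<^bsub>Q\<^esub> inv\<^bsub>Q\<^esub> X"
proof -
  interpret Q: group Q by (rule quaternion_group_group)
  let ?R = "quaternion_rels n"
  have rel: "pres_class ?R r = pres_class ?R s" if "(r, s) \<in> ?R" for r s
    using pres_eq.rel[OF that, of "[]" "[]"] by (simp add: pres_class_eq_iff)
  show X: "X \<in> carrier Q" and Y: "Y \<in> carrier Q"
    by (simp_all add: Q_def X_def Y_def quaternion_group_def carrier_presented_group)
  show "X [^]\<^bsub>Q\<^esub> (2 ^ (n - 1) :: nat) = \<one>\<^bsub>Q\<^esub>"
    using rel[of "replicate (2 ^ (n - 1)) (QX, True)" "[]"]
    by (simp add: Q_def X_def quaternion_group_def pres_class_replicate one_presented_group quaternion_rels_def)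
  show "Y \<otimes>\<^bsub>Q\<^esub> Y = X [^]\<^bsub>Q\<^esub> (2 ^ (n - 2) :: nat)"
    using rel[of "[(QY, True), (QY, True)]" "replicate (2 ^ (n - 2)) (QX, True)"]
    by (simp add: Q_def X_def Y_def quaternion_group_def pres_class_replicate presented_group_mult quaternion_rels_def)
  have "pres_class ?R ([(QY, False)] @ [(QX, True)] @ [(QY, True)]) = pres_class ?R [(QX, False)]"
    using rel by (simp add: quaternion_rels_def)
  then have "inv\<^bsub>Q\<^esub> Y \<otimes>\<^bsub>Q\<^esub> (X \<otimes>\<^bsub>Q\<^esub> Y) = inv\<^bsub>Q\<^esub> X"
    unfolding Q_def X_def Y_def quaternion_group_def
      presented_group_mult[symmetric] pres_class_inverse .
  then show "X \<otimes>\<^bsub>Q\<^esub> Y = Y \<otimes>\<^bsub>Q\<^esub> inv\<^bsub>Q\<^esub> X"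
    using X Y by (metis Q.inv_closed Q.inv_solve_left Q.m_closed)
qed

text \<open>The set of normal forms is stable under left multiplication by powers of
  \<open>X\<close> and by \<open>Y\<close>, so induction on words applies. Natural exponents suffice
  since \<open>X\<close> has finite order.\<close>

lemma quaternion_normal_form:
  assumes "A \<in> carrier Q"
  shows "\<exists>i::nat. A = X [^]\<^bsub>Q\<^esub> i \<or> A = X [^]\<^bsub>Q\<^esub> i \<otimes>\<^bsub>Q\<^esub> Y"
proof -
  interpret Q: group Q by (rule quaternion_group_group)
  note rel = quaternion_relations
  define N :: nat where "N = 2 ^ (n - 1)"
  define K :: nat where "K = 2 ^ (n - 2)"
  define S where "S = {B. \<exists>i::nat. B = X [^]\<^bsub>Q\<^esub> i \<or> B = X [^]\<^bsub>Q\<^esub> i \<otimes>\<^bsub>Q\<^esub> Y}"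
  have invX: "inv\<^bsub>Q\<^esub> X = X [^]\<^bsub>Q\<^esub> (N - 1)"
  proof (rule Q.inv_equality)
    have "Suc (N - 1) = N" by (simp add: N_def)
    then have "X [^]\<^bsub>Q\<^esub> Suc (N - 1) = \<one>\<^bsub>Q\<^esub>" using rel(3) by (simp add: N_def)
    then show "X [^]\<^bsub>Q\<^esub> (N - 1) \<otimes>\<^bsub>Q\<^esub> X = \<one>\<^bsub>Q\<^esub>" by simp
  qed (use rel in auto)
  have inv_pow: "inv\<^bsub>Q\<^esub> X [^]\<^bsub>Q\<^esub> i = X [^]\<^bsub>Q\<^esub> ((N - 1) * i)" for i :: nat
    using rel invX by (simp add: Q.nat_pow_pow)
  have SX: "X [^]\<^bsub>Q\<^esub> (j::nat) \<otimes>\<^bsub>Q\<^esub> B \<in> S" if B: "B \<in> S" for B j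
  proof -
    obtain i :: nat where i: "B = X [^]\<^bsub>Q\<^esub> i \<or> B = X [^]\<^bsub>Q\<^esub> i \<otimes>\<^bsub>Q\<^esub> Y" using B S_def by blast
    have "X [^]\<^bsub>Q\<^esub> j \<otimes>\<^bsub>Q\<^esub> B = X [^]\<^bsub>Q\<^esub> (j + i) \<or> X [^]\<^bsub>Q\<^esub> j \<otimes>\<^bsub>Q\<^esub> B = X [^]\<^bsub>Q\<^esub> (j + i) \<otimes>\<^bsub>Q\<^esub> Y"
      using i rel by (auto simp: Q.m_assoc[symmetric] Q.nat_pow_mult)
    then show ?thesis unfolding S_def by blast
  qed
  have Xpow_S: "X [^]\<^bsub>Q\<^esub> i \<in> S" for i :: nat unfolding S_def by blast
  have SY: "Y \<otimes>\<^bsub>Q\<^esub> B \<in> S" if B: "B \<in> S" for B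
  proof -
    obtain i :: nat where i: "B = X [^]\<^bsub>Q\<^esub> i \<or> B = X [^]\<^bsub>Q\<^esub> i \<otimes>\<^bsub>Q\<^esub> Y" using B S_def by blast
    have YX: "Y \<otimes>\<^bsub>Q\<^esub> X [^]\<^bsub>Q\<^esub> i = X [^]\<^bsub>Q\<^esub> ((N - 1) * i) \<otimes>\<^bsub>Q\<^esub> Y"
      using Q.conjugate_inverts_pow rel inv_pow by simp
    from i show ?thesis
    proof
      assume "B = X [^]\<^bsub>Q\<^esub> i" then show ?thesis unfolding S_def using YX by blast
    next
      assume "B = X [^]\<^bsub>Q\<^esub> i \<otimes>\<^bsub>Q\<^esub> Y"
      then have "Y \<otimes>\<^bsub>Q\<^esub> B = X [^]\<^bsub>Q\<^esub> ((N - 1) * i) \<otimes>\<^bsub>Q\<^esub> X [^]\<^bsub>Q\<^esub> K"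
        using rel YX by (simp add: Q.m_assoc[symmetric] K_def) (simp add: Q.m_assoc rel)
      then show ?thesis using SX Xpow_S by simp
    qed
  qed
  \<comment> \<open>From \<open>Y\<close> squared being the \<open>K\<close>-th power of
    \<open>X\<close>; left multiplication by the inverse of \<open>Y\<close> is thereby reduced to
    \<open>X\<close> and \<open>Y\<close>.\<close>
  have invY: "inv\<^bsub>Q\<^esub> Y = inv\<^bsub>Q\<^esub> X [^]\<^bsub>Q\<^esub> K \<otimes>\<^bsub>Q\<^esub> Y"
  proof (rule Q.inv_equality)
    have "inv\<^bsub>Q\<^esub> X [^]\<^bsub>Q\<^esub> K \<otimes>\<^bsub>Q\<^esub> Y \<otimes>\<^bsub>Q\<^esub> Y = inv\<^bsub>Q\<^esub> X [^]\<^bsub>Q\<^esub> K \<otimes>\<^bsub>Q\<^esub> X [^]\<^bsub>Q\<^esub> K"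
      using rel by (simp add: Q.m_assoc K_def)
    then show "inv\<^bsub>Q\<^esub> X [^]\<^bsub>Q\<^esub> K \<otimes>\<^bsub>Q\<^esub> Y \<otimes>\<^bsub>Q\<^esub> Y = \<one>\<^bsub>Q\<^esub>"
      using rel by (simp add: Q.nat_pow_inv)
  qed (use rel in auto)
  have "pres_class (quaternion_rels n) w \<in> S" for w
  proof (induction w)
    case Nil
    have "pres_class (quaternion_rels n) [] = X [^]\<^bsub>Q\<^esub> (0::nat)"
      by (simp add: Q_def quaternion_group_def one_presented_group)
    then show ?case using Xpow_S by metis
  next
    case (Cons l w)
    have "pres_class (quaternion_rels n) (l # w)
        = pres_class (quaternion_rels n) [l] \<otimes>\<^bsub>Q\<^esub> pres_class (quaternion_rels n) w" (is "?L = _ \<otimes>\<^bsub>Q\<^esub> ?w")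
      by (simp add: Q_def quaternion_group_def presented_group_mult)
    moreover have "?w \<in> carrier Q"
      by (simp add: Q_def quaternion_group_def carrier_presented_group)
    moreover have "pres_class (quaternion_rels n) [l] \<in> {X, inv\<^bsub>Q\<^esub> X, Y, inv\<^bsub>Q\<^esub> Y}"
    proof -
      obtain s b where l: "l = (s, b)" by (cases l)
      show ?thesis
        by (cases s; cases b) (simp_all add: l X_def Y_def Q_def quaternion_group_def pres_class_inverse)
    qed
    ultimately show ?case
      using SX[OF Cons.IH, of 1] SX[OF Cons.IH, of "N - 1"] SY[OF Cons.IH]
        SX[OF SY[OF Cons.IH], of "(N - 1) * K"] rel(1,2) invX invY inv_pow
      by (auto simp: Q.m_assoc)
  qed
  moreover obtain w where "A = pres_class (quaternion_rels n) w"
    using assms by (auto simp: Q_def quaternion_group_def carrier_presented_group)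
  ultimately show ?thesis by (simp add: S_def)
qed

end

text \<open>The homomorphism goes from the presented group to \<open>G\<close>. Its kernel is
  trivial on normal forms: the \<open>i\<close>-th power of \<open>X\<close> dies only if
  \<open>N\<close> divides \<open>i\<close>, and a form ending in \<open>Y\<close> cannot die
  because \<open>y\<close> is not a power of \<open>a\<close>.\<close>

lemma (in group) quaternion_group_iso:
  assumes "quaternion_generators G n a y"
  obtains \<phi> where "\<phi> \<in> iso G (quaternion_group n)" "\<phi> y = quaternion_y n"
proof -
  let ?R = "quaternion_rels n" and ?Q = "quaternion_group n"
  let ?X = "pres_class ?R [(QX, True)]" and ?Y = "pres_class ?R [(QY, True)]"
  define N :: nat where "N = 2 ^ (n - 1)"
  have a: "a \<in> carrier G" and y: "y \<in> carrier G" and ord: "ord a = N"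
    and yy: "y \<otimes> y = a [^] (2 ^ (n - 2) :: nat)" and ay: "a \<otimes> y = y \<otimes> inv a"
    and y_notin: "y \<notin> range (\<lambda>i::nat. a [^] i)"
    and carrier: "carrier G = range (\<lambda>i::nat. a [^] i) \<union> range (\<lambda>i::nat. a [^] i \<otimes> y)"
    using assms unfolding quaternion_generators_def N_def by blast+
  have aN: "a [^] N = \<one>" using ord a pow_ord_eq_1 by metis
  define f where "f = (\<lambda>s. case s of QX \<Rightarrow> a | QY \<Rightarrow> y)"
  have f: "f s \<in> carrier G" for s using a y by (simp add: f_def split: quat_gen.split)
  have R: "word_eval G f r = word_eval G f s" if "(r, s) \<in> ?R" for r s
  proof -
    have "inv y \<otimes> (a \<otimes> y) = inv a" using a y ay by (simp add: m_assoc[symmetric])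
    then show ?thesis
      using that aN yy a y f by (auto simp: quaternion_rels_def word_eval_replicate N_def f_def)
  qed
  obtain h where h: "h \<in> hom (presented_group ?R) G"
    and hw: "\<And>w. h (pres_class ?R w) = word_eval G f w"
    using presented_group_hom[OF f R] by blast
  interpret Q: group ?Q by (rule quaternion_group_group)
  interpret h: group_hom ?Q G h
    using h by unfold_locales (simp add: quaternion_group_def)
  note rel = quaternion_relations[of n]
  have hX: "h (?X [^]\<^bsub>?Q\<^esub> i) = a [^] i" for i :: nat
    using rel(1) a by (simp add: h.hom_nat_pow hw f_def)
  have hXY: "h (?X [^]\<^bsub>?Q\<^esub> i \<otimes>\<^bsub>?Q\<^esub> ?Y) = a [^] i \<otimes> y" for i :: nat
    using rel(1,2) hX y by (simp add: hw f_def)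
  have "h \<in> iso ?Q G"
    unfolding h.iso_iff
  proof (intro conjI ballI impI)
    show "carrier G \<subseteq> h ` carrier ?Q"
    proof
      fix z assume "z \<in> carrier G"
      then consider i :: nat where "z = a [^] i" | i :: nat where "z = a [^] i \<otimes> y"
        using carrier by blast
      then show "z \<in> h ` carrier ?Q"
      proof cases
        case 1 then show ?thesis using hX[of i] rel(1) by (metis Q.nat_pow_closed imageI)
      next
        case 2 then show ?thesis using hXY[of i] rel(1,2) by (metis Q.nat_pow_closed Q.m_closed imageI)
      qed
    qed
    fix A assume A: "A \<in> carrier ?Q" and hA: "h A = \<one>"
    from quaternion_normal_form[OF A] obtain i :: nat
      where "A = ?X [^]\<^bsub>?Q\<^esub> i \<or> A = ?X [^]\<^bsub>?Q\<^esub> i \<otimes>\<^bsub>?Q\<^esub> ?Y" by blast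
    then show "A = \<one>\<^bsub>?Q\<^esub>"
    proof
      assume "A = ?X [^]\<^bsub>?Q\<^esub> i"
      moreover from this have "N dvd i" using hA hX a ord by (simp add: pow_eq_id)
      then obtain k where "i = N * k" by blast
      then have "?X [^]\<^bsub>?Q\<^esub> i = (?X [^]\<^bsub>?Q\<^esub> N) [^]\<^bsub>?Q\<^esub> k" using rel(1) by (simp only: Q.nat_pow_pow)
      then have "?X [^]\<^bsub>?Q\<^esub> i = \<one>\<^bsub>?Q\<^esub>" using rel(3) by (simp add: N_def)
      ultimately show ?thesis by simp
    next
      assume "A = ?X [^]\<^bsub>?Q\<^esub> i \<otimes>\<^bsub>?Q\<^esub> ?Y"
      then have "a [^] i \<otimes> y = \<one>" using hA hXY by simp
      \<comment> \<open>This is the inverse of \<open>a [^] i\<close> with a natural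
        exponent.\<close>
      moreover have "a [^] i \<otimes> a [^] ((N - 1) * i) = \<one>"
      proof -
        have "i + (N - 1) * i = N * i" by (simp add: N_def algebra_simps)
        then have "a [^] i \<otimes> a [^] ((N - 1) * i) = (a [^] N) [^] i"
          using a by (simp only: nat_pow_mult nat_pow_pow)
        then show ?thesis by (simp add: aN)
      qed
      ultimately have "a [^] i \<otimes> y = a [^] i \<otimes> a [^] ((N - 1) * i)" by simp
      then have "y = a [^] ((N - 1) * i)" using a y by simp
      then show ?thesis using y_notin by blast
    qed
  qed
  then have "inv_into (carrier ?Q) h \<in> iso G ?Q" by (rule Q.iso_set_sym)
  moreover have "inv_into (carrier ?Q) h y = quaternion_y n"
  proof -
    have "h ?Y = y" using y by (simp add: hw f_def)
    moreover have "inj_on h (carrier ?Q)" using \<open>h \<in> iso ?Q G\<close> by (simp add: iso_def bij_betw_def)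
    ultimately show ?thesis using rel(2) by (metis inv_into_f_f quaternion_y_def)
  qed
  ultimately show thesis by (rule that)
qed

section \<open>Procyclic and quaternion conclusions\<close>

context procyclic_closure begin

lemma nodal_primeE:
  assumes "nodal g" "finite (rcosets (cyc g))" "cyc g \<noteq> carrier G"
  obtains p x where "nodal_prime G cyc g p x"
proof -
  interpret nodal_element G cyc g
    using assms by unfold_locales auto
  obtain x where x: "x \<in> carrier G" "x \<notin> cyc g"
    using assms(3) C.subset by blast
  obtain p m :: nat where "prime p" "x [^] m \<notin> C" "(x [^] m) [^] p \<in> C"
    using exists_prime_index_pow[OF x] .
  then have "nodal_prime G cyc g p (x [^] m)"
    using x by unfold_locales auto
  then show thesis by (rule that)
qed

text \<open>Take a largest \<open>cyc k\<close> above \<open>cyc g\<close> with \<open>k\<close>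
  nodal and \<open>k [^] 2\<close> nontrivial. If it were proper, \<open>central_root\<close> would
  provide a root of \<open>k\<close> with the same properties and a strictly larger closure.\<close>

lemma nodal_imp_procyclic:
  assumes g: "nodal g" "finite (rcosets (cyc g))" "g [^] (2::nat) \<noteq> \<one>"
  shows "\<exists>a\<in>carrier G. cyc a = carrier G"
proof -
  let ?S = "{cyc k | k. nodal k \<and> k [^] (2::nat) \<noteq> \<one> \<and> cyc g \<subseteq> cyc k}"
  have gG: "g \<in> carrier G" using g by (simp add: nodal_def)
  have "?S \<subseteq> {K. subgroup K G \<and> cyc g \<subseteq> K}"
    using cyc_subgroup by (auto simp: nodal_def)
  then have "finite ?S"
    using finite_subgroups_above[OF cyc_subgroup[OF gG] g(2)] finite_subset by blast
  moreover have "cyc g \<in> ?S" using g by auto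
  ultimately obtain K where K: "K \<in> ?S" "\<And>L. L \<in> ?S \<Longrightarrow> K \<subseteq> L \<Longrightarrow> K = L"
    using finite_has_maximal[of ?S] by (metis (no_types, lifting) emptyE)
  then obtain k where k: "nodal k" "k [^] (2::nat) \<noteq> \<one>" "cyc g \<subseteq> cyc k" "K = cyc k" by auto
  have kG: "k \<in> carrier G" using k by (simp add: nodal_def)
  have "cyc k = carrier G"
  proof (rule ccontr)
    assume ne: "cyc k \<noteq> carrier G"
    have fin: "finite (rcosets (cyc k))"
      using finite_rcosets_mono[OF cyc_subgroup[OF gG] cyc_subgroup[OF kG] k(3) g(2)] .
    obtain p x where "nodal_prime G cyc k p x" using nodal_primeE[OF k(1) fin ne] .
    then interpret nodal_prime G cyc k p x .
    obtain k' where k': "k' \<in> carrier G" "k' \<notin> C" "k' [^] p = k"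
      "\<And>x. \<lbrakk>x \<in> carrier G; x \<notin> C; k' \<notin> cyc x\<rbrakk> \<Longrightarrow> p = 2 \<and> k [^] (2::nat) = \<one>"
      using central_root by metis
    have sub: "cyc k \<subseteq> cyc k'" using C_sub_cyc k' by blast
    have "k' \<noteq> \<one>" using k'(2) C.one_closed by blast
    then have "nodal k'" unfolding nodal_def using k' sub k(2) by blast
    \<comment> \<open>If \<open>k'\<close> were an involution, \<open>k = k' [^] p\<close> would be
      \<open>\<one>\<close> or \<open>k'\<close>, according to the parity of
      \<open>p\<close>.\<close>
    moreover have "k' [^] (2::nat) \<noteq> \<one>"
    proof
      assume sq: "k' [^] (2::nat) = \<one>"
      have "(k' [^] (2::nat)) [^] (p div 2) \<otimes> k' [^] (p mod 2) = k' [^] (p mod 2)"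
        using k'(1) sq by simp
      then have "k' [^] (2 * (p div 2) + p mod 2) = k' [^] (p mod 2)"
        using k'(1) by (simp only: nat_pow_pow nat_pow_mult)
      then have "k = k' [^] (p mod 2)" using k'(3) by simp
      moreover have "p mod 2 = 0 \<or> p mod 2 = 1" by auto
      ultimately have "k = \<one> \<or> k = k'" using k'(1) by auto
      then show False using g_not_one k'(2) cyc_self[OF kG] by auto
    qed
    ultimately have "cyc k' \<in> ?S" using sub k(3) by blast
    then have "cyc k = cyc k'" using K(2) k(4) sub by blast
    then show False using k' cyc_self by blast
  qed
  then show ?thesis using kG by blast
qed

text \<open>The sets \<open>cyc x\<close> are unchanged, so the climb can be repeated inside a
  centralizer.\<close>

lemma restrict_subgroup:
  assumes A: "subgroup A G" and closed: "\<And>x. x \<in> A \<Longrightarrow> cyc x \<subseteq> A"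
  shows "procyclic_closure (G\<lparr>carrier := A\<rparr>) cyc"
proof -
  interpret A: group "G\<lparr>carrier := A\<rparr>" using A by (rule subgroup_imp_group)
  have AG: "x \<in> carrier G" if "x \<in> A" for x using A that by (rule subgroup.mem_carrier)
  have pow: "x [^]\<^bsub>G\<lparr>carrier := A\<rparr>\<^esub> (n::nat) = x [^] n" for x n
    by (rule nat_pow_consistent[symmetric])
  show ?thesis
  proof (intro procyclic_closure.intro procyclic_closure_axioms.intro)
    show "group (G\<lparr>carrier := A\<rparr>)" ..
  next
    fix x assume x: "x \<in> carrier (G\<lparr>carrier := A\<rparr>)"
    then have xA: "x \<in> A" and xG: "x \<in> carrier G" using AG by auto
    show "subgroup (cyc x) (G\<lparr>carrier := A\<rparr>)"
      using subgroup_incl[OF cyc_subgroup[OF xG] A closed[OF xA]] .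
    show "x \<in> cyc x" using xG by (rule cyc_self)
    show "cyc y \<subseteq> cyc x" if "y \<in> cyc x" for y using xG that by (rule cyc_least)
    show "y \<otimes>\<^bsub>G\<lparr>carrier := A\<rparr>\<^esub> z = z \<otimes>\<^bsub>G\<lparr>carrier := A\<rparr>\<^esub> y" if "y \<in> cyc x" "z \<in> cyc x" for y z
      using cyc_commute[OF xG that] by simp
    show "\<exists>i<n. \<exists>c\<in>cyc (x [^]\<^bsub>G\<lparr>carrier := A\<rparr>\<^esub> (n::nat)).
        y = x [^]\<^bsub>G\<lparr>carrier := A\<rparr>\<^esub> i \<otimes>\<^bsub>G\<lparr>carrier := A\<rparr>\<^esub> c" if "0 < n" "y \<in> cyc x" for n y
      using cyc_decomp[OF xG that] by (simp add: pow)
    show "cyc (x [^]\<^bsub>G\<lparr>carrier := A\<rparr>\<^esub> (n::nat)) = (\<lambda>y. y [^]\<^bsub>G\<lparr>carrier := A\<rparr>\<^esub> n) ` cyc x" for n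
      using cyc_pow[OF xG] by (simp add: pow)
    show "x = \<one>\<^bsub>G\<lparr>carrier := A\<rparr>\<^esub>" if "\<And>n::nat. 0 < n \<Longrightarrow> cyc (x [^]\<^bsub>G\<lparr>carrier := A\<rparr>\<^esub> n) = cyc x"
      using cyc_not_divisible[OF xG] that by (simp add: pow)
  qed
qed

end

context nodal_prime begin

lemma cyc_coprime_pow_procyclic:
  assumes a: "a \<in> carrier G" "cyc a = carrier G" and q: "prime q" "q \<noteq> p"
  shows "cyc (a [^] q) = cyc a"
proof -
  obtain k where k: "a [^] (p ^ k) \<in> C" using exists_p_power_mem_C a by blast
  have "a \<notin> C" using a x\<^sub>0 cyc_least[of g a] by auto
  moreover have "coprime (p ^ k) q" using p q by (simp add: primes_coprime)
  ultimately show ?thesis using cyc_coprime_pow a k by blast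
qed

text \<open>The centralizer \<open>A\<close> of a root \<open>i\<close> of \<open>g\<close> is
  cyclic by the climb, now started at \<open>i\<close>, whose square \<open>g\<close> is nontrivial.
  If \<open>A\<close> is proper it has index 2, and every element outside it squares to
  \<open>g\<close>.\<close>

lemma quaternion_or_procyclic:
  assumes p2: "p = 2" and g2: "g [^] (2::nat) = \<one>"
  shows "(\<exists>a\<in>carrier G. cyc a = carrier G) \<or>
    finite (carrier G) \<and> (\<exists>n a y. quaternion_generators G n a y \<and> y [^] (2::nat) = g)"
proof -
  have C2: "C = {\<one>, g}"
  proof
    show "C \<subseteq> {\<one>, g}"
    proof
      fix c assume "c \<in> C"
      then obtain i where "i < 2" "c = g [^] (i::nat)"
        using cyc_torsion[OF g_carrier g2] by auto
      then show "c \<in> {\<one>, g}" by (auto simp: less_2_cases_iff)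
    qed
    show "{\<one>, g} \<subseteq> C" using cyc_self C.one_closed by simp
  qed
  \<comment> \<open>An infinite carrier has order 0, so two positive factors prove
    finiteness.\<close>
  have "card (rcosets C) * card C = Coset.order G" using lagrange[OF C_subgroup] .
  moreover have "card (rcosets C) > 0"
    using finite_index rcosetsI[OF C.subset g_carrier] by (auto simp: card_gt_0_iff)
  moreover have "card C > 0" using C2 by (simp add: card_gt_0_iff)
  ultimately have "Coset.order G > 0" by (metis nat_0_less_mult_iff)
  then have finG: "finite (carrier G)" by (simp add: order_gt_0_iff_finite)
  \<comment> \<open>An involution outside \<open>C\<close> would have \<open>g\<close> in its
    two-element closure, so \<open>g\<close> is the only involution.\<close>
  have order2: "x = g" if x: "x \<in> carrier G" "x \<noteq> \<one>" "x [^] (2::nat) = \<one>" for x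
  proof (cases "x \<in> C")
    case True then show ?thesis using C2 x by auto
  next
    case False
    then obtain i where "i < 2" "g = x [^] (i::nat)"
      using cyc_torsion[OF x(1,3)] g_in_cyc[OF x(1)] by auto
    then show ?thesis using x g_not_one by (auto simp: less_2_cases_iff)
  qed
  obtain i where i: "i \<in> carrier G" "i \<notin> C" "i [^] p = g"
    and i_comm: "\<And>x. x \<in> carrier G \<Longrightarrow> \<exists>w\<in>C. x \<otimes> i = w \<otimes> (i \<otimes> x)"
    and i_cyc: "\<And>x. \<lbrakk>x \<in> carrier G; x \<notin> C; x \<otimes> i = i \<otimes> x\<rbrakk> \<Longrightarrow> i \<in> cyc x"
    using central_root by metis
  have i2: "i [^] (2::nat) = g" using i p2 by simp
  define A where "A = {x \<in> carrier G. x \<otimes> i = i \<otimes> x}"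
  have A: "subgroup A G"
  proof (rule subgroupI)
    show "A \<noteq> {}" unfolding A_def using i by auto
    show "inv a \<in> A" if "a \<in> A" for a
    proof -
      have aG: "a \<in> carrier G" and ai: "a \<otimes> i = i \<otimes> a" using that by (auto simp: A_def)
      have "inv a \<otimes> i = inv a \<otimes> (i \<otimes> a) \<otimes> inv a" using aG i by (simp add: m_assoc)
      also have "\<dots> = i \<otimes> inv a" using aG i by (simp add: ai[symmetric] m_assoc[symmetric])
      finally show ?thesis using aG by (simp add: A_def)
    qed
    show "a \<otimes> b \<in> A" if "a \<in> A" "b \<in> A" for a b
    proof -
      have aG: "a \<in> carrier G" "b \<in> carrier G" and ai: "a \<otimes> i = i \<otimes> a" "b \<otimes> i = i \<otimes> b"
        using that by (auto simp: A_def)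
      have "a \<otimes> b \<otimes> i = (a \<otimes> i) \<otimes> b" using aG i ai(2) by (simp add: m_assoc)
      then show ?thesis using aG ai(1) i by (simp add: A_def m_assoc)
    qed
  qed (auto simp: A_def)
  have AG: "x \<in> carrier G" if "x \<in> A" for x using that by (simp add: A_def)
  have cyc_A: "cyc x \<subseteq> A" if "x \<in> A" for x
  proof
    fix z assume z: "z \<in> cyc x"
    have xG: "x \<in> carrier G" using that AG by blast
    have "x [^] Coset.order G = \<one>" using pow_order_eq_1[OF xG] .
    then obtain j where "z = x [^] (j::nat)"
      using cyc_torsion[OF xG _ _ z] \<open>Coset.order G > 0\<close> by metis
    then show "z \<in> A" using nat_pow_mem_subgroup[OF A that] by simp
  qed
  have iA: "i \<in> A" using i by (simp add: A_def)
  interpret A: procyclic_closure "G\<lparr>carrier := A\<rparr>" cyc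
    by (rule restrict_subgroup[OF A cyc_A])
  have "A.nodal i"
    unfolding A.nodal_def
  proof (intro conjI ballI)
    show "i \<in> carrier (G\<lparr>carrier := A\<rparr>)" using iA by simp
    have "i \<noteq> \<one>" using i(2) C.one_closed by metis
    then show "i \<noteq> \<one>\<^bsub>G\<lparr>carrier := A\<rparr>\<^esub>" by simp
    fix x assume "x \<in> carrier (G\<lparr>carrier := A\<rparr>) - cyc i"
    then have x: "x \<in> carrier G" "x \<otimes> i = i \<otimes> x" "x \<notin> cyc i" by (auto simp: A_def)
    have "x \<notin> C" using x(3) C_sub_cyc[OF i(1,2)] by blast
    then show "i \<in> cyc x" using i_cyc x by blast
  qed
  moreover have "finite (rcosets\<^bsub>G\<lparr>carrier := A\<rparr>\<^esub> (cyc i))"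
    using finG AG finite_subset[of A "carrier G"] by (auto simp: RCOSETS_def)
  moreover have "i [^]\<^bsub>G\<lparr>carrier := A\<rparr>\<^esub> (2::nat) \<noteq> \<one>\<^bsub>G\<lparr>carrier := A\<rparr>\<^esub>"
    using i2 g_not_one by (simp add: nat_pow_consistent[symmetric])
  ultimately obtain a where a: "a \<in> A" "cyc a = A"
    using A.nodal_imp_procyclic by auto
  have aG: "a \<in> carrier G" using a AG by blast
  show ?thesis
  proof (cases "A = carrier G")
    case True then show ?thesis using a by blast
  next
    case False
    \<comment> \<open>The commutator with \<open>i\<close> lies in \<open>{\<one>, g}\<close> and is
      nontrivial off the centralizer.\<close>
    have twist: "x \<otimes> i = g \<otimes> (i \<otimes> x)" if x: "x \<in> carrier G" "x \<notin> A" for x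
      using i_comm[OF x(1)] x C2 i by (auto simp: A_def)
    have gcomm: "x \<otimes> g = g \<otimes> x" if "x \<in> carrier G" for x
      using C_central[OF that] C2 by simp
    have gg: "g \<otimes> g = \<one>" using g2 by (simp add: numeral_2_eq_2)
    \<comment> \<open>The two factors \<open>g\<close> cancel, so \<open>A\<close> has index
      2.\<close>
    have twist2: "x \<otimes> z \<in> A" if x: "x \<in> carrier G" "x \<notin> A" and z: "z \<in> carrier G" "z \<notin> A" for x z
    proof -
      have "x \<otimes> z \<otimes> i = x \<otimes> (g \<otimes> (i \<otimes> z))" using twist[OF z] x z i by (simp add: m_assoc)
      also have "\<dots> = (x \<otimes> g) \<otimes> (i \<otimes> z)" using x z i by (simp add: m_assoc)
      also have "\<dots> = g \<otimes> ((x \<otimes> i) \<otimes> z)" using x z i gcomm by (simp add: m_assoc)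
      also have "\<dots> = (g \<otimes> g) \<otimes> (i \<otimes> (x \<otimes> z))" using twist[OF x] x z i by (simp add: m_assoc)
      finally show ?thesis using gg x z i by (simp add: A_def)
    qed
    have sq: "x \<otimes> x = g" if x: "x \<in> carrier G" "x \<notin> A" for x
    proof -
      have xx: "x \<otimes> x = x [^] (2::nat)" using x by (simp add: numeral_2_eq_2)
      \<comment> \<open>The square commutes with \<open>i\<close>. Outside \<open>C\<close> its
        closure would contain \<open>i\<close>, and then \<open>cyc x\<close> would contain
        \<open>i\<close>, making \<open>x\<close> commute with \<open>i\<close>.\<close>
      have "x \<otimes> x \<in> C"
      proof (rule ccontr)
        assume n: "x \<otimes> x \<notin> C"
        have "i \<in> cyc (x \<otimes> x)" using i_cyc[of "x \<otimes> x"] twist2[OF x x] n x by (auto simp: A_def)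
        then have "i \<in> cyc x" using cyc_pow_subset[OF x(1), of 2] xx by auto
        then have "x \<otimes> i = i \<otimes> x" using cyc_commute[OF x(1)] cyc_self x by blast
        then show False using x by (simp add: A_def)
      qed
      moreover have "x \<noteq> \<one>" "x \<noteq> g" using x subgroup.one_closed[OF A] gcomm[OF i(1)] by (auto simp: A_def)
      ultimately show ?thesis using order2[OF x(1)] C2 xx by auto
    qed
    obtain y where y: "y \<in> carrier G" "y \<notin> A" using False AG by blast
    have inv_A: "inv x \<notin> A" if "x \<in> carrier G" "x \<notin> A" for x
      using that subgroup.m_inv_closed[OF A, of "inv x"] by auto
    have ord_pos: "ord a > 0" using ord_ge_1[OF finG aG] by simp
    have A_pow: "A = range (\<lambda>j::nat. a [^] j)"
    proof
      show "A \<subseteq> range (\<lambda>j::nat. a [^] j)"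
      proof
        fix z assume "z \<in> A"
        then have "z \<in> cyc a" using a by simp
        from cyc_torsion[OF aG pow_ord_eq_1[OF aG] ord_pos this]
        show "z \<in> range (\<lambda>j::nat. a [^] j)" by blast
      qed
      show "range (\<lambda>j::nat. a [^] j) \<subseteq> A" using nat_pow_mem_subgroup[OF A a(1)] by auto
    qed
    have carrier: "carrier G = A \<union> (\<lambda>x. x \<otimes> y) ` A"
    proof
      show "carrier G \<subseteq> A \<union> (\<lambda>x. x \<otimes> y) ` A"
      proof
        fix x assume x: "x \<in> carrier G"
        show "x \<in> A \<union> (\<lambda>x. x \<otimes> y) ` A"
        proof (cases "x \<in> A")
          case xA: False
          have "x \<otimes> inv y \<in> A" using twist2[OF x xA _ inv_A[OF y]] y by simp
          moreover have "x = x \<otimes> inv y \<otimes> y" using x y by (simp add: m_assoc)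
          ultimately show ?thesis by blast
        qed simp
      qed
    qed (use AG y in auto)
    have ya: "y \<otimes> a \<notin> A"
    proof
      assume "y \<otimes> a \<in> A"
      then have "y \<otimes> a \<otimes> inv a \<in> A" using A a subgroup.m_closed subgroup.m_inv_closed by metis
      then show False using y aG by (simp add: m_assoc)
    qed
    \<comment> \<open>Both squares equal \<open>g\<close>; cancelling \<open>y\<close> shows that
      \<open>y\<close> inverts \<open>a\<close>.\<close>
    have "y \<otimes> a \<otimes> (y \<otimes> a) = y \<otimes> y" using sq[OF _ ya] sq[OF y] y aG by simp
    then have "a \<otimes> (y \<otimes> a) = y" using y aG by (simp add: m_assoc)
    then have rel: "a \<otimes> y = y \<otimes> inv a"
      using y aG by (metis inv_solve_right m_assoc m_closed)
    obtain k where "a [^] ((2::nat) ^ k) \<in> C" using exists_p_power_mem_C[OF aG] p2 by blast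
    then have "(a [^] ((2::nat) ^ k)) [^] (2::nat) = \<one>" using C2 g2 by auto
    then have "ord a dvd 2 ^ Suc k" using aG by (simp add: nat_pow_pow pow_eq_id mult.commute)
    then obtain m where m: "ord a = 2 ^ m"
      using divides_primepow_nat[OF two_is_prime_nat] by blast
    obtain j where j: "i = a [^] (j::nat)" using iA A_pow by blast
    \<comment> \<open>The root \<open>i\<close> is a power of \<open>a\<close> and its square
      \<open>g\<close> is nontrivial, so the order of \<open>a\<close> cannot divide 2.\<close>
    have "m \<ge> 2"
    proof (rule ccontr)
      assume "\<not> m \<ge> 2"
      then have "ord a dvd 2" using m by (cases m) (auto simp: le_Suc_eq not_le less_Suc_eq)
      then have "a [^] (2::nat) = \<one>" using aG by (simp add: pow_eq_id)
      then have "(a [^] (2::nat)) [^] j = \<one>" by simp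
      then have "i [^] (2::nat) = \<one>" using j aG by (simp add: nat_pow_pow mult.commute)
      then show False using i2 g_not_one by simp
    qed
    have "a [^] ((2::nat) ^ (m - 1)) = g"
    proof (rule order2)
      show "a [^] ((2::nat) ^ (m - 1)) \<in> carrier G" using aG by simp
      show "a [^] ((2::nat) ^ (m - 1)) \<noteq> \<one>"
      proof -
        have "\<not> (2::nat) ^ m dvd 2 ^ (m - 1)"
          using \<open>m \<ge> 2\<close> by (auto dest!: dvd_imp_le)
        then show ?thesis using m aG by (simp add: pow_eq_id)
      qed
      have "(2::nat) ^ (m - 1) * 2 = 2 ^ m" using \<open>m \<ge> 2\<close> by (cases m) auto
      then show "(a [^] ((2::nat) ^ (m - 1))) [^] (2::nat) = \<one>"
        using m aG by (simp add: nat_pow_pow pow_eq_id)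
    qed
    then have "y \<otimes> y = a [^] ((2::nat) ^ (m - 1))" using sq y by simp
    \<comment> \<open>With \<open>n = Suc m\<close> the cyclic part has order
      \<open>2 ^ (n - 1)\<close>, and \<open>m \<ge> 2\<close> becomes
      \<open>n \<ge> 3\<close>.\<close>
    then have "quaternion_generators G (Suc m) a y"
      unfolding quaternion_generators_def
      using \<open>m \<ge> 2\<close> aG y m rel carrier by (auto simp: A_pow)
    moreover have "y [^] (2::nat) = g" using sq y by (simp add: numeral_2_eq_2)
    ultimately show ?thesis using finG by blast
  qed
qed

end

section \<open>Profinite groups\<close>

context topological_group begin

lemma continuous_map_mult:
  assumes "continuous_map X T f" "continuous_map X T h"
  shows "continuous_map X T (\<lambda>x. f x \<otimes> h x)"
proof -
  have "continuous_map X (prod_topology T T) (\<lambda>x. (f x, h x))"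
    using assms by (simp add: continuous_map_paired)
  from continuous_map_compose[OF this continuous_mult] show ?thesis by (simp add: o_def)
qed

lemma continuous_map_inv:
  assumes "continuous_map X T f" shows "continuous_map X T (\<lambda>x. inv (f x))"
  using continuous_map_compose[OF assms continuous_inv] by (simp add: o_def)

lemma continuous_map_const_group: "a \<in> carrier G \<Longrightarrow> continuous_map X T (\<lambda>x. a)"
  by (simp add: topspace_eq)

lemma continuous_map_ident: "continuous_map T T (\<lambda>x. x)"
  by simp

lemma continuous_map_nat_pow: "continuous_map T T (\<lambda>x. x [^] (n::nat))"
proof (induction n)
  case 0 then show ?case by (simp add: topspace_eq)
next
  case (Suc n) then show ?case by (simp add: continuous_map_mult)
qed

lemmas continuous_intros_group = continuous_map_mult continuous_map_inv continuous_map_const_group continuous_map_ident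

lemma openin_preimage:
  "continuous_map T T f \<Longrightarrow> openin T U \<Longrightarrow> openin T {x \<in> carrier G. f x \<in> U}"
  using openin_continuous_map_preimage[of T T f U] by (simp add: topspace_eq)

lemma closedin_preimage:
  "continuous_map T T f \<Longrightarrow> closedin T U \<Longrightarrow> closedin T {x \<in> carrier G. f x \<in> U}"
  using closedin_continuous_map_preimage[of T T f U] by (simp add: topspace_eq)

lemma openin_subset_carrier: "openin T U \<Longrightarrow> U \<subseteq> carrier G"
  using openin_subset topspace_eq by metis

lemma closedin_subset_carrier: "closedin T U \<Longrightarrow> U \<subseteq> carrier G"
  using closedin_subset topspace_eq by metis

lemma closedin_left_translate:
  assumes "closedin T F" "a \<in> carrier G" shows "closedin T ((\<lambda>x. a \<otimes> x) ` F)"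
proof -
  have "(\<lambda>x. a \<otimes> x) ` F = {x \<in> carrier G. inv a \<otimes> x \<in> F}"
  proof
    show "(\<lambda>x. a \<otimes> x) ` F \<subseteq> {x \<in> carrier G. inv a \<otimes> x \<in> F}"
      using assms closedin_subset_carrier[OF assms(1)] by (auto simp: m_assoc[symmetric])
    show "{x \<in> carrier G. inv a \<otimes> x \<in> F} \<subseteq> (\<lambda>x. a \<otimes> x) ` F"
    proof
      fix x assume "x \<in> {x \<in> carrier G. inv a \<otimes> x \<in> F}"
      then have "x = a \<otimes> (inv a \<otimes> x)" "inv a \<otimes> x \<in> F" using assms by (auto simp: m_assoc[symmetric])
      then show "x \<in> (\<lambda>x. a \<otimes> x) ` F" by (rule image_eqI)
    qed
  qed
  moreover have "closedin T {x \<in> carrier G. inv a \<otimes> x \<in> F}"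
    using assms by (intro closedin_preimage continuous_intros_group) auto
  ultimately show ?thesis by simp
qed

lemma rcoset_preimage:
  assumes "H \<subseteq> carrier G" "a \<in> carrier G"
  shows "H #> a = {x \<in> carrier G. x \<otimes> inv a \<in> H}"
proof
  show "H #> a \<subseteq> {x \<in> carrier G. x \<otimes> inv a \<in> H}"
    using assms by (auto simp: r_coset_def m_assoc)
  show "{x \<in> carrier G. x \<otimes> inv a \<in> H} \<subseteq> H #> a"
  proof
    fix x assume "x \<in> {x \<in> carrier G. x \<otimes> inv a \<in> H}"
    then have "x = x \<otimes> inv a \<otimes> a" "x \<otimes> inv a \<in> H" using assms by (auto simp: m_assoc)
    then show "x \<in> H #> a" unfolding r_coset_def by blast
  qed
qed

lemma openin_rcoset:
  assumes "openin T H" "a \<in> carrier G" shows "openin T (H #> a)"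
proof -
  have "continuous_map T T (\<lambda>x. x \<otimes> inv a)"
    using assms(2) by (intro continuous_intros_group) auto
  from openin_preimage[OF this assms(1)] show ?thesis
    using rcoset_preimage[OF openin_subset_carrier[OF assms(1)] assms(2)] by simp
qed

lemma closedin_rcoset:
  assumes "closedin T H" "a \<in> carrier G" shows "closedin T (H #> a)"
proof -
  have "continuous_map T T (\<lambda>x. x \<otimes> inv a)"
    using assms(2) by (intro continuous_intros_group) auto
  from closedin_preimage[OF this assms(1)] show ?thesis
    using rcoset_preimage[OF closedin_subset_carrier[OF assms(1)] assms(2)] by simp
qed

lemma openin_subgroup_above:
  assumes H: "openin T H" "subgroup H G" and K: "subgroup K G" "H \<subseteq> K"
  shows "openin T K"
proof -
  have "openin T (\<Union>k\<in>K. H #> k)"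
    using H K by (intro openin_Union) (auto intro!: openin_rcoset simp: subgroup.mem_carrier)
  moreover have "(\<Union>k\<in>K. H #> k) = K"
  proof
    show "(\<Union>k\<in>K. H #> k) \<subseteq> K"
      using K subgroup.m_closed[OF K(1)] by (auto simp: r_coset_def)
    show "K \<subseteq> (\<Union>k\<in>K. H #> k)"
      using rcos_self[OF subgroup.mem_carrier[OF K(1)] H(2)] by blast
  qed
  ultimately show ?thesis by simp
qed

lemma closedin_open_subgroup:
  assumes H: "openin T H" "subgroup H G"
  shows "closedin T H"
proof -
  have "openin T (\<Union>a\<in>carrier G - H. H #> a)"
    using H by (intro openin_Union) (auto intro!: openin_rcoset)
  moreover have "(\<Union>a\<in>carrier G - H. H #> a) = carrier G - H"
  proof
    show "(\<Union>a\<in>carrier G - H. H #> a) \<subseteq> carrier G - H"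
    proof clarify
      fix x a assume a: "a \<in> carrier G" "a \<notin> H" and x: "x \<in> H #> a"
      then obtain h where h: "h \<in> H" "x = h \<otimes> a" by (auto simp: r_coset_def)
      have hG: "h \<in> carrier G" using subgroup.mem_carrier[OF H(2) h(1)] .
      have "x \<notin> H"
      proof
        assume "x \<in> H"
        then have "inv h \<otimes> x \<in> H" using h H by (simp add: subgroup.m_closed subgroup.m_inv_closed)
        then show False using a h hG by (simp add: m_assoc[symmetric])
      qed
      then show "x \<in> carrier G - H" using h hG a by simp
    qed
    show "carrier G - H \<subseteq> (\<Union>a\<in>carrier G - H. H #> a)"
      using rcos_self[OF _ H(2)] by blast
  qed
  ultimately show ?thesis
    using openin_subset_carrier[OF H(1)] by (simp add: closedin_def topspace_eq)
qed

lemma subgroup_closure_of: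
  assumes H: "subgroup H G"
  shows "subgroup (T closure_of H) G"
proof (rule subgroupI)
  have sub: "H \<subseteq> T closure_of H"
    using H by (simp add: closure_of_subset subgroup.subset topspace_eq)
  show "T closure_of H \<subseteq> carrier G" using closure_of_subset_topspace topspace_eq by metis
  show "T closure_of H \<noteq> {}" using sub subgroup.one_closed[OF H] by blast
  show "inv a \<in> T closure_of H" if "a \<in> T closure_of H" for a
  proof -
    have "(\<lambda>x. inv x) ` (T closure_of H) \<subseteq> T closure_of ((\<lambda>x. inv x) ` H)"
      using continuous_map_image_closure_subset[OF continuous_inv] .
    moreover have "(\<lambda>x. inv x) ` H \<subseteq> H" using subgroup.m_inv_closed[OF H] by auto
    ultimately show ?thesis using that closure_of_mono[of "(\<lambda>x. inv x) ` H" H T] by blast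
  qed
  show "a \<otimes> b \<in> T closure_of H" if "a \<in> T closure_of H" "b \<in> T closure_of H" for a b
  proof -
    have "(\<lambda>(x, y). x \<otimes> y) ` (prod_topology T T closure_of (H \<times> H)) \<subseteq> T closure_of ((\<lambda>(x, y). x \<otimes> y) ` (H \<times> H))"
      using continuous_map_image_closure_subset[OF continuous_mult] .
    moreover have "(\<lambda>(x, y). x \<otimes> y) ` (H \<times> H) \<subseteq> H" using subgroup.m_closed[OF H] by auto
    moreover have "(a, b) \<in> prod_topology T T closure_of (H \<times> H)" using that by (simp add: closure_of_Times)
    ultimately show ?thesis using closure_of_mono[of "(\<lambda>(x, y). x \<otimes> y) ` (H \<times> H)" H T] by force
  qed
qed

definition span :: "'a set \<Rightarrow> 'a set" where
  "span X = T closure_of (generate G X)"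

lemma span_subgroup: "X \<subseteq> carrier G \<Longrightarrow> subgroup (span X) G"
  by (simp add: span_def subgroup_closure_of generate_is_subgroup)

lemma span_closed: "closedin T (span X)"
  by (simp add: span_def)

lemma generate_subset_span: "X \<subseteq> carrier G \<Longrightarrow> generate G X \<subseteq> span X"
  unfolding span_def using generate_incl by (intro closure_of_subset) (auto simp: topspace_eq)

lemma subset_span: "X \<subseteq> carrier G \<Longrightarrow> X \<subseteq> span X"
  using generate_subset_span[of X] generate.incl[of _ X G] by blast

lemma span_least: "X \<subseteq> F \<Longrightarrow> subgroup F G \<Longrightarrow> closedin T F \<Longrightarrow> span X \<subseteq> F"
  unfolding span_def by (intro closure_of_minimal generate_subgroup_incl)

lemma span_mono: "X \<subseteq> Y \<Longrightarrow> Y \<subseteq> carrier G \<Longrightarrow> span X \<subseteq> span Y"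
  unfolding span_def by (intro closure_of_mono mono_generate)

abbreviation cyc :: "'a \<Rightarrow> 'a set" where "cyc x \<equiv> span {x}"

lemma top_generates_iff: "top_generates G T X \<longleftrightarrow> X \<subseteq> carrier G \<and> span X = carrier G"
  by (simp add: top_generates_def span_def)

text \<open>For closed \<open>H\<close> the closure in the subtopology agrees with the one in
  \<open>T\<close>, so generation of \<open>H\<close> can be read off \<open>span\<close> in the
  ambient group.\<close>

lemma top_generates_subgroup_iff:
  assumes H: "subgroup H G" "closedin T H"
  shows "top_generates (G\<lparr>carrier := H\<rparr>) (subtopology T H) X \<longleftrightarrow> X \<subseteq> H \<and> span X = H"
proof (cases "X \<subseteq> H")
  case True
  have gen: "generate (G\<lparr>carrier := H\<rparr>) X = generate G X"
    using generate_consistent[OF True H(1)] by simp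
  have "generate G X \<subseteq> H" using True H(1) by (rule generate_subgroup_incl)
  moreover have "T closure_of (generate G X) \<subseteq> H" using span_least[OF True H] by (simp add: span_def)
  ultimately have "subtopology T H closure_of (generate G X) = span X"
    by (simp add: closure_of_subtopology span_def Int_absorb1)
  then show ?thesis using True by (simp add: top_generates_def gen)
qed (simp add: top_generates_def)

lemma minimal_generating_set_subgroup_iff:
  assumes H: "subgroup H G" "closedin T H"
  shows "minimal_generating_set (G\<lparr>carrier := H\<rparr>) (subtopology T H) X
    \<longleftrightarrow> X \<subseteq> H \<and> span X = H \<and> (\<forall>Y. Y \<subset> X \<longrightarrow> span Y \<noteq> H)"
  unfolding minimal_generating_set_def top_generates_subgroup_iff[OF H] by blast

end

section \<open>Compactness: open normal subgroups and procyclic subgroups\<close>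

context profinite_group begin

lemma closedin_singleton: "a \<in> carrier G \<Longrightarrow> closedin T {a}"
  using Hausdorff topspace_eq by (simp add: closedin_Hausdorff_singleton)

lemma closedin_finite: "finite F \<Longrightarrow> F \<subseteq> carrier G \<Longrightarrow> closedin T F"
  using Hausdorff topspace_eq by (simp add: closedin_Hausdorff_finite)

lemma closedin_image:
  assumes "continuous_map T T f" "closedin T F" shows "closedin T (f ` F)"
  using assms compact Hausdorff continuous_imp_closed_map closed_map_def by metis

text \<open>The cosets form an open cover by disjoint nonempty sets, so a finite subcover must
  contain all of them.\<close>

lemma finite_rcosets_open:
  assumes H: "subgroup H G" "openin T H"
  shows "finite (rcosets H)"
proof -
  have "compactin T (\<Union>(rcosets H))"
    using compact rcosets_part_G[OF H(1)] by (simp add: compact_space_def topspace_eq)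
  moreover have op: "openin T U" if "U \<in> rcosets H" for U
    using that openin_rcoset[OF H(2)] by (auto simp: RCOSETS_def)
  ultimately obtain F where F: "finite F" "F \<subseteq> rcosets H" "\<Union>(rcosets H) \<subseteq> \<Union>F"
    unfolding compactin_def by (metis (no_types, lifting) order_refl)
  have "rcosets H \<subseteq> F"
  proof
    fix U assume U: "U \<in> rcosets H"
    then obtain x where x: "x \<in> U" using subgroup.rcosets_non_empty[OF H(1)] by blast
    then obtain V where V: "V \<in> F" "x \<in> V" using F U by blast
    then have "U = V"
      using rcos_disjoint[OF H(1)] U x F(2) unfolding pairwise_def disjnt_def by blast
    then show "U \<in> F" using V by simp
  qed
  then show ?thesis using F(1) finite_subset by blast
qed

text \<open>By the tube lemma, a condition quantified over a compact set remains open.\<close>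

lemma openin_forall:
  assumes K: "compactin T K" and f: "continuous_map (prod_topology T T) T f" and W: "openin T W"
  shows "openin T {y \<in> carrier G. \<forall>k\<in>K. f (k, y) \<in> W}"
proof (subst openin_subopen, intro ballI)
  fix y assume y: "y \<in> {y \<in> carrier G. \<forall>k\<in>K. f (k, y) \<in> W}"
  let ?W = "{z \<in> topspace (prod_topology T T). f z \<in> W}"
  have KG: "K \<subseteq> carrier G" using compactin_subset_topspace[OF K] topspace_eq by simp
  have "openin (prod_topology T T) ?W" using openin_continuous_map_preimage[OF f W] .
  moreover have "K \<times> {y} \<subseteq> ?W" using y KG topspace_eq by auto
  moreover have "y \<in> topspace T" using y topspace_eq by simp
  ultimately obtain U V where UV: "openin T V" "K \<subseteq> U" "y \<in> V" "U \<times> V \<subseteq> ?W"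
    using tube_lemma_left[of T T ?W K y] K by blast
  have "V \<subseteq> {y \<in> carrier G. \<forall>k\<in>K. f (k, y) \<in> W}"
    using UV openin_subset_carrier[OF UV(1)] by blast
  then show "\<exists>V. openin T V \<and> y \<in> V \<and> V \<subseteq> {y \<in> carrier G. \<forall>k\<in>K. f (k, y) \<in> W}"
    using UV by blast
qed

text \<open>In a compact Hausdorff space a component has arbitrarily small clopen neighbourhoods,
  and here the components are points.\<close>

lemma clopen_nbhd:
  assumes W: "openin T W" "a \<in> W"
  obtains U where "openin T U" "closedin T U" "a \<in> U" "U \<subseteq> W"
proof -
  have aT: "a \<in> topspace T" using W openin_subset by blast
  let ?C = "connected_component_of_set T a"
  have "\<exists>b. ?C \<subseteq> {b}"
    using totally_disconnected connectedin_connected_component_of unfolding totally_disconnected_space_def by metis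
  moreover have "a \<in> ?C" using aT by (simp add: connected_component_of_refl)
  ultimately have C: "?C = {a}" by auto
  have "locally_compact_space T" using compact by (simp add: compact_imp_locally_compact_space)
  moreover have "?C \<in> connected_components_of T"
    using aT by (simp add: connected_component_in_connected_components_of)
  ultimately obtain U V where "openin T U" "openin T V" "disjnt U V" "U \<union> V = topspace T" "{a} \<subseteq> U" "U \<subseteq> W"
    using wilder_locally_compact_component_thm[of T "{a}" W] Hausdorff W aT C by (metis compactin_sing empty_subsetI insert_subset)
  moreover from this have "U = topspace T - V" by (auto simp: disjnt_iff)
  with \<open>openin T V\<close> have "closedin T U" by blast
  ultimately show thesis using that by blast
qed

lemma open_normal_nbhd:
  assumes W: "openin T W" "\<one> \<in> W"
  obtains N where "N \<lhd> G" "openin T N" "N \<subseteq> W"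
proof -
  obtain U where U: "openin T U" "closedin T U" "\<one> \<in> U" "U \<subseteq> W"
    using clopen_nbhd[OF W] .
  have UG: "U \<subseteq> carrier G" using U openin_subset_carrier by blast
  have Uc: "compactin T U" using U(2) compact closedin_compact_space by blast
  \<comment> \<open>The right stabilizer of \<open>U\<close>: imposing the condition on
    \<open>inv x\<close> too makes it a group, and it lies in \<open>U\<close> because
    \<open>\<one>\<close> does.\<close>
  define H where "H = {x \<in> carrier G. \<forall>u\<in>U. u \<otimes> x \<in> U} \<inter> {x \<in> carrier G. \<forall>u\<in>U. u \<otimes> inv x \<in> U}"
  have c: "continuous_map (prod_topology T T) T (\<lambda>z. fst z \<otimes> snd z)"
    "continuous_map (prod_topology T T) T (\<lambda>z. fst z \<otimes> inv (snd z))"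
    "continuous_map (prod_topology T T) T (\<lambda>z. fst z \<otimes> snd z \<otimes> inv (fst z))"
    by (intro continuous_map_mult continuous_map_inv continuous_map_fst continuous_map_snd)+
  have Ho: "openin T H"
    unfolding H_def using openin_forall[OF Uc c(1) U(1)] openin_forall[OF Uc c(2) U(1)]
    by (intro openin_Int) simp_all
  have H: "subgroup H G"
  proof (rule subgroupI)
    have "\<one> \<in> H" using UG U(3) by (auto simp: H_def subsetD)
    then show "H \<noteq> {}" by blast
    show "inv x \<in> H" if "x \<in> H" for x using that by (auto simp: H_def)
    show "x \<otimes> y \<in> H" if "x \<in> H" "y \<in> H" for x y
      using that UG by (auto simp: H_def m_assoc[symmetric] inv_mult_group subsetD)
  qed (auto simp: H_def)
  have HU: "H \<subseteq> U"
  proof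
    fix x assume "x \<in> H" then have "x \<in> carrier G" "\<one> \<otimes> x \<in> U" using U(3) by (auto simp: H_def)
    then show "x \<in> U" by simp
  qed
  \<comment> \<open>The normal core of \<open>H\<close>, open because the conjugating elements range
    over a compact set.\<close>
  define N where "N = {x \<in> carrier G. \<forall>k\<in>carrier G. k \<otimes> x \<otimes> inv k \<in> H}"
  have "compactin T (carrier G)" using compact topspace_eq by (simp add: compact_space_def)
  from openin_forall[OF this c(3) Ho] have No: "openin T N" by (simp add: N_def)
  have conj_mult: "k \<otimes> (x \<otimes> y) \<otimes> inv k = (k \<otimes> x \<otimes> inv k) \<otimes> (k \<otimes> y \<otimes> inv k)"
    if "k \<in> carrier G" "x \<in> carrier G" "y \<in> carrier G" for k x y
  proof -
    have "(k \<otimes> x \<otimes> inv k) \<otimes> (k \<otimes> y \<otimes> inv k) = k \<otimes> x \<otimes> (inv k \<otimes> k) \<otimes> y \<otimes> inv k"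
      using that by (simp only: m_assoc m_closed inv_closed)
    then show ?thesis using that by (simp add: m_assoc)
  qed
  have Ns: "subgroup N G"
  proof (rule subgroupI)
    show "N \<noteq> {}" unfolding N_def using subgroup.one_closed[OF H] by (auto intro!: exI[of _ \<one>])
    show "inv x \<in> N" if x: "x \<in> N" for x
    proof -
      have xG: "x \<in> carrier G" using x by (simp add: N_def)
      have "k \<otimes> inv x \<otimes> inv k \<in> H" if k: "k \<in> carrier G" for k
      proof -
        have "inv (k \<otimes> x \<otimes> inv k) \<in> H" using x k subgroup.m_inv_closed[OF H] by (simp add: N_def)
        moreover have "inv (k \<otimes> x \<otimes> inv k) = k \<otimes> inv x \<otimes> inv k"
          using xG k by (simp add: inv_mult_group m_assoc)
        ultimately show ?thesis by simp
      qed
      then show ?thesis using xG by (simp add: N_def)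
    qed
    show "x \<otimes> y \<in> N" if "x \<in> N" "y \<in> N" for x y
      using that subgroup.m_closed[OF H] by (simp add: N_def conj_mult)
  qed (auto simp: N_def)
  have "N \<lhd> G"
    unfolding normal_inv_iff
  proof (intro conjI Ns ballI)
    fix x h assume x: "x \<in> carrier G" and h: "h \<in> N"
    then have hG: "h \<in> carrier G" by (simp add: N_def)
    have "k \<otimes> (x \<otimes> h \<otimes> inv x) \<otimes> inv k \<in> H" if k: "k \<in> carrier G" for k
    proof -
      have "k \<otimes> (x \<otimes> h \<otimes> inv x) \<otimes> inv k = (k \<otimes> x) \<otimes> h \<otimes> inv (k \<otimes> x)"
        using x hG k by (simp add: m_assoc inv_mult_group)
      then show ?thesis using h x k by (simp add: N_def)
    qed
    then show "x \<otimes> h \<otimes> inv x \<in> N" using x hG by (simp add: N_def)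
  qed
  moreover have "N \<subseteq> W"
  proof
    fix x assume "x \<in> N"
    then have x: "x \<in> carrier G" "\<forall>k\<in>carrier G. k \<otimes> x \<otimes> inv k \<in> H" by (auto simp: N_def)
    from bspec[OF x(2) one_closed] have "x \<in> H" using x(1) by simp
    then show "x \<in> W" using HU U(4) by auto
  qed
  ultimately show thesis using that No by blast
qed

lemma open_normal_avoiding:
  assumes "a \<in> carrier G" "a \<noteq> \<one>"
  obtains N where "N \<lhd> G" "openin T N" "a \<notin> N"
proof -
  have "openin T (carrier G - {a})"
    using closedin_singleton[OF assms(1)] by (simp add: closedin_def topspace_eq)
  from open_normal_nbhd[OF this] assms show thesis using that by blast
qed

lemma closed_subgroup_open_hull:
  assumes M: "subgroup M G" "closedin T M" and g: "g \<in> carrier G" "g \<notin> M"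
  obtains K where "subgroup K G" "openin T K" "M \<subseteq> K" "g \<notin> K"
proof -
  have "openin T (carrier G - M)" using M(2) by (simp add: closedin_def topspace_eq)
  \<comment> \<open>A normal \<open>N\<close> inside this set keeps \<open>g\<close> out of
    \<open>N <#> M\<close>: from \<open>g = n \<otimes> m\<close> the element
    \<open>inv n \<otimes> g\<close> would be in \<open>M\<close>.\<close>
  then have "openin T {x \<in> carrier G. x \<otimes> g \<in> carrier G - M}"
    using g by (intro openin_preimage continuous_intros_group) auto
  moreover have "\<one> \<in> {x \<in> carrier G. x \<otimes> g \<in> carrier G - M}" using g by simp
  ultimately obtain N where N: "N \<lhd> G" "openin T N" "N \<subseteq> {x \<in> carrier G. x \<otimes> g \<in> carrier G - M}"
    using open_normal_nbhd by blast
  interpret N: normal N G by (rule N(1))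
  have sub: "subgroup (N <#> M) G"
    using second_isomorphism_grp.normal_set_mult_subgroup[of N G M] N(1) M(1)
    by (simp add: second_isomorphism_grp_def second_isomorphism_grp_axioms_def)
  have NK: "N \<subseteq> N <#> M"
  proof
    fix x assume x: "x \<in> N"
    then have "x = x \<otimes> \<one>" using N.mem_carrier by simp
    then show "x \<in> N <#> M" using x subgroup.one_closed[OF M(1)] unfolding set_mult_def by blast
  qed
  have MK: "M \<subseteq> N <#> M"
  proof
    fix x assume x: "x \<in> M"
    then have "x = \<one> \<otimes> x" using subgroup.mem_carrier[OF M(1)] by simp
    then show "x \<in> N <#> M" using x N.one_closed unfolding set_mult_def by blast
  qed
  have "g \<notin> N <#> M"
  proof
    assume "g \<in> N <#> M"
    then obtain n m where nm: "n \<in> N" "m \<in> M" "g = n \<otimes> m" unfolding set_mult_def by blast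
    have "inv n \<otimes> g = m" using nm N.mem_carrier subgroup.mem_carrier[OF M(1)] by (simp add: m_assoc[symmetric])
    moreover have "inv n \<in> N" using nm by simp
    ultimately show False using N(3) nm(2) by blast
  qed
  then show thesis using that[OF sub openin_subgroup_above[OF N(2) N.subgroup_axioms sub NK] MK] by blast
qed

text \<open>Centralizers are closed subgroups. Applied to \<open>x\<close> this makes
  \<open>y\<close> commute with \<open>x\<close>; applied to \<open>y\<close> it then reaches
  \<open>z\<close>.\<close>

lemma cyc_abelian:
  assumes x: "x \<in> carrier G" and y: "y \<in> cyc x" and z: "z \<in> cyc x"
  shows "y \<otimes> z = z \<otimes> y"
proof -
  have centralizer: "cyc x \<subseteq> {b \<in> carrier G. a \<otimes> b = b \<otimes> a}" if a: "a \<in> carrier G" "a \<otimes> x = x \<otimes> a" for a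
  proof (rule span_least)
    show "{x} \<subseteq> {b \<in> carrier G. a \<otimes> b = b \<otimes> a}" using x a by simp
    show "subgroup {b \<in> carrier G. a \<otimes> b = b \<otimes> a} G"
    proof (rule subgroupI)
      show "{b \<in> carrier G. a \<otimes> b = b \<otimes> a} \<noteq> {}" using x a by blast
      show "inv b \<in> {b \<in> carrier G. a \<otimes> b = b \<otimes> a}" if "b \<in> {b \<in> carrier G. a \<otimes> b = b \<otimes> a}" for b
      proof -
        have b: "b \<in> carrier G" "a \<otimes> b = b \<otimes> a" using that by auto
        have "inv b \<otimes> a = inv b \<otimes> (a \<otimes> b) \<otimes> inv b" using a b(1) by (simp add: m_assoc)
        also have "\<dots> = a \<otimes> inv b" using a b by (simp add: m_assoc[symmetric])
        finally show ?thesis using b by simp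
      qed
      show "b \<otimes> c \<in> {b \<in> carrier G. a \<otimes> b = b \<otimes> a}"
        if "b \<in> {b \<in> carrier G. a \<otimes> b = b \<otimes> a}" "c \<in> {b \<in> carrier G. a \<otimes> b = b \<otimes> a}" for b c
      proof -
        have bc: "b \<in> carrier G" "a \<otimes> b = b \<otimes> a" "c \<in> carrier G" "a \<otimes> c = c \<otimes> a" using that by auto
        have "b \<otimes> c \<otimes> a = b \<otimes> (a \<otimes> c)" using a bc by (simp add: m_assoc)
        also have "\<dots> = a \<otimes> (b \<otimes> c)" using a bc(1-3) by (simp add: m_assoc[symmetric])
        finally show ?thesis using bc by simp
      qed
    qed auto
    have "a \<otimes> b = b \<otimes> a \<longleftrightarrow> a \<otimes> b \<otimes> inv (b \<otimes> a) \<in> {\<one>}" if b: "b \<in> carrier G" for b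
      using right_cancel[of "inv (b \<otimes> a)" "a \<otimes> b" "b \<otimes> a"] a(1) b r_inv[of "b \<otimes> a"] by simp
    then have "{b \<in> carrier G. a \<otimes> b = b \<otimes> a} = {b \<in> carrier G. a \<otimes> b \<otimes> inv (b \<otimes> a) \<in> {\<one>}}"
      by blast
    moreover have "closedin T {b \<in> carrier G. a \<otimes> b \<otimes> inv (b \<otimes> a) \<in> {\<one>}}"
      using a by (intro closedin_preimage continuous_intros_group closedin_singleton) auto
    ultimately show "closedin T {b \<in> carrier G. a \<otimes> b = b \<otimes> a}" by simp
  qed
  have yG: "y \<in> carrier G" using subgroup.mem_carrier[OF span_subgroup y] x by simp
  have "x \<otimes> y = y \<otimes> x" using centralizer[OF x] y by blast
  then show ?thesis using centralizer[of y] yG z by auto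
qed

lemma mem_cyc: "x \<in> carrier G \<Longrightarrow> x \<in> cyc x"
  using subset_span[of "{x}"] by simp

lemma cyc_subset: "subgroup F G \<Longrightarrow> closedin T F \<Longrightarrow> x \<in> F \<Longrightarrow> cyc x \<subseteq> F"
  using span_least[of "{x}" F] by simp

lemma int_pow_mem_cyc: "x \<in> carrier G \<Longrightarrow> x [^] (k::int) \<in> cyc x"
  using subgroup_int_pow_closed[OF span_subgroup mem_cyc] by simp

text \<open>Integer powers are dense in \<open>cyc x\<close>, and \<open>F\<close> may be any closed
  set; facts about exponents pass to \<open>cyc x\<close> in this way.\<close>

lemma cyc_subset_of_int_pows:
  assumes x: "x \<in> carrier G" and F: "closedin T F" "\<And>k::int. x [^] k \<in> F"
  shows "cyc x \<subseteq> F"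
  unfolding span_def generate_pow[OF x] using F by (intro closure_of_minimal) auto

text \<open>Both inclusions are checked on integer powers: the image is closed by compactness, the
  preimage by continuity.\<close>

lemma cyc_pow_image:
  assumes x: "x \<in> carrier G"
  shows "cyc (x [^] (n::nat)) = (\<lambda>y. y [^] n) ` cyc x"
proof
  have comm: "(x [^] k) [^] n = (x [^] n) [^] k" for k :: int
    using x by (simp add: int_pow_pow mult.commute flip: int_pow_int)
  show "cyc (x [^] n) \<subseteq> (\<lambda>y. y [^] n) ` cyc x"
  proof (rule cyc_subset_of_int_pows)
    show "closedin T ((\<lambda>y. y [^] n) ` cyc x)"
      using continuous_map_nat_pow span_closed by (rule closedin_image)
    show "(x [^] n) [^] (k::int) \<in> (\<lambda>y. y [^] n) ` cyc x" for k
      unfolding comm[symmetric] using int_pow_mem_cyc[OF x] by blast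
  qed (use x in simp)
  have "cyc x \<subseteq> {y \<in> carrier G. y [^] n \<in> cyc (x [^] n)}"
  proof (rule cyc_subset_of_int_pows[OF x])
    show "closedin T {y \<in> carrier G. y [^] n \<in> cyc (x [^] n)}"
      using continuous_map_nat_pow span_closed by (rule closedin_preimage)
    show "x [^] (k::int) \<in> {y \<in> carrier G. y [^] n \<in> cyc (x [^] n)}" for k
      using x int_pow_mem_cyc[of "x [^] n" k] by (simp add: comm)
  qed
  then show "(\<lambda>y. y [^] n) ` cyc x \<subseteq> cyc (x [^] n)" by auto
qed

text \<open>Division of exponents with remainder covers the integer powers by finitely many closed
  translates, and the union of these is closed.\<close>

lemma cyc_mod_pow:
  assumes x: "x \<in> carrier G" and n: "0 < n" and y: "y \<in> cyc x"
  shows "\<exists>i<n. \<exists>c\<in>cyc (x [^] (n::nat)). y = x [^] i \<otimes> c"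
proof -
  let ?F = "\<Union>i<n. (\<lambda>c. x [^] i \<otimes> c) ` cyc (x [^] n)"
  have "cyc x \<subseteq> ?F"
  proof (rule cyc_subset_of_int_pows[OF x])
    show "closedin T ?F"
      using x by (intro closedin_Union) (auto intro!: closedin_left_translate span_closed)
    fix k :: int
    have "x [^] k = x [^] (k mod int n + int n * (k div int n))" by simp
    also have "\<dots> = x [^] nat (k mod int n) \<otimes> (x [^] n) [^] (k div int n)"
      using x n by (simp only: int_pow_mult int_pow_pow[symmetric] int_pow_int[symmetric] int_nat_eq) simp
    finally have "x [^] k = x [^] nat (k mod int n) \<otimes> (x [^] n) [^] (k div int n)" .
    moreover have "nat (k mod int n) < n" using n by (simp add: nat_less_iff)
    moreover have "(x [^] n) [^] (k div int n) \<in> cyc (x [^] n)" using x int_pow_mem_cyc by simp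
    ultimately show "x [^] k \<in> ?F" by blast
  qed
  then show ?thesis using y by blast
qed

lemma open_normal_pow_mem:
  assumes "N \<lhd> G" "openin T N"
  obtains n :: nat where "n > 0" "\<And>x. x \<in> carrier G \<Longrightarrow> x [^] n \<in> N"
proof -
  interpret N: normal N G by (rule assms(1))
  interpret Q: group "G Mod N" by (rule N.factorgroup_is_group)
  have "finite (carrier (G Mod N))"
    using finite_rcosets_open[OF N.subgroup_axioms assms(2)] by (simp add: FactGroup_def)
  then have "Coset.order (G Mod N) > 0" using Q.order_gt_0_iff_finite by blast
  moreover have "x [^] Coset.order (G Mod N) \<in> N" if x: "x \<in> carrier G" for x
  proof -
    have "N #> x \<in> carrier (G Mod N)" using x by (auto simp: carrier_FactGroup)
    from Q.pow_order_eq_1[OF this] have "N #> (x [^] Coset.order (G Mod N)) = N"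
      using x by (simp add: N.FactGroup_pow)
    then show ?thesis using x rcos_self[OF _ N.subgroup_axioms, of "x [^] Coset.order (G Mod N)"] by simp
  qed
  ultimately show thesis using that by blast
qed

sublocale procyclic_closure G cyc
proof (intro procyclic_closure.intro procyclic_closure_axioms.intro)
  show "group G" ..
next
  fix x assume x: "x \<in> carrier G"
  show "subgroup (cyc x) G" using x by (simp add: span_subgroup)
  show "x \<in> cyc x" using x by (rule mem_cyc)
  show "cyc y \<subseteq> cyc x" if "y \<in> cyc x" for y
    using that x by (intro cyc_subset span_subgroup span_closed) auto
  show "y \<otimes> z = z \<otimes> y" if "y \<in> cyc x" "z \<in> cyc x" for y z using cyc_abelian[OF x that] .
  show "\<exists>i<n. \<exists>c\<in>cyc (x [^] (n::nat)). y = x [^] i \<otimes> c" if "0 < n" "y \<in> cyc x" for n y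
    using cyc_mod_pow[OF x that] .
  show "cyc (x [^] (n::nat)) = (\<lambda>y. y [^] n) ` cyc x" for n using cyc_pow_image[OF x] .
  \<comment> \<open>An open normal subgroup that avoids \<open>x\<close> contains some power
    \<open>x [^] n\<close> and hence all of \<open>cyc (x [^] n)\<close>.\<close>
  show "x = \<one>" if eq: "\<And>n::nat. 0 < n \<Longrightarrow> cyc (x [^] n) = cyc x"
  proof (rule ccontr)
    assume "x \<noteq> \<one>"
    then obtain N where N: "N \<lhd> G" "openin T N" "x \<notin> N" using open_normal_avoiding[OF x] by blast
    obtain n :: nat where n: "n > 0" "\<And>x. x \<in> carrier G \<Longrightarrow> x [^] n \<in> N"
      using open_normal_pow_mem[OF N(1,2)] by blast
    have "cyc (x [^] n) \<subseteq> N"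
      using n(2)[OF x] N normal_imp_subgroup closedin_open_subgroup by (intro cyc_subset) auto
    then show False using eq[OF n(1)] mem_cyc[OF x] N(3) by blast
  qed
qed

end

section \<open>Isolated vertices\<close>

context profinite_group begin

text \<open>Schreier's argument: with \<open>R\<close> a transversal of \<open>M\<close> and \<open>Y\<close> the elements \<open>r s r'\<^sup>-\<^sup>1\<close> of \<open>M\<close>,
  the set \<open>\<langle>Y\<rangle> R\<close> is stable under right multiplication by the generators of \<open>G\<close>.\<close>

lemma open_subgroup_finitely_generated:
  assumes fg: "top_finitely_generated G T" and M: "subgroup M G" "openin T M"
  obtains Y where "finite Y" "Y \<subseteq> M" "span Y = M"
proof -
  obtain S where S: "finite S" "S \<subseteq> carrier G" "span S = carrier G"
    using fg unfolding top_finitely_generated_def top_generates_iff by blast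
  have MG: "x \<in> carrier G" if "x \<in> M" for x using that by (rule subgroup.mem_carrier[OF M(1)])
  \<comment> \<open>The representative of \<open>M\<close> is fixed as \<open>\<one>\<close>, so
    that at the end a representative lying in \<open>M\<close> must be trivial.\<close>
  define r where "r = (\<lambda>X. if X = M then \<one> else SOME x. x \<in> X)"
  define R where "R = r ` (rcosets M)"
  have finR: "finite R" using finite_rcosets_open[OF M] by (simp add: R_def)
  have r: "r X \<in> X" if X: "X \<in> rcosets M" for X
    using subgroup.rcosets_non_empty[OF M(1) X] subgroup.one_closed[OF M(1)]
    unfolding r_def by (auto simp: some_in_eq)
  have RG: "R \<subseteq> carrier G"
    using r rcosets_part_G[OF M(1)] unfolding R_def by blast
  have MX: "M \<in> rcosets M" using M(1) subgroup.subgroup_in_rcosets is_group by blast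
  have oneR: "\<one> \<in> R"
    using MX unfolding R_def r_def by (intro image_eqI[of _ _ M]) auto
  have RM: "x = \<one>" if x: "x \<in> R" "x \<in> M" for x
  proof -
    obtain X where X: "X \<in> rcosets M" "x = r X" using x(1) unfolding R_def by blast
    then have "x \<in> X" using r by simp
    then have "X = M"
      using rcos_disjoint[OF M(1)] X(1) MX x(2) unfolding pairwise_def disjnt_def by blast
    then show ?thesis using X by (simp add: r_def)
  qed
  have cover: "\<exists>t\<in>R. x \<otimes> inv t \<in> M" if x: "x \<in> carrier G" for x
  proof -
    have X: "M #> x \<in> rcosets M" using x M(1) by (simp add: rcosetsI subgroup.subset)
    then obtain m where m: "m \<in> M" "r (M #> x) = m \<otimes> x" using r[OF X] by (auto simp: r_coset_def)
    have "x \<otimes> inv (m \<otimes> x) = inv m" using MG[OF m(1)] x by (simp add: inv_mult_group m_assoc[symmetric])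
    then have "x \<otimes> inv (r (M #> x)) \<in> M" using m subgroup.m_inv_closed[OF M(1)] by simp
    then show ?thesis using X unfolding R_def by blast
  qed
  define S' where "S' = S \<union> m_inv G ` S"
  have S'G: "S' \<subseteq> carrier G" using S by (auto simp: S'_def)
  define Y where "Y = (\<lambda>(t, s, u). t \<otimes> s \<otimes> inv u) ` (R \<times> S' \<times> R) \<inter> M"
  have finY: "finite Y" using finR S(1) by (simp add: Y_def S'_def)
  have YM: "Y \<subseteq> M" by (simp add: Y_def)
  have YG: "Y \<subseteq> carrier G" using YM MG by blast
  let ?H = "generate G Y"
  have H: "subgroup ?H G" using YG by (rule generate_is_subgroup)
  have HG: "x \<in> carrier G" if "x \<in> ?H" for x using that by (rule subgroup.mem_carrier[OF H])
  have step: "\<exists>h'\<in>?H. \<exists>u\<in>R. h \<otimes> t \<otimes> s = h' \<otimes> u" if h: "h \<in> ?H" and t: "t \<in> R" and s: "s \<in> S'" for h t s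
  proof -
    have tG: "t \<in> carrier G" and sG: "s \<in> carrier G" using t s RG S'G by auto
    obtain u where u: "u \<in> R" "t \<otimes> s \<otimes> inv u \<in> M" using cover[of "t \<otimes> s"] tG sG by auto
    have uG: "u \<in> carrier G" using u RG by blast
    have "t \<otimes> s \<otimes> inv u \<in> (\<lambda>(t, s, u). t \<otimes> s \<otimes> inv u) ` (R \<times> S' \<times> R)"
      by (rule image_eqI[of _ _ "(t, s, u)"]) (use t s u in auto)
    then have "t \<otimes> s \<otimes> inv u \<in> ?H" using u(2) by (intro generate.incl) (simp add: Y_def)
    then have "h \<otimes> (t \<otimes> s \<otimes> inv u) \<in> ?H" using h subgroup.m_closed[OF H] by blast
    moreover have "h \<otimes> t \<otimes> s = h \<otimes> (t \<otimes> s \<otimes> inv u) \<otimes> u"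
      using HG[OF h] tG sG uG by (simp add: m_assoc)
    ultimately show ?thesis using u(1) by blast
  qed
  have gen: "d \<in> carrier G \<and> (\<forall>h\<in>?H. \<forall>t\<in>R. \<exists>h'\<in>?H. \<exists>u\<in>R. h \<otimes> t \<otimes> d = h' \<otimes> u)"
    if "d \<in> generate G S" for d
    using that
  proof induction
    case one
    show ?case using HG RG by force
  next
    case (incl s)
    then show ?case using step S(2) by (auto simp: S'_def)
  next
    case (inv s)
    then show ?case using step S(2) by (auto simp: S'_def)
  next
    case (eng d e)
    have "\<exists>h'\<in>?H. \<exists>u\<in>R. h \<otimes> t \<otimes> (d \<otimes> e) = h' \<otimes> u" if h: "h \<in> ?H" and t: "t \<in> R" for h t
    proof -
      obtain h' u where hu: "h' \<in> ?H" "u \<in> R" "h \<otimes> t \<otimes> d = h' \<otimes> u" using eng.IH(1) h t by blast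
      obtain h'' v where hv: "h'' \<in> ?H" "v \<in> R" "h' \<otimes> u \<otimes> e = h'' \<otimes> v" using eng.IH(2) hu by blast
      have "h \<otimes> t \<otimes> (d \<otimes> e) = h'' \<otimes> v"
      proof -
        have c: "h \<in> carrier G" "t \<in> carrier G" "d \<in> carrier G" "e \<in> carrier G"
          using HG[OF h] t RG eng.IH by auto
        have "h \<otimes> t \<otimes> (d \<otimes> e) = h \<otimes> t \<otimes> d \<otimes> e" using c by (simp add: m_assoc)
        then show ?thesis unfolding hu(3) hv(3) .
      qed
      then show ?thesis using hv by blast
    qed
    then show ?case using eng.IH by simp
  qed
  \<comment> \<open>This finite union of closed cosets contains a dense subgroup and is therefore
    the whole group.\<close>
  have "generate G S \<subseteq> (\<Union>t\<in>R. span Y #> t)"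
  proof
    fix d assume d: "d \<in> generate G S"
    have dG: "d \<in> carrier G" using gen[OF d] by blast
    obtain h u where hu: "h \<in> ?H" "u \<in> R" "\<one> \<otimes> \<one> \<otimes> d = h \<otimes> u"
      using gen[OF d] generate.one oneR by blast
    have "h \<in> span Y" using hu(1) generate_subset_span[OF YG] by blast
    then show "d \<in> (\<Union>t\<in>R. span Y #> t)" using hu dG by (auto simp: r_coset_def)
  qed
  moreover have "closedin T (\<Union>t\<in>R. span Y #> t)"
    using finR RG by (intro closedin_Union) (auto intro!: closedin_rcoset span_closed)
  ultimately have cov: "carrier G \<subseteq> (\<Union>t\<in>R. span Y #> t)"
    using S(3) closure_of_minimal unfolding span_def by metis
  have sub: "span Y \<subseteq> M" using span_least[OF YM M(1) closedin_open_subgroup[OF M(2,1)]] .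
  have "M \<subseteq> span Y"
  proof
    fix m assume m: "m \<in> M"
    have "m \<in> (\<Union>t\<in>R. span Y #> t)" using cov MG[OF m] by (rule subsetD)
    then obtain t k where tk: "t \<in> R" "k \<in> span Y" "m = k \<otimes> t"
      by (auto simp: r_coset_def)
    have kM: "k \<in> M" using tk sub by blast
    have tG: "t \<in> carrier G" using tk RG by blast
    have "t = inv k \<otimes> m" using tk MG[OF kM] tG by (simp add: m_assoc[symmetric])
    then have "t \<in> M" using kM m subgroup.m_closed[OF M(1)] subgroup.m_inv_closed[OF M(1)] by simp
    then have "t = \<one>" using RM tk by blast
    then show "m \<in> span Y" using tk MG[OF kM] by simp
  qed
  then show thesis using that finY YM sub by blast
qed

lemma isolated_vertex_iff:
  "isolated_vertex (virt_graph G T) g \<longleftrightarrow>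
    g \<in> carrier G \<and> (\<forall>x\<in>carrier G. x \<noteq> g \<longrightarrow> \<not> virtually_independent G T g x)"
proof -
  have sym: "virtually_independent G T x y \<longleftrightarrow> virtually_independent G T y x" for x y
    unfolding virtually_independent_def by metis
  show ?thesis
    unfolding isolated_vertex_def virt_graph_def by (simp, metis insert_iff singletonD sym)
qed

lemma isolated_comparable:
  assumes fg: "top_finitely_generated G T" and iso: "isolated_vertex (virt_graph G T) g"
    and M: "subgroup M G" "openin T M" and gM: "g \<notin> M"
  shows "M \<subseteq> cyc g"
proof -
  have gG: "g \<in> carrier G" using iso by (simp add: isolated_vertex_iff)
  obtain Y where Y: "finite Y" "Y \<subseteq> M" "span Y = M"
    using open_subgroup_finitely_generated[OF fg M] .
  have YG: "insert g Y \<subseteq> carrier G" using gG Y(2) subgroup.subset[OF M(1)] by blast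
  define K where "K = span (insert g Y)"
  have K: "subgroup K G" unfolding K_def using YG by (rule span_subgroup)
  have MK: "M \<subseteq> K" unfolding K_def Y(3)[symmetric] using YG by (intro span_mono) auto
  have Ko: "openin T K" using openin_subgroup_above[OF M(2,1) K MK] .
  have Kc: "closedin T K" by (simp add: K_def span_closed)
  have gK: "insert g Y \<subseteq> K" unfolding K_def using YG by (rule subset_span)
  have "K = cyc g"
  proof (rule ccontr)
    assume ne: "K \<noteq> cyc g"
    \<comment> \<open>Finiteness of \<open>Y\<close> guarantees a minimal member, which is then a
      minimal generating set of the open subgroup \<open>K\<close>.\<close>
    let ?Z = "{Z. Z \<subseteq> insert g Y \<and> span Z = K}"
    have "finite ?Z" using Y(1) by simp
    moreover have "?Z \<noteq> {}" using K_def by blast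
    ultimately have "\<exists>X\<in>?Z. \<forall>Z\<in>?Z. Z \<subseteq> X \<longrightarrow> X = Z" by (rule finite_has_minimal)
    then obtain X where XZ: "X \<in> ?Z" and min: "\<forall>Z\<in>?Z. Z \<subseteq> X \<longrightarrow> X = Z" by (rule bexE)
    have X: "X \<subseteq> insert g Y" "span X = K" using XZ by auto
    have Xmin: "span Z \<noteq> K" if "Z \<subset> X" for Z using min that X(1) by blast
    \<comment> \<open>Without \<open>g\<close> the span would stay inside \<open>M\<close>.\<close>
    have gX: "g \<in> X"
    proof (rule ccontr)
      assume "g \<notin> X"
      then have "X \<subseteq> Y" using X(1) by auto
      then have "span X \<subseteq> span Y" using YG by (intro span_mono) auto
      then show False using X(2) Y(3) gK gM by auto
    qed
    moreover have "X \<noteq> {g}" using X(2) ne by auto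
    ultimately obtain x where x: "x \<in> X" "x \<noteq> g" by blast
    have "minimal_generating_set (G\<lparr>carrier := K\<rparr>) (subtopology T K) X"
      unfolding minimal_generating_set_subgroup_iff[OF K Kc] using X gK Xmin by auto
    then have "virtually_independent G T g x"
      unfolding virtually_independent_def using K Ko gX x by blast
    moreover have "x \<in> carrier G" using x X(1) YG by blast
    ultimately show False using iso x(2) by (simp add: isolated_vertex_iff)
  qed
  then show ?thesis using MK by simp
qed

text \<open>An open normal subgroup avoiding \<open>g\<close> gives openness. If \<open>g\<close>
  were not in \<open>cyc x\<close>, some open subgroup above \<open>cyc x\<close> would avoid
  \<open>g\<close> and so lie in \<open>cyc g\<close>, together with \<open>x\<close>.\<close>

lemma isolated_imp_nodal:
  assumes fg: "top_finitely_generated G T" and iso: "isolated_vertex (virt_graph G T) g"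
    and g: "g \<noteq> \<one>"
  shows "nodal g" "openin T (cyc g)"
proof -
  have gG: "g \<in> carrier G" using iso by (simp add: isolated_vertex_iff)
  show "openin T (cyc g)"
  proof -
    obtain N where N: "N \<lhd> G" "openin T N" "g \<notin> N" using open_normal_avoiding[OF gG g] .
    have Ns: "subgroup N G" using N(1) by (rule normal_imp_subgroup)
    have "N \<subseteq> cyc g" using isolated_comparable[OF fg iso Ns N(2,3)] .
    then show ?thesis using openin_subgroup_above[OF N(2) Ns] cyc_subgroup[OF gG] by blast
  qed
  have "g \<in> cyc x" if x: "x \<in> carrier G" "x \<notin> cyc g" for x
  proof (rule ccontr)
    assume "g \<notin> cyc x"
    then obtain K where "subgroup K G" "openin T K" "cyc x \<subseteq> K" "g \<notin> K"
      using closed_subgroup_open_hull[OF cyc_subgroup[OF x(1)] span_closed gG] by blast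
    then show False using isolated_comparable[OF fg iso] cyc_self[OF x(1)] x(2) by blast
  qed
  then show "nodal g" using gG g by (simp add: nodal_def)
qed

text \<open>Of two distinct members of a minimal generating set, neither can lie in the closure of
  the other, for it could then be removed.\<close>

lemma chain_imp_isolated:
  assumes chain: "\<And>x y. x \<in> carrier G \<Longrightarrow> y \<in> carrier G \<Longrightarrow> x \<in> cyc y \<or> y \<in> cyc x"
    and v: "v \<in> carrier G"
  shows "isolated_vertex (virt_graph G T) v"
proof -
  have redundant: False
    if H: "subgroup H G" "openin T H" and X: "minimal_generating_set (G\<lparr>carrier := H\<rparr>) (subtopology T H) X"
      and xy: "x \<in> X" "y \<in> X" "x \<noteq> y" "x \<in> cyc y" for H X x y
  proof -
    have X': "X \<subseteq> H" "span X = H" "\<And>Y. Y \<subset> X \<Longrightarrow> span Y \<noteq> H"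
      using X unfolding minimal_generating_set_subgroup_iff[OF H(1) closedin_open_subgroup[OF H(2,1)]] by auto
    have XG: "X \<subseteq> carrier G" using X'(1) subgroup.subset[OF H(1)] by blast
    have XxG: "X - {x} \<subseteq> carrier G" using XG by blast
    have "cyc y \<subseteq> span (X - {x})" using xy XG by (intro span_mono) auto
    then have "X \<subseteq> span (X - {x})" using subset_span[OF XxG] xy by blast
    then have "span X \<subseteq> span (X - {x})" by (rule span_least[OF _ span_subgroup[OF XxG] span_closed])
    then have "span (X - {x}) = H" using X'(2) span_mono[OF _ XG, of "X - {x}"] by blast
    then show False using X'(3)[of "X - {x}"] xy(1) by blast
  qed
  have "\<not> virtually_independent G T v x" if x: "x \<in> carrier G" "x \<noteq> v" for x
    unfolding virtually_independent_def using redundant chain[OF v x(1)] x(2) by metis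
  then show ?thesis using v by (simp add: isolated_vertex_iff)
qed

end

section \<open>Procyclic pro-p groups\<close>

text \<open>A finite Hausdorff group is discrete.\<close>

lemma (in profinite_group) finite_iso_imp_top_iso:
  assumes fin: "finite (carrier G)" and h: "h \<in> iso G H"
  shows "h \<in> top_iso G T H (discrete_topology (carrier H))"
proof -
  have bij: "bij_betw h (carrier G) (carrier H)" using h by (simp add: iso_def)
  have "openin T U" if "U \<subseteq> carrier G" for U
  proof -
    have "closedin T (carrier G - U)" using fin by (intro closedin_finite) auto
    then show ?thesis using that by (simp add: closedin_def topspace_eq double_diff)
  qed
  then have "continuous_map T (discrete_topology (carrier H)) h"
    using bij by (auto simp: continuous_map_def topspace_eq bij_betw_def)
  then have "homeomorphic_map T (discrete_topology (carrier H)) h"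
    using compact bij by (intro continuous_imp_homeomorphic_map) (auto simp: bij_betw_def topspace_eq)
  then show ?thesis using h by (simp add: top_iso_def)
qed

lemma padic_int_group_simps:
  assumes "p > 0"
  shows "f \<in> carrier (padic_int_group p) \<longleftrightarrow>
      (\<forall>k. 0 \<le> f k \<and> f k < int (p ^ k) \<and> f (Suc k) mod int (p ^ k) = f k)"
    and "f \<otimes>\<^bsub>padic_int_group p\<^esub> h = (\<lambda>k. (f k + h k) mod int (p ^ k))"
    and "\<one>\<^bsub>padic_int_group p\<^esub> = (\<lambda>k. 0)"
  using assms by (auto simp: padic_int_group_def Let_def carrier_integer_mod_group PiE_iff fun_eq_iff)

text \<open>\<open>prime_to_p\<close> encodes that the group is pro-\<open>p\<close>: for every
  other prime \<open>q\<close>, the \<open>q\<close>-th power of the generator still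
  generates.\<close>

locale procyclic_pro_p = profinite_group +
  fixes a :: 'a and p :: nat
  assumes a: "a \<in> carrier G" and generator: "cyc a = carrier G" and p: "prime p"
    and prime_to_p: "\<And>q::nat. prime q \<Longrightarrow> q \<noteq> p \<Longrightarrow> cyc (a [^] q) = cyc a"
begin

abbreviation "filt k \<equiv> cyc (a [^] (p ^ k :: nat))"

lemma comm: "x \<in> carrier G \<Longrightarrow> y \<in> carrier G \<Longrightarrow> x \<otimes> y = y \<otimes> x"
  using cyc_commute[OF a] generator by simp

lemma filt_subgroup: "subgroup (filt k) G"
  using a by (simp add: cyc_subgroup)

lemma filt_0: "filt 0 = carrier G"
  using generator a by simp

lemma filt_decreasing: "j \<le> k \<Longrightarrow> filt k \<subseteq> filt j"
proof -
  assume "j \<le> k"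
  then have "a [^] (p ^ k) = (a [^] (p ^ j)) [^] (p ^ (k - j))"
    using a by (simp add: nat_pow_pow flip: power_add)
  then show ?thesis using cyc_pow_subset a by simp
qed

lemma cyc_coprime_pow: "\<not> p dvd m \<Longrightarrow> m > 0 \<Longrightarrow> cyc (a [^] m) = cyc a"
  by (rule cyc_pow_eq_of_primes[OF a]) (metis prime_to_p)+

text \<open>A power \<open>a [^] n\<close> lies in an open normal subgroup, and the part of
  \<open>n\<close> prime to \<open>p\<close> does not affect the closure.\<close>

lemma open_contains_filt:
  assumes V: "subgroup V G" "openin T V"
  obtains e where "filt e \<subseteq> V"
proof -
  obtain N where N: "N \<lhd> G" "openin T N" "N \<subseteq> V"
    using open_normal_nbhd[OF V(2) subgroup.one_closed[OF V(1)]] .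
  obtain n :: nat where n: "n > 0" "\<And>x. x \<in> carrier G \<Longrightarrow> x [^] n \<in> N"
    using open_normal_pow_mem[OF N(1,2)] by blast
  obtain m where m: "n = p ^ multiplicity p n * m" "\<not> p dvd m"
    using multiplicity_decompose'[of n p] n(1) p by (metis not_prime_unit not_gr0)
  have "m > 0" using m by (cases m) auto
  let ?e = "multiplicity p n"
  have "filt ?e = (\<lambda>y. y [^] (p ^ ?e)) ` cyc (a [^] m)"
    using a cyc_coprime_pow[OF m(2) \<open>m > 0\<close>] by (simp add: cyc_pow)
  also have "\<dots> = cyc ((a [^] m) [^] (p ^ ?e))" using a by (simp add: cyc_pow)
  also have "\<dots> = cyc (a [^] n)" using a m(1) by (simp add: nat_pow_pow mult.commute)
  also have "\<dots> \<subseteq> N"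
    using n(2)[OF a] normal_imp_subgroup[OF N(1)] closedin_open_subgroup[OF N(2)]
    by (intro cyc_subset) auto
  finally show thesis using that N(3) by blast
qed

lemma filt_separated:
  assumes "x \<in> carrier G" "x \<noteq> \<one>" obtains e where "x \<notin> filt e"
proof -
  obtain N where "N \<lhd> G" "openin T N" "x \<notin> N" using open_normal_avoiding[OF assms] .
  then show thesis using open_contains_filt normal_imp_subgroup that by (metis subsetD)
qed

text \<open>With \<open>j\<close> the last index such that \<open>y\<close> is in
  \<open>filt j\<close>, the generator of \<open>filt j\<close> lies in \<open>cyc y\<close>;
  otherwise an open subgroup \<open>V\<close> would separate them.\<close>

lemma cyc_eq_filt:
  assumes y: "y \<in> carrier G" "y \<noteq> \<one>"
  obtains j where "cyc y = filt j"
proof -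
  obtain e where e: "y \<notin> filt e" using filt_separated[OF y] .
  \<comment> \<open>The subtraction is harmless: the least failing index is positive since
    \<open>filt 0\<close> is the whole group.\<close>
  define j where "j = (LEAST n. y \<notin> filt n) - 1"
  have L: "y \<notin> filt (LEAST n. y \<notin> filt n)" using e by (rule LeastI)
  have "(LEAST n. y \<notin> filt n) \<noteq> 0" using L y(1) filt_0 by (metis (no_types, lifting))
  then have j: "Suc j = (LEAST n. y \<notin> filt n)" by (simp add: j_def)
  have yS: "y \<notin> filt (Suc j)" using L j by simp
  have yj: "y \<in> filt j" using not_less_Least[of j "\<lambda>n. y \<notin> filt n"] j by auto
  let ?b = "a [^] (p ^ j)"
  have b: "?b \<in> carrier G" using a by simp
  have "?b \<in> cyc y"
  proof (rule ccontr)
    assume "?b \<notin> cyc y"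
    then obtain V where V: "subgroup V G" "openin T V" "cyc y \<subseteq> V" "?b \<notin> V"
      using closed_subgroup_open_hull[OF cyc_subgroup[OF y(1)] span_closed b] by blast
    obtain e where e: "filt e \<subseteq> V" using open_contains_filt[OF V(1,2)] .
    have be: "?b [^] (p ^ e) = (a [^] (p ^ e)) [^] (p ^ j)" using a by (simp add: nat_pow_pow mult.commute)
    then have beV: "?b [^] (p ^ e) \<in> V"
      using e cyc_nat_pow[of "a [^] (p ^ e)" "p ^ j"] a by auto
    have "e \<noteq> 0"
    proof
      assume "e = 0" then show False using beV V(4) b by simp
    qed
    obtain i c where ic: "i < p ^ e" "c \<in> cyc (?b [^] (p ^ e))" "y = ?b [^] i \<otimes> c"
      using cyc_decomp[OF b _ yj, of "p ^ e"] p prime_gt_0_nat by auto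
    have cG: "c \<in> carrier G" using cyc_carrier[OF _ ic(2)] b by simp
    have cV: "c \<in> V" using cyc_subset[OF V(1) closedin_open_subgroup[OF V(2,1)] beV] ic(2) by blast
    have "y \<in> V" using V(3) cyc_self[OF y(1)] by blast
    moreover have "?b [^] i = y \<otimes> inv c" using ic(3) cG b by (simp add: m_assoc)
    ultimately have "?b [^] i \<in> V" using cV V(1) by (simp add: subgroup.m_closed subgroup.m_inv_closed)
    show False
    \<comment> \<open>If \<open>p\<close> does not divide \<open>i\<close>, then \<open>V\<close>
      contains two coprime powers of \<open>?b\<close>, hence \<open>?b\<close>. Otherwise both
      factors of \<open>y\<close> fall into \<open>filt (Suc j)\<close>, for \<open>c\<close>
      because \<open>e\<close> is positive.\<close>
    proof (cases "p dvd i")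
      case False
      then have "coprime i (p ^ e)" using p by (metis coprime_commute coprime_power_left_iff prime_imp_coprime)
      then show False using pow_mem_coprime[OF V(1) b \<open>?b [^] i \<in> V\<close> beV] V(4) by blast
    next
      case True
      then obtain m where m: "i = p * m" by blast
      have bp: "?b [^] p = a [^] (p ^ Suc j)" using a by (simp add: nat_pow_pow mult.commute)
      have "?b [^] i = (?b [^] p) [^] m" using b m by (simp add: nat_pow_pow)
      then have "?b [^] i \<in> filt (Suc j)" using cyc_nat_pow[OF nat_pow_closed[OF b], of p m] unfolding bp by simp
      moreover have "c \<in> filt (Suc j)"
      proof -
        have "?b [^] (p ^ e) = (?b [^] p) [^] (p ^ (e - 1))"
          using b \<open>e \<noteq> 0\<close> by (cases e) (simp_all add: nat_pow_pow)
        then have "cyc (?b [^] (p ^ e)) \<subseteq> filt (Suc j)"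
          using cyc_pow_subset[OF nat_pow_closed[OF b], of p "p ^ (e - 1)"] unfolding bp by simp
        then show ?thesis using ic(2) by blast
      qed
      ultimately have "y \<in> filt (Suc j)"
        unfolding ic(3) using subgroup.m_closed[OF filt_subgroup] by blast
      then show False using yS by blast
    qed
  qed
  then have "cyc y = filt j" using cyc_least[OF y(1)] cyc_least[OF b yj] by blast
  then show thesis by (rule that)
qed

lemma chain:
  assumes x: "x \<in> carrier G" and y: "y \<in> carrier G"
  shows "x \<in> cyc y \<or> y \<in> cyc x"
proof (cases "x = \<one> \<or> y = \<one>")
  case True
  then show ?thesis using subgroup.one_closed[OF cyc_subgroup] x y by metis
next
  case False
  obtain i where i: "cyc x = filt i" using cyc_eq_filt[OF x] False by blast
  obtain j where j: "cyc y = filt j" using cyc_eq_filt[OF y] False by blast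
  have "filt i \<subseteq> filt j \<or> filt j \<subseteq> filt i" using filt_decreasing nat_le_linear by metis
  then show ?thesis using i j cyc_self x y by blast
qed

lemma finite_cyclic:
  assumes e: "a [^] (p ^ e) = \<one>"
  obtains n \<phi> where "\<phi> \<in> top_iso G T (integer_mod_group (p ^ n)) (discrete_topology (carrier (integer_mod_group (p ^ n))))"
proof -
  have "ord a dvd p ^ e" using e a by (simp add: pow_eq_id)
  then obtain n where n: "ord a = p ^ n" using divides_primepow_nat[OF p] by blast
  have pos: "p ^ n > 0" using p prime_gt_0_nat by simp
  interpret Z: group "integer_mod_group (p ^ n)" by simp
  have carrier: "carrier (integer_mod_group (p ^ n)) = {0..<int (p ^ n)}"
    using p prime_gt_0_nat[OF p] by (simp add: carrier_integer_mod_group)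
  have surj: "\<exists>i<p ^ n. x = a [^] i" if "x \<in> carrier G" for x
    using cyc_torsion[of a "p ^ n" x] that generator a pos n pow_ord_eq_1[OF a] by metis
  have "(\<lambda>i::int. a [^] i) \<in> hom (integer_mod_group (p ^ n)) G"
  proof (rule homI)
    show "a [^] (i \<otimes>\<^bsub>integer_mod_group (p ^ n)\<^esub> j) = a [^] i \<otimes> a [^] j" for i j :: int
    proof -
      have "a [^] ((i + j) mod int (p ^ n)) = a [^] (i + j)"
        using int_pow_eq[OF a] n by (simp add: mod_eq_dvd_iff)
      then show ?thesis using a by (simp add: int_pow_mult)
    qed
  qed (use a in simp)
  then interpret h: group_hom "integer_mod_group (p ^ n)" G "\<lambda>i::int. a [^] i"
    by unfold_locales
  have iso: "(\<lambda>i::int. a [^] i) \<in> iso (integer_mod_group (p ^ n)) G"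
    unfolding h.iso_iff
  proof (intro conjI ballI impI)
    show "carrier G \<subseteq> (\<lambda>i::int. a [^] i) ` carrier (integer_mod_group (p ^ n))"
    proof
      fix x assume "x \<in> carrier G"
      then obtain i where i: "i < p ^ n" "x = a [^] i" using surj by blast
      then have "x = a [^] int i" "int i \<in> carrier (integer_mod_group (p ^ n))"
        by (simp_all add: int_pow_int carrier flip: of_nat_power)
      then show "x \<in> (\<lambda>i::int. a [^] i) ` carrier (integer_mod_group (p ^ n))" by (rule image_eqI)
    qed
    fix i assume i: "i \<in> carrier (integer_mod_group (p ^ n))" and "a [^] i = \<one>"
    then have "int (p ^ n) dvd i" using int_pow_eq_id[OF a] n by simp
    then show "i = \<one>\<^bsub>integer_mod_group (p ^ n)\<^esub>" using i carrier by (auto dest: zdvd_imp_le)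
  qed
  have "carrier G \<subseteq> (\<lambda>i. a [^] i) ` {..<p ^ n}" using surj by blast
  then have "finite (carrier G)" using finite_surj by blast
  then show thesis using finite_iso_imp_top_iso[OF _ Z.iso_set_sym[OF iso]] that by blast
qed

end

section \<open>p-adic coordinates on an infinite procyclic pro-p group\<close>

locale procyclic_infinite = procyclic_pro_p +
  assumes infinite_order: "\<And>e. a [^] (p ^ e :: nat) \<noteq> \<one>"
begin

lemma p_pos: "p > 0" using p prime_gt_0_nat by blast

text \<open>If the \<open>p\<close>-part of \<open>m\<close> were smaller than \<open>p ^ k\<close>,
  two consecutive members of the filtration would coincide. Their generator would then be divisible
  by every prime, hence trivial, against infinite order.\<close>

lemma pow_mem_filt_iff: "a [^] (m::nat) \<in> filt k \<longleftrightarrow> p ^ k dvd m"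
proof
  assume "p ^ k dvd m"
  then obtain n where "m = p ^ k * n" by blast
  then show "a [^] m \<in> filt k"
    using cyc_nat_pow[of "a [^] (p ^ k)" n] a by (simp add: nat_pow_pow)
next
  assume m: "a [^] m \<in> filt k"
  show "p ^ k dvd m"
  proof (cases "m = 0")
    case False
    obtain u where u: "m = p ^ multiplicity p m * u" "\<not> p dvd u"
      using multiplicity_decompose'[of m p] False p by (metis not_prime_unit)
    have "u > 0" using u by (cases u) auto
    let ?j = "multiplicity p m"
    have "k \<le> ?j"
    proof (rule ccontr)
      assume "\<not> k \<le> ?j"
      have "filt ?j = (\<lambda>y. y [^] (p ^ ?j)) ` cyc (a [^] u)"
        using a cyc_coprime_pow[OF u(2) \<open>u > 0\<close>] by (simp add: cyc_pow)
      also have "\<dots> = cyc (a [^] m)" using a u(1) by (simp add: nat_pow_pow mult.commute flip: cyc_pow)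
      also have "\<dots> \<subseteq> filt k" using m a by (simp add: cyc_least)
      also have "\<dots> \<subseteq> filt (Suc ?j)" using \<open>\<not> k \<le> ?j\<close> by (simp add: filt_decreasing del: power_Suc)
      finally have sub: "filt ?j \<subseteq> filt (Suc ?j)" .
      let ?b = "a [^] (p ^ ?j)"
      have b: "?b \<in> carrier G" using a by simp
      have "cyc (?b [^] q) = cyc ?b" if q: "prime q" for q :: nat
      proof (cases "q = p")
        case True
        have "?b [^] q = a [^] (p ^ Suc ?j)" using a True by (simp add: nat_pow_pow mult.commute)
        then show ?thesis using sub filt_decreasing[of ?j "Suc ?j"] by auto
      next
        case False
        have "cyc (?b [^] q) = cyc ((a [^] q) [^] (p ^ ?j))" using a by (simp add: nat_pow_pow mult.commute)
        also have "\<dots> = (\<lambda>y. y [^] (p ^ ?j)) ` cyc a" using a prime_to_p[OF q False] by (simp add: cyc_pow)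
        finally show ?thesis using a by (simp add: cyc_pow)
      qed
      then have "?b = \<one>" using cyc_not_divisible[OF b] cyc_pow_eq_of_primes[OF b] by blast
      then show False using infinite_order by blast
    qed
    then have "p ^ k dvd p ^ ?j" by (rule le_imp_power_dvd)
    then show ?thesis using u(1) by (metis dvd_mult2)
  qed simp
qed

text \<open>A congruence of \<open>x\<close> with \<open>a [^] i\<close> modulo
  \<open>filt k\<close>. The exponent is not restricted to residues, so that exponents can be added
  before they are reduced.\<close>

definition digit :: "nat \<Rightarrow> nat \<Rightarrow> 'a \<Rightarrow> bool" where
  "digit k i x \<longleftrightarrow> inv (a [^] i) \<otimes> x \<in> filt k"

lemma digit_exists:
  assumes x: "x \<in> carrier G" shows "\<exists>i<p ^ k. digit k i x"
proof -
  obtain i c where ic: "i < p ^ k" "c \<in> filt k" "x = a [^] i \<otimes> c"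
    using cyc_decomp[OF a, of "p ^ k" x] p_pos generator x by auto
  have "c \<in> carrier G" using subgroup.mem_carrier[OF filt_subgroup ic(2)] .
  then have "inv (a [^] i) \<otimes> x = c" using ic(3) a by (simp add: m_assoc[symmetric])
  then show ?thesis using ic by (auto simp: digit_def)
qed

text \<open>Symmetry reduces to \<open>i \<le> j\<close>, where the quotient is a power with the
  natural exponent \<open>j - i\<close>.\<close>

lemma digit_pow: "digit k i (a [^] j) \<longleftrightarrow> [i = j] (mod (p ^ k))"
proof -
  have *: "digit k i (a [^] j) \<longleftrightarrow> p ^ k dvd j - i" if "i \<le> j" for i j
  proof -
    have "a [^] j = a [^] i \<otimes> a [^] (j - i)" using that a by (simp add: nat_pow_mult)
    then have "inv (a [^] i) \<otimes> a [^] j = a [^] (j - i)" using a by (simp add: m_assoc[symmetric])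
    then show ?thesis by (simp add: digit_def pow_mem_filt_iff)
  qed
  have sym: "digit k i (a [^] j) \<longleftrightarrow> digit k j (a [^] i)" for i j
  proof -
    have "digit k j (a [^] i)" if "digit k i (a [^] j)" for i j
    proof -
      have "inv (inv (a [^] i) \<otimes> a [^] j) \<in> filt k"
        using that subgroup.m_inv_closed[OF filt_subgroup] by (simp add: digit_def)
      then show ?thesis using a by (simp add: digit_def inv_mult_group)
    qed
    then show ?thesis by blast
  qed
  show ?thesis
  proof (cases "i \<le> j")
    case True then show ?thesis using * cong_altdef_nat[OF True] cong_sym_eq[of i j] by simp
  next
    case False then show ?thesis using * sym[of i j] by (simp add: cong_altdef_nat)
  qed
qed

lemma digit_mult:
  assumes "x \<in> carrier G" "y \<in> carrier G" "digit k i x" "digit k j y"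
  shows "digit k (i + j) (x \<otimes> y)"
proof -
  have c: "inv (a [^] i) \<in> carrier G" "inv (a [^] j) \<in> carrier G" using a by simp_all
  have "(inv (a [^] i) \<otimes> x) \<otimes> (inv (a [^] j) \<otimes> y) \<in> filt k"
    using assms(3,4) subgroup.m_closed[OF filt_subgroup] by (simp add: digit_def)
  also have "(inv (a [^] i) \<otimes> x) \<otimes> (inv (a [^] j) \<otimes> y) = inv (a [^] i) \<otimes> (x \<otimes> inv (a [^] j)) \<otimes> y"
    using c assms by (simp add: m_assoc)
  also have "x \<otimes> inv (a [^] j) = inv (a [^] j) \<otimes> x" using comm c assms by blast
  also have "inv (a [^] i) \<otimes> (inv (a [^] j) \<otimes> x) \<otimes> y = inv (a [^] j \<otimes> a [^] i) \<otimes> (x \<otimes> y)"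
    using c assms a by (simp add: m_assoc inv_mult_group)
  also have "a [^] j \<otimes> a [^] i = a [^] (i + j)" using a by (simp add: nat_pow_mult add.commute)
  finally show ?thesis by (simp add: digit_def)
qed

lemma digit_cong:
  assumes x: "x \<in> carrier G" and i: "digit k i x"
  shows "digit k j x \<longleftrightarrow> [j = i] (mod (p ^ k))"
proof -
  have c: "inv (a [^] i) \<otimes> x \<in> filt k" using i by (simp add: digit_def)
  have "inv (a [^] j) \<otimes> x = (inv (a [^] j) \<otimes> a [^] i) \<otimes> (inv (a [^] i) \<otimes> x)"
  proof -
    have "(inv (a [^] j) \<otimes> a [^] i) \<otimes> (inv (a [^] i) \<otimes> x) = inv (a [^] j) \<otimes> (a [^] i \<otimes> inv (a [^] i)) \<otimes> x"
      using a x by (simp only: m_assoc m_closed inv_closed nat_pow_closed)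
    then show ?thesis using a x by simp
  qed
  then have "digit k j x \<longleftrightarrow> inv (a [^] j) \<otimes> a [^] i \<in> filt k"
    unfolding digit_def
    using c a x subgroup.m_closed[OF filt_subgroup] subgroup.m_inv_closed[OF filt_subgroup c]
    by (smt (verit, best) inv_closed inv_solve_right m_closed nat_pow_closed)
  then show ?thesis using digit_pow[of k j i] by (simp add: digit_def)
qed

lemma digit_Suc: "digit (Suc k) i x \<Longrightarrow> digit k i x"
  unfolding digit_def using filt_decreasing[of k "Suc k"] by auto

text \<open>The coordinate of \<open>x\<close> in the quotient by \<open>filt k\<close>, identified
  with the integers modulo \<open>p ^ k\<close>; by \<open>digit_cong\<close> the choice is
  unique.\<close>

definition \<phi> :: "'a \<Rightarrow> nat \<Rightarrow> int" where
  "\<phi> x k = int (SOME i. i < p ^ k \<and> digit k i x)"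

lemma \<phi>_digit:
  assumes x: "x \<in> carrier G"
  shows "\<phi> x k = int i \<longleftrightarrow> i < p ^ k \<and> digit k i x"
proof -
  define j where "j = (SOME i. i < p ^ k \<and> digit k i x)"
  have j: "j < p ^ k" "digit k j x"
    using someI_ex[OF digit_exists[OF x, of k]] by (auto simp: j_def)
  have "i < p ^ k \<and> digit k i x \<longleftrightarrow> i = j"
    using digit_cong[OF x j(2), of i] j cong_less_modulus_unique_nat by blast
  then show ?thesis by (auto simp: \<phi>_def j_def)
qed

lemma \<phi>_nat: assumes x: "x \<in> carrier G"
  obtains i where "\<phi> x k = int i" "i < p ^ k" "digit k i x"
  using digit_exists[OF x, of k] \<phi>_digit[OF x] by blast

lemma digit_imp_\<phi>:
  assumes x: "x \<in> carrier G" and i: "digit k i x"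
  shows "\<phi> x k = int i mod int (p ^ k)"
proof -
  have "digit k (i mod p ^ k) x" using digit_cong[OF x i] by (simp add: cong_def)
  then have "\<phi> x k = int (i mod p ^ k)" using \<phi>_digit[OF x] p_pos by simp
  then show ?thesis by (simp add: of_nat_mod)
qed

lemma \<phi>_carrier:
  assumes x: "x \<in> carrier G" shows "\<phi> x \<in> carrier (padic_int_group p)"
  unfolding padic_int_group_simps(1)[OF p_pos]
proof (intro allI conjI)
  fix k
  obtain i where i: "\<phi> x k = int i" "i < p ^ k" using \<phi>_nat[OF x] by blast
  then show "0 \<le> \<phi> x k" "\<phi> x k < int (p ^ k)" by (simp_all only: of_nat_0_le_iff of_nat_less_iff)
  obtain j where j: "\<phi> x (Suc k) = int j" "digit (Suc k) j x" using \<phi>_nat[OF x] by blast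
  then show "\<phi> x (Suc k) mod int (p ^ k) = \<phi> x k"
    using digit_imp_\<phi>[OF x digit_Suc] by simp
qed

lemma \<phi>_hom: "\<phi> \<in> hom G (padic_int_group p)"
proof (rule homI)
  fix x y assume xy: "x \<in> carrier G" "y \<in> carrier G"
  show "\<phi> (x \<otimes> y) = \<phi> x \<otimes>\<^bsub>padic_int_group p\<^esub> \<phi> y"
    unfolding padic_int_group_simps(2)[OF p_pos]
  proof
    fix k
    obtain i where i: "\<phi> x k = int i" "digit k i x" using \<phi>_nat[OF xy(1)] by blast
    obtain j where j: "\<phi> y k = int j" "digit k j y" using \<phi>_nat[OF xy(2)] by blast
    show "\<phi> (x \<otimes> y) k = (\<phi> x k + \<phi> y k) mod int (p ^ k)"
      using digit_imp_\<phi>[OF _ digit_mult[OF xy i(2) j(2)]] xy i(1) j(1) by simp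
  qed
qed (rule \<phi>_carrier)

lemma closedin_digit: "closedin T {x \<in> carrier G. digit k i x}"
  unfolding digit_def using a
  by (intro closedin_preimage continuous_intros_group span_closed) auto

text \<open>The compatible residues of \<open>f\<close> describe a decreasing sequence of nonempty
  closed cosets, which meet by compactness.\<close>

lemma \<phi>_surj:
  assumes f: "f \<in> carrier (padic_int_group p)"
  shows "\<exists>x\<in>carrier G. \<phi> x = f"
proof -
  have f': "0 \<le> f k" "f k < int (p ^ k)" "f (Suc k) mod int (p ^ k) = f k" for k
    using f unfolding padic_int_group_simps(1)[OF p_pos] by auto
  let ?C = "\<lambda>k. {x \<in> carrier G. digit k (nat (f k)) x}"
  have "decseq ?C"
  proof (rule decseq_SucI, rule subsetI)
    fix k x assume "x \<in> ?C (Suc k)"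
    then have x: "x \<in> carrier G" and "digit k (nat (f (Suc k))) x" using digit_Suc by auto
    then have "\<phi> x k = f k" using digit_imp_\<phi>[OF x] f' by simp
    then have "\<phi> x k = int (nat (f k))" using f' by simp
    then have "digit k (nat (f k)) x" using \<phi>_digit[OF x] by blast
    then show "x \<in> ?C k" using x by simp
  qed
  moreover have "?C k \<noteq> {}" for k
    using digit_pow[of k "nat (f k)" "nat (f k)"] a by (auto intro!: exI[of _ "a [^] nat (f k)"])
  ultimately have "(\<Inter>k. ?C k) \<noteq> {}"
    using compact_space_imp_nest[OF compact, of ?C] closedin_digit by blast
  then obtain x where x: "\<And>k. x \<in> ?C k" by blast
  have "\<phi> x = f"
  proof
    fix k
    have "nat (f k) < p ^ k" using f'[of k] by (simp add: nat_less_iff)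
    then have "\<phi> x k = int (nat (f k))" using x[of k] \<phi>_digit by blast
    then show "\<phi> x k = f k" using f' by simp
  qed
  then show ?thesis using x by blast
qed

lemma \<phi>_iso: "\<phi> \<in> iso G (padic_int_group p)"
proof -
  interpret P: group "padic_int_group p" using p_pos by (rule group_padic_int_group)
  interpret h: group_hom G "padic_int_group p" \<phi> using \<phi>_hom by unfold_locales
  show ?thesis
    unfolding h.iso_iff
  proof (intro conjI ballI impI)
    show "carrier (padic_int_group p) \<subseteq> \<phi> ` carrier G" using \<phi>_surj by blast
    fix x assume x: "x \<in> carrier G" and "\<phi> x = \<one>\<^bsub>padic_int_group p\<^esub>"
    then have "\<phi> x k = int 0" for k by (simp add: padic_int_group_simps(3)[OF p_pos])
    then have "digit k 0 x" for k using \<phi>_digit[OF x] by blast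
    then have "x \<in> filt k" for k using x by (simp add: digit_def)
    then show "x = \<one>" using filt_separated[OF x] by blast
  qed
qed

text \<open>Each coordinate takes finitely many values, and the preimage of a set of values is a
  finite union of closed cosets.\<close>

lemma continuous_\<phi>: "continuous_map T (padic_int_topology p) \<phi>"
proof -
  have "continuous_map T (discrete_topology (carrier (integer_mod_group (p ^ k)))) (\<lambda>x. \<phi> x k)" for k
    unfolding continuous_map_closedin
  proof (intro conjI ballI allI impI)
    have carrier: "carrier (integer_mod_group (p ^ k)) = {0..<int (p ^ k)}"
      using p_pos by (simp add: carrier_integer_mod_group)
    have mem: "\<phi> x k \<in> {0..<int (p ^ k)}" if "x \<in> carrier G" for x
      using \<phi>_carrier[OF that] unfolding padic_int_group_simps(1)[OF p_pos] by auto
    then show "(\<lambda>x. \<phi> x k) \<in> topspace T \<rightarrow> topspace (discrete_topology (carrier (integer_mod_group (p ^ k))))"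
      by (auto simp: topspace_eq carrier)
    fix U assume "closedin (discrete_topology (carrier (integer_mod_group (p ^ k)))) U"
    then have U: "U \<subseteq> {0..<int (p ^ k)}" by (simp add: carrier)
    have "{x \<in> topspace T. \<phi> x k \<in> U} = (\<Union>i\<in>{i. int i \<in> U}. {x \<in> carrier G. digit k i x})" (is "?L = ?R")
    proof
      show "?L \<subseteq> ?R"
      proof
        fix x assume "x \<in> ?L"
        then have x: "x \<in> carrier G" "\<phi> x k \<in> U" by (auto simp: topspace_eq)
        obtain i where "\<phi> x k = int i" "digit k i x" using \<phi>_nat[OF x(1)] by blast
        then show "x \<in> ?R" using x by auto
      qed
      show "?R \<subseteq> ?L"
      proof
        fix x assume "x \<in> ?R"
        then obtain i where i: "int i \<in> U" "x \<in> carrier G" "digit k i x" by blast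
        then have "i < p ^ k" using U by (metis atLeastLessThan_iff of_nat_less_iff subsetD)
        then have "\<phi> x k = int i" using \<phi>_digit i by blast
        then show "x \<in> ?L" using i by (simp add: topspace_eq)
      qed
    qed
    moreover have "finite {i. int i \<in> U}"
      using finite_vimageI[OF finite_subset[OF U], of int] by (simp add: vimage_def)
    ultimately show "closedin T {x \<in> topspace T. \<phi> x k \<in> U}"
      using closedin_digit by (auto intro!: closedin_Union)
  qed
  then show ?thesis
    unfolding padic_int_topology_def using \<phi>_carrier
    by (auto simp: continuous_map_in_subtopology continuous_map_componentwise_UNIV topspace_eq)
qed

lemma \<phi>_top_iso: "\<phi> \<in> top_iso G T (padic_int_group p) (padic_int_topology p)"
proof -
  have bij: "bij_betw \<phi> (carrier G) (carrier (padic_int_group p))"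
    using \<phi>_iso by (simp add: iso_def)
  have top: "topspace (padic_int_topology p) = carrier (padic_int_group p)"
    by (auto simp: padic_int_topology_def padic_int_group_def Let_def)
  have "Hausdorff_space (padic_int_topology p)"
    unfolding padic_int_topology_def
    by (intro Hausdorff_space_subtopology) (simp add: Hausdorff_space_product_topology)
  then have "homeomorphic_map T (padic_int_topology p) \<phi>"
    using compact continuous_\<phi> bij by (intro continuous_imp_homeomorphic_map) (auto simp: bij_betw_def topspace_eq top)
  then show ?thesis using \<phi>_iso by (simp add: top_iso_def)
qed

end

section \<open>The classification\<close>

context profinite_group begin

lemma odd_pow_involution:
  assumes "x \<in> carrier G" "x [^] (2::nat) = \<one>" "odd n"
  shows "x [^] (n::nat) = x"
proof -
  obtain m where "n = 2 * m + 1" using assms(3) by (rule oddE)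
  then have "x [^] n = (x [^] (2::nat)) [^] m \<otimes> x" using assms(1) by (simp add: nat_pow_pow)
  then show ?thesis using assms(1,2) by simp
qed

text \<open>The two outcomes are told apart by whether some \<open>p\<close>-power of the generator
  is trivial.\<close>

lemma procyclic_case:
  assumes g: "nodal g" "openin T (cyc g)" "cyc g \<noteq> carrier G"
    and a: "a \<in> carrier G" "cyc a = carrier G"
  shows "((\<exists>p n. prime p \<and>
          top_iso G T (integer_mod_group (p ^ n))
            (discrete_topology (carrier (integer_mod_group (p ^ n)))) \<noteq> {})
       \<and> (\<forall>v \<in> carrier G. isolated_vertex (virt_graph G T) v))
    \<or> ((\<exists>p. prime p \<and>
          top_iso G T (padic_int_group p) (padic_int_topology p) \<noteq> {})
       \<and> (\<forall>v \<in> carrier G. isolated_vertex (virt_graph G T) v))"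
proof -
  have gG: "g \<in> carrier G" using g(1) by (simp add: nodal_def)
  have fin: "finite (rcosets (cyc g))" using finite_rcosets_open[OF cyc_subgroup[OF gG] g(2)] .
  obtain p x where "nodal_prime G cyc g p x" using nodal_primeE[OF g(1) fin g(3)] .
  then interpret nodal_prime G cyc g p x .
  interpret procyclic_pro_p G T a p
    using a p cyc_coprime_pow_procyclic[OF a] by unfold_locales auto
  have iso: "\<forall>v \<in> carrier G. isolated_vertex (virt_graph G T) v"
    using chain_imp_isolated chain by blast
  show ?thesis
  proof (cases "\<exists>e. a [^] (p ^ e) = \<one>")
    case True
    then obtain e where "a [^] (p ^ e) = \<one>" by blast
    then obtain n \<phi> where "\<phi> \<in> top_iso G T (integer_mod_group (p ^ n)) (discrete_topology (carrier (integer_mod_group (p ^ n))))"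
      by (rule finite_cyclic)
    then show ?thesis using iso p by blast
  next
    case False
    then interpret procyclic_infinite G T a p by unfold_locales auto
    show ?thesis using \<phi>_top_iso iso p by blast
  qed
qed

text \<open>Uniqueness of \<open>g\<close>: another isolated vertex must be an involution too, since
  otherwise the climb from it would make the group procyclic; and two comparable subgroups of order
  2 coincide.\<close>

lemma quaternion_case:
  assumes fg: "top_finitely_generated G T"
    and g: "isolated_vertex (virt_graph G T) g" "g \<noteq> \<one>" "g [^] (2::nat) = \<one>"
    and fin: "finite (carrier G)" and not_cyclic: "\<And>a. a \<in> carrier G \<Longrightarrow> cyc a \<noteq> carrier G"
    and gens: "quaternion_generators G n a y" "y [^] (2::nat) = g"
  shows "\<exists>n \<ge> 3. \<exists>\<phi> \<in> top_iso G T (quaternion_group n)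
            (discrete_topology (carrier (quaternion_group n))).
          \<phi> g = quaternion_y n [^]\<^bsub>quaternion_group n\<^esub> (2::nat)
          \<and> (\<forall>v. isolated_vertex (virt_graph G T) v \<and> v \<noteq> \<one>\<^bsub>G\<^esub> \<longleftrightarrow> v = g)"
proof -
  obtain \<phi> where \<phi>: "\<phi> \<in> iso G (quaternion_group n)" "\<phi> y = quaternion_y n"
    using quaternion_group_iso[OF gens(1)] .
  interpret h: group_hom G "quaternion_group n" \<phi>
    using \<phi>(1) quaternion_group_group by (simp add: group_hom_def group_hom_axioms_def iso_def is_group)
  have y: "y \<in> carrier G" "n \<ge> 3" using gens(1) by (auto simp: quaternion_generators_def)
  have "\<phi> g = quaternion_y n [^]\<^bsub>quaternion_group n\<^esub> (2::nat)"
    using gens(2) \<phi>(2) y h.hom_nat_pow by metis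
  moreover have "v = g" if v: "isolated_vertex (virt_graph G T) v" "v \<noteq> \<one>" for v
  proof -
    have vG: "v \<in> carrier G" and gG: "g \<in> carrier G" using v(1) g(1) by (simp_all add: isolated_vertex_iff)
    have "v [^] (2::nat) = \<one>"
    proof (rule ccontr)
      assume "v [^] (2::nat) \<noteq> \<one>"
      then show False
        using nodal_imp_procyclic[OF isolated_imp_nodal(1)[OF fg v]] not_cyclic
          finite_rcosets_open[OF cyc_subgroup[OF vG] isolated_imp_nodal(2)[OF fg v]] by blast
    qed
    moreover have "g \<in> cyc v \<or> v \<in> cyc g"
      using isolated_imp_nodal(1)[OF fg g(1,2)] vG by (auto simp: nodal_def)
    ultimately obtain i where "i < (2::nat)" "g = v [^] i \<or> v = g [^] i"
      using cyc_torsion[OF vG _ pos2] cyc_torsion[OF gG g(3) pos2] by metis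
    then show ?thesis using v(2) g(2) vG gG by (auto simp: less_2_cases_iff)
  qed
  ultimately show ?thesis using finite_iso_imp_top_iso[OF fin \<phi>(1)] y(2) g(1,2) by blast
qed

end

theorem theorem3:
  fixes G :: "('a, 'b) monoid_scheme" and T :: "'a topology" and g :: 'a
  assumes "profinite_group G T"
    and "top_finitely_generated G T"
    and "isolated_vertex (virt_graph G T) g"
    and "g \<noteq> \<one>\<^bsub>G\<^esub>"
  shows "top_generates G T {g}
    \<or> ((\<exists>p n. prime p \<and>
          top_iso G T (integer_mod_group (p ^ n))
            (discrete_topology (carrier (integer_mod_group (p ^ n)))) \<noteq> {})
       \<and> (\<forall>v \<in> carrier G. isolated_vertex (virt_graph G T) v))
    \<or> ((\<exists>p. prime p \<and>
          top_iso G T (padic_int_group p) (padic_int_topology p) \<noteq> {})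
       \<and> (\<forall>v \<in> carrier G. isolated_vertex (virt_graph G T) v))
    \<or> (\<exists>n \<ge> 3. \<exists>\<phi> \<in> top_iso G T (quaternion_group n)
            (discrete_topology (carrier (quaternion_group n))).
          \<phi> g = quaternion_y n [^]\<^bsub>quaternion_group n\<^esub> (2::nat)
          \<and> (\<forall>v. isolated_vertex (virt_graph G T) v \<and> v \<noteq> \<one>\<^bsub>G\<^esub> \<longleftrightarrow> v = g))"
proof -
  interpret profinite_group G T by (rule assms(1))
  have gG: "g \<in> carrier G" using assms(3) by (simp add: isolated_vertex_iff)
  have nodal: "nodal g" and op: "openin T (cyc g)" using isolated_imp_nodal[OF assms(2-4)] by auto
  have fin: "finite (rcosets\<^bsub>G\<^esub> (cyc g))" using finite_rcosets_open[OF cyc_subgroup[OF gG] op] .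
  show ?thesis
  proof (cases "cyc g = carrier G")
    case True
    then show ?thesis using gG by (simp add: top_generates_iff)
  next
    case ne: False
    obtain p x where "nodal_prime G cyc g p x" using nodal_primeE[OF nodal fin ne] .
    then interpret nodal_prime G cyc g p x .
    show ?thesis
    proof (cases "\<exists>a\<in>carrier G. cyc a = carrier G")
      case True
      then obtain a where a: "a \<in> carrier G" "cyc a = carrier G" by (rule bexE)
      have "B \<or> C \<Longrightarrow> A \<or> B \<or> C \<or> D" for A B C D by blast
      from this[OF procyclic_case[OF nodal op ne a]] show ?thesis .
    next
      case False
      then have not_cyclic: "cyc a \<noteq> carrier G" if "a \<in> carrier G" for a using that by simp
      have g2: "g [^]\<^bsub>G\<^esub> (2::nat) = \<one>\<^bsub>G\<^esub>"
        using False nodal_imp_procyclic[OF nodal fin] by (rule contrapos_np)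
      \<comment> \<open>For odd \<open>p\<close> the involution \<open>g\<close> would equal
        \<open>g [^] p\<close>, contradicting \<open>cyc_g_pow_p\<close>.\<close>
      have "p = 2"
      proof (rule ccontr)
        assume "p \<noteq> 2"
        then have "odd p" using p primes_dvd_imp_eq[OF two_is_prime_nat p] by auto
        then have "g [^]\<^bsub>G\<^esub> p = g" by (rule odd_pow_involution[OF gG g2])
        then show False using cyc_g_pow_p by simp
      qed
      from quaternion_or_procyclic[OF this g2] False obtain n a y
        where "finite (carrier G)" "quaternion_generators G n a y" "y [^]\<^bsub>G\<^esub> (2::nat) = g"
        by (elim disjE conjE exE) simp_all
      then show ?thesis
        by (intro disjI2) (rule quaternion_case[OF assms(2-4) g2 _ not_cyclic])
    qed
  qed
qed

end
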